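(* Let $f:\mathbb R^{n+1}\to\mathbb R$ be smooth and let $\Sigma\subset\mathbb R^{n+1}$ be a two-sided, smooth, properly immersed hypersurface with unit normal $N$. Then $\delta\mathcal A_f(u)=0$ for all $u\in C_0^\infty(\Sigma)$ with $\int_\Sigma u\,d\mathcal A_f=0$ if and only if $H+\langle\nabla f,N\rangle$ is constant on $\Sigma$.
   Context: $d\mathcal A$ is the $n$-dimensional area measure on $\Sigma$ and $d\mathcal A_f=e^f\,d\mathcal A$. The mean curvature is $H=\operatorname{div}N$; $\nabla f$ is the gradient of $f$ in $\mathbb R^{n+1}$. $\Sigma$ need not be connected; an orientation is chosen on each component. A compact normal variation of $\Sigma$ is a smooth map $F:(-\epsilon,\epsilon)\times\Sigma\to\mathbb R^{n+1}$ with $F(0,\cdot)$ the given immersion, $F(t,\cdot)$ independent of $t$ outside a compact set, and $\partial_tF$ normal to $\Sigma_t=F(t,\Sigma)$ for all $t$. The first variation $\delta\mathcal A_f(u)$ is the derivative at $t=0$ of the weighted area $\mathcal A_f(\Sigma_t)$ (computed on the compact set where $F$ varies) for a compact normal variation with $\langle\partial_tF(0,x),N(x)\rangle=u(x)$; it depends only on $u$. *)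

theory Defs
  imports "HOL-Analysis.Analysis"
begin

section \<open>Smooth maps between Euclidean spaces\<close>

text \<open>Intended for open \<open>S\<close>: in finite dimension, \<open>C_k_on k S f\<close> says that \<open>f\<close> is of class \<open>C\<^sup>k\<close> on
  \<open>S\<close>, by recursion on the directional derivatives.\<close>

primrec C_k_on :: "nat \<Rightarrow> 'a::real_normed_vector set \<Rightarrow> ('a \<Rightarrow> 'b::real_normed_vector) \<Rightarrow> bool" where
  "C_k_on 0 S f \<longleftrightarrow> continuous_on S f"
| "C_k_on (Suc k) S f \<longleftrightarrow>
     (\<forall>x\<in>S. f differentiable (at x)) \<and> (\<forall>v. C_k_on k S (\<lambda>x. frechet_derivative f (at x) v))"

definition smooth_on :: "'a::real_normed_vector set \<Rightarrow> ('a \<Rightarrow> 'b::real_normed_vector) \<Rightarrow> bool" where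
  "smooth_on S f \<longleftrightarrow> (\<forall>k. C_k_on k S f)"

definition gradient :: "('a::real_inner \<Rightarrow> real) \<Rightarrow> 'a \<Rightarrow> 'a" where
  "gradient f x = (THE D. GDERIV f x :> D)"

definition partial :: "(real^'n \<Rightarrow> 'b::real_normed_vector) \<Rightarrow> 'n \<Rightarrow> real^'n \<Rightarrow> 'b" where
  "partial g i y = frechet_derivative g (at y) (axis i 1)"


section \<open>Smooth manifolds\<close>

text \<open>An \<open>n\<close>-manifold is the whole of a Hausdorff, second countable type \<open>'p\<close> together with an
  atlas, given as a set of local parametrizations \<open>(V, \<psi>)\<close>: \<open>V\<close> is open in \<open>\<real>\<^sup>n\<close> and
  \<open>\<psi>\<close> maps it homeomorphically onto an open subset of the manifold. So charts are the inverses of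
  the \<open>\<psi>\<close>. The values of \<open>\<psi>\<close> outside \<open>V\<close> are irrelevant.\<close>

type_synonym ('n, 'p) atlas = "((real^'n) set \<times> (real^'n \<Rightarrow> 'p)) set"

definition smooth_atlas :: "('n::finite, 'p::{t2_space,second_countable_topology}) atlas \<Rightarrow> bool" where
  "smooth_atlas \<A> \<longleftrightarrow>
     (\<forall>(V, \<psi>)\<in>\<A>. open V \<and> open (\<psi> ` V) \<and> homeomorphism V (\<psi> ` V) \<psi> (inv_into V \<psi>)) \<and>
     (\<Union>(V, \<psi>)\<in>\<A>. \<psi> ` V) = UNIV \<and>
     (\<forall>(V, \<psi>)\<in>\<A>. \<forall>(W, \<phi>)\<in>\<A>. smooth_on (V \<inter> \<psi> -` (\<phi> ` W)) (inv_into W \<phi> \<circ> \<psi>))"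

definition smooth_map :: "('n::finite, 'p) atlas \<Rightarrow> ('p \<Rightarrow> 'b::real_normed_vector) \<Rightarrow> bool" where
  "smooth_map \<A> h \<longleftrightarrow> (\<forall>(V, \<psi>)\<in>\<A>. smooth_on V (h \<circ> \<psi>))"

definition smooth_compact_support ::
    "('n::finite, 'p::topological_space) atlas \<Rightarrow> ('p \<Rightarrow> real) \<Rightarrow> bool" where
  "smooth_compact_support \<A> u \<longleftrightarrow> smooth_map \<A> u \<and> compact (closure {p. u p \<noteq> 0})"

definition param_at :: "('n::finite, 'p) atlas \<Rightarrow> 'p \<Rightarrow> (real^'n) set \<times> (real^'n \<Rightarrow> 'p)" where
  "param_at \<A> p = (SOME (V, \<psi>). (V, \<psi>) \<in> \<A> \<and> p \<in> \<psi> ` V)"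


section \<open>Two-sided, properly immersed hypersurfaces\<close>

definition smooth_immersion ::
    "('n::finite, 'p) atlas \<Rightarrow> ('p \<Rightarrow> 'b::real_normed_vector) \<Rightarrow> bool" where
  "smooth_immersion \<A> X \<longleftrightarrow> smooth_map \<A> X \<and>
     (\<forall>(V, \<psi>)\<in>\<A>. \<forall>y\<in>V. inj (frechet_derivative (X \<circ> \<psi>) (at y)))"

definition normal_at :: "('n::finite, 'p) atlas \<Rightarrow> ('p \<Rightarrow> 'b::real_inner) \<Rightarrow> 'p \<Rightarrow> 'b \<Rightarrow> bool" where
  "normal_at \<A> X p w \<longleftrightarrow> (\<forall>(V, \<psi>)\<in>\<A>. \<forall>y\<in>V. \<psi> y = p \<longrightarrow>
     (\<forall>v. w \<bullet> frechet_derivative (X \<circ> \<psi>) (at y) v = 0))"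

definition unit_normal_field ::
    "('n::finite, 'p) atlas \<Rightarrow> ('p \<Rightarrow> 'b::real_inner) \<Rightarrow> ('p \<Rightarrow> 'b) \<Rightarrow> bool" where
  "unit_normal_field \<A> X N \<longleftrightarrow>
     smooth_map \<A> N \<and> (\<forall>p. norm (N p) = 1 \<and> normal_at \<A> X p (N p))"

definition two_sided_proper_hypersurface ::
    "('n::finite, 'p::{t2_space,second_countable_topology}) atlas \<Rightarrow>
     ('p \<Rightarrow> real^'m::finite) \<Rightarrow> ('p \<Rightarrow> real^'m) \<Rightarrow> bool" where
  "two_sided_proper_hypersurface \<A> X N \<longleftrightarrow>
     CARD('m) = CARD('n) + 1 \<and> smooth_atlas \<A> \<and> smooth_immersion \<A> X \<and>
     proper_map euclidean euclidean X \<and> unit_normal_field \<A> X N"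

definition gram :: "(real^'n \<Rightarrow> 'b::real_inner) \<Rightarrow> real^'n \<Rightarrow> real^'n^'n" where
  "gram g y = (\<chi> i j. partial g i y \<bullet> partial g j y)"

text \<open>The divergence \<open>\<Sum>\<^sub>i \<langle>D\<^bsub>e\<^sub>i\<^esub> Z, e\<^sub>i\<rangle>\<close> over an orthonormal tangent
  frame, written in the coordinate frame as \<open>g\<^sup>i\<^sup>j \<langle>\<partial>\<^sub>i Z, \<partial>\<^sub>j X\<rangle>\<close>.\<close>

definition surface_div ::
    "('n::finite, 'p) atlas \<Rightarrow> ('p \<Rightarrow> 'b::real_inner) \<Rightarrow> ('p \<Rightarrow> 'b) \<Rightarrow> 'p \<Rightarrow> real" where
  "surface_div \<A> X Z p =
     (let (V, \<psi>) = param_at \<A> p; y = inv_into V \<psi> p in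
      \<Sum>i\<in>UNIV. \<Sum>j\<in>UNIV. matrix_inv (gram (X \<circ> \<psi>) y) $ i $ j *
        (partial (Z \<circ> \<psi>) i y \<bullet> partial (X \<circ> \<psi>) j y))"

definition mean_curvature ::
    "('n::finite, 'p) atlas \<Rightarrow> ('p \<Rightarrow> 'b::real_inner) \<Rightarrow> ('p \<Rightarrow> 'b) \<Rightarrow> 'p \<Rightarrow> real" where
  "mean_curvature \<A> X N = surface_div \<A> X N"


section \<open>Weighted area\<close>

text \<open>The measure on the manifold induced by a smooth map \<open>Y\<close> into Euclidean space: the Borel
  measure which is \<open>\<surd>det(g\<^sub>i\<^sub>j) dy\<close> in every local parametrization. It measures the
  parameter manifold, so the area of the image is counted with multiplicity.\<close>

definition area_measure ::
    "('n::finite, 'p::topological_space) atlas \<Rightarrow> ('p \<Rightarrow> 'b::real_inner) \<Rightarrow> 'p measure" where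
  "area_measure \<A> Y = (THE \<mu>. sets \<mu> = sets borel \<and>
     (\<forall>(V, \<psi>)\<in>\<A>. \<forall>B\<in>sets borel. B \<subseteq> \<psi> ` V \<longrightarrow>
        emeasure \<mu> B = (\<integral>\<^sup>+ y\<in>(V \<inter> \<psi> -` B). ennreal (sqrt (det (gram (Y \<circ> \<psi>) y))) \<partial>lborel)))"

definition weighted_area_measure ::
    "('n::finite, 'p::topological_space) atlas \<Rightarrow> ('b::real_inner \<Rightarrow> real) \<Rightarrow> ('p \<Rightarrow> 'b) \<Rightarrow> 'p measure" where
  "weighted_area_measure \<A> f Y = density (area_measure \<A> Y) (\<lambda>p. ennreal (exp (f (Y p))))"


section \<open>First variation\<close>

definition compact_normal_variation ::
    "('n::finite, 'p::topological_space) atlas \<Rightarrow> ('p \<Rightarrow> 'b::real_inner) \<Rightarrow>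
     real \<Rightarrow> 'p set \<Rightarrow> (real \<Rightarrow> 'p \<Rightarrow> 'b) \<Rightarrow> bool" where
  "compact_normal_variation \<A> X \<epsilon> K F \<longleftrightarrow>
     \<epsilon> > 0 \<and> compact K \<and>
     (\<forall>(V, \<psi>)\<in>\<A>. smooth_on ({-\<epsilon><..<\<epsilon>} \<times> V) (\<lambda>(t, y). F t (\<psi> y))) \<and>
     (\<forall>p. F 0 p = X p) \<and>
     (\<forall>t\<in>{-\<epsilon><..<\<epsilon>}. \<forall>p. p \<notin> K \<longrightarrow> F t p = X p) \<and>
     (\<forall>t\<in>{-\<epsilon><..<\<epsilon>}. \<forall>p. normal_at \<A> (F t) p (vector_derivative (\<lambda>s. F s p) (at t)))"

text \<open>The first variation in the direction \<open>u\<close>. All compact normal variations with initial normal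
  speed \<open>u\<close> (which exist for \<open>u \<in> C\<^sub>0\<^sup>\<infinity>\<close>), and all compact sets \<open>K\<close> outside which they
  are constant, yield the same derivative.\<close>

definition first_variation ::
    "('n::finite, 'p::topological_space) atlas \<Rightarrow> ('b::real_inner \<Rightarrow> real) \<Rightarrow> ('p \<Rightarrow> 'b) \<Rightarrow>
     ('p \<Rightarrow> 'b) \<Rightarrow> ('p \<Rightarrow> real) \<Rightarrow> real" where
  "first_variation \<A> f X N u = (THE D. \<exists>\<epsilon> K F.
     compact_normal_variation \<A> X \<epsilon> K F \<and>
     (\<forall>p. vector_derivative (\<lambda>t. F t p) (at 0) \<bullet> N p = u p) \<and>
     ((\<lambda>t. measure (weighted_area_measure \<A> f (F t)) K) has_real_derivative D) (at 0))"

end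

theory Submission
  imports Defs
begin

text \<open>For a normal variation with initial normal speed \<open>u\<close>, differentiating the area density in a
  chart (Jacobi's formula for the Gram determinant) gives \<open>\<delta>\<A>\<^sub>f(u) = \<integral> u h d\<A>\<^sub>f\<close> with
  \<open>h = H + \<langle>\<nabla>f, N\<rangle>\<close>; the velocity has no tangential part, so the divergence theorem is not needed.
  Hence a constant \<open>h\<close> is critical, and if \<open>h(p) < h(q)\<close>, a difference of two bump functions near
  \<open>q\<close> and \<open>p\<close> with equal weighted integrals has nonzero first variation.

  Since the first variation is a definite description, a normal variation has to be exhibited for every
  \<open>u\<close>. It is \<open>X + t u N\<close>, reparametrized by the flow on \<open>\<Sigma>\<close> that cancels its tangential velocity;
  this rests on the smooth dependence of solutions of ordinary differential equations on parameters.
  The area measure is also a definite description, so its existence and uniqueness are needed as well;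
  they come from the change of variables formula.\<close>

section \<open>Calculus of \<open>C\<^sup>k\<close> maps\<close>

text \<open>A variation must have normal velocity at all times, while the velocity u N of X + t u N
  is normal in general only at time zero, because the tangent spaces turn. The cancelling field
  depends on time and is available only chart by chart, so its local flows are glued by uniqueness
  of trajectories, with constant trajectories off the support of u. Uniqueness holds on the manifold
  because the field is characterized by an orthogonality condition that all charts see alike. Smooth
  dependence is an induction on the order: the parameter derivative of a solution solves the
  linearized equation, which has the same Lipschitz constant L, so the smallness condition 2 L T
  \<le> 1 survives at every order. The same condition takes the place of Gronwall's inequality.
  Areas are cut into finitely many disjoint Borel pieces, each inside one chart, before they are
  differentiated. Two levels a < b strictly between h(p) and h(q) make the final contradiction
  strict; p and q may lie on different components, so the constant obtained is common to all of
  them.\<close>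

text \<open>\<open>C_k_on\<close> uses derivatives in the full space; values on \<open>S\<close>
  determine them because \<open>S\<close> is open.\<close>

lemma C_k_on_cong_aux:
  fixes f g :: "'a::real_normed_vector \<Rightarrow> 'b::real_normed_vector"
  assumes "open S" "\<And>x. x \<in> S \<Longrightarrow> f x = g x" "C_k_on k S f"
  shows "C_k_on k S g"
  using assms(2-)
proof (induction k arbitrary: f g)
  case 0
  then show ?case using continuous_on_cong by (metis C_k_on.simps(1))
next
  case (Suc k)
  have d: "(g has_derivative frechet_derivative f (at x)) (at x)" if "x \<in> S" for x
  proof -
    have "(f has_derivative frechet_derivative f (at x)) (at x)"
      using Suc.prems that frechet_derivative_works by auto
    from has_derivative_transform_within_open[OF this \<open>open S\<close> that] Suc.prems(1) show ?thesis by auto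
  qed
  have eq: "frechet_derivative f (at x) v = frechet_derivative g (at x) v" if "x \<in> S" for x v
    using frechet_derivative_at[OF d[OF that]] by simp
  have "C_k_on k S (\<lambda>x. frechet_derivative g (at x) v)" for v
    by (rule Suc.IH[of "\<lambda>x. frechet_derivative f (at x) v"]) (use eq Suc.prems in auto)
  then show ?case using d by (auto simp: differentiable_def)
qed

text \<open>Uniqueness of the derivative lets an explicit formula stand in for the chosen
  \<open>frechet_derivative\<close>; nearly all closure rules below go through this.\<close>

lemma C_k_on_SucI:
  assumes "open S" "\<And>x. x \<in> S \<Longrightarrow> (f has_derivative f' x) (at x)"
    and "\<And>v. C_k_on k S (\<lambda>x. f' x v)"
  shows "C_k_on (Suc k) S f"
proof -
  have eq: "f' x v = frechet_derivative f (at x) v" if "x \<in> S" for x v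
    using frechet_derivative_at[OF assms(2)[OF that]] by simp
  have "C_k_on k S (\<lambda>x. frechet_derivative f (at x) v)" for v
    by (rule C_k_on_cong_aux[OF assms(1) _ assms(3)[of v]]) (rule eq)
  then show ?thesis
    using assms(2) by (auto simp: differentiable_def)
qed

lemma C_k_on_SucD:
  assumes "C_k_on (Suc k) S f" "x \<in> S"
  shows "(f has_derivative frechet_derivative f (at x)) (at x)"
  using assms frechet_derivative_works by auto

lemma C_k_on_SucD': "C_k_on (Suc k) S f \<Longrightarrow> C_k_on k S (\<lambda>x. frechet_derivative f (at x) v)"
  by simp

lemma C_k_on_subset: "C_k_on k S f \<Longrightarrow> T \<subseteq> S \<Longrightarrow> C_k_on k T f"
  by (induction k arbitrary: f) (auto intro: continuous_on_subset)

lemma C_k_on_Suc_imp: "C_k_on (Suc k) S f \<Longrightarrow> C_k_on k S f"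
proof (induction k arbitrary: f)
  case 0
  then show ?case
    by (auto intro!: differentiable_imp_continuous_on differentiable_at_imp_differentiable_on)
next
  case (Suc k)
  then show ?case by (metis C_k_on.simps(2))
qed

lemma C_k_on_le: "C_k_on k S f \<Longrightarrow> j \<le> k \<Longrightarrow> C_k_on j S f"
  by (induction k) (auto simp: le_Suc_eq simp del: C_k_on.simps dest: C_k_on_Suc_imp)

lemma C_k_on_imp_continuous: "C_k_on k S f \<Longrightarrow> continuous_on S f"
  using C_k_on_le[of k S f 0] by simp

lemma C_k_on_local:
  assumes "\<And>x. x \<in> S \<Longrightarrow> \<exists>U. open U \<and> x \<in> U \<and> C_k_on k U f"
  shows "C_k_on k S f"
  using assms
proof (induction k arbitrary: f)
  case 0
  have "isCont f x" if "x \<in> S" for x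
    using 0[OF that] by (auto simp: continuous_on_eq_continuous_at)
  then show ?case by (auto intro: continuous_at_imp_continuous_on)
next
  case (Suc k)
  have "f differentiable at x" if "x \<in> S" for x
    using Suc.prems[OF that] by auto
  moreover have "C_k_on k S (\<lambda>x. frechet_derivative f (at x) v)" for v
  proof (rule Suc.IH)
    fix x assume "x \<in> S"
    from Suc.prems[OF this] obtain U where "open U" "x \<in> U" "C_k_on (Suc k) U f" by blast
    then show "\<exists>U. open U \<and> x \<in> U \<and> C_k_on k U (\<lambda>x. frechet_derivative f (at x) v)"
      using C_k_on_SucD' by blast
  qed
  ultimately show ?case by auto
qed

lemma C_k_on_const [simp]: "C_k_on k S (\<lambda>x. c)"
  by (induction k arbitrary: c) auto

lemma C_k_on_bounded_linear:
  assumes "bounded_linear f" shows "C_k_on k S f"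
proof (cases k)
  case 0
  then show ?thesis using linear_continuous_on[OF assms] by simp
next
  case (Suc j)
  have d: "(f has_derivative f) (at x)" for x
    using assms bounded_linear_imp_has_derivative by blast
  then have "frechet_derivative f (at x) = f" for x
    using frechet_derivative_at by metis
  with d show ?thesis using Suc by (auto simp: differentiable_def)
qed

lemma C_k_on_add:
  assumes "open S" "C_k_on k S f" "C_k_on k S g"
  shows "C_k_on k S (\<lambda>x. f x + g x)"
  using assms(2-)
proof (induction k arbitrary: f g)
  case 0
  then show ?case by (auto intro: continuous_intros)
next
  case (Suc k)
  show ?case
    by (rule C_k_on_SucI[OF \<open>open S\<close>, where f' = "\<lambda>x v. frechet_derivative f (at x) v + frechet_derivative g (at x) v"])
      (use Suc in \<open>auto intro!: has_derivative_add C_k_on_SucD simp del: C_k_on.simps intro: Suc.IH C_k_on_SucD'\<close>)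
qed

text \<open>The product rule gives a sum of two terms of the same bilinear shape, so one induction
  covers products, scalings and inner products.\<close>

lemma C_k_on_bilinear:
  assumes "bounded_bilinear p" "open S" "C_k_on k S f" "C_k_on k S g"
  shows "C_k_on k S (\<lambda>x. p (f x) (g x))"
  using assms(3-)
proof (induction k arbitrary: f g)
  case 0
  then show ?case using bounded_bilinear.continuous_on[OF assms(1)] by auto
next
  case (Suc k)
  show ?case
  proof (rule C_k_on_SucI[OF \<open>open S\<close>])
    show "((\<lambda>x. p (f x) (g x)) has_derivative
        (\<lambda>v. p (f x) (frechet_derivative g (at x) v) + p (frechet_derivative f (at x) v) (g x))) (at x)"
      if "x \<in> S" for x
      by (rule bounded_bilinear.FDERIV[OF assms(1)]) (use Suc.prems that C_k_on_SucD in blast)+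
    show "C_k_on k S (\<lambda>x. p (f x) (frechet_derivative g (at x) v) + p (frechet_derivative f (at x) v) (g x))" for v
      using Suc.prems by (intro C_k_on_add Suc.IH C_k_on_SucD' \<open>open S\<close>) (auto dest: C_k_on_Suc_imp simp del: C_k_on.simps)
  qed
qed

lemmas C_k_on_mult = C_k_on_bilinear[OF bounded_bilinear_mult]
lemmas C_k_on_scaleR = C_k_on_bilinear[OF bounded_bilinear_scaleR]
lemmas C_k_on_inner = C_k_on_bilinear[OF bounded_bilinear_inner]

lemma C_k_on_sum:
  assumes "open S" "\<And>i. i \<in> I \<Longrightarrow> C_k_on k S (f i)"
  shows "C_k_on k S (\<lambda>x. \<Sum>i\<in>I. f i x)"
  using assms(2) by (induction I rule: infinite_finite_induct) (auto intro: C_k_on_add[OF \<open>open S\<close>])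

lemma C_k_on_prod:
  fixes f :: "'i \<Rightarrow> 'a::real_normed_vector \<Rightarrow> real"
  assumes "open S" "\<And>i. i \<in> I \<Longrightarrow> C_k_on k S (f i)"
  shows "C_k_on k S (\<lambda>x. \<Prod>i\<in>I. f i x)"
  using assms(2) by (induction I rule: infinite_finite_induct) (auto intro: C_k_on_mult[OF \<open>open S\<close>])

lemma C_k_on_bounded_linear_compose:
  assumes "bounded_linear l" "open S" "C_k_on k S f"
  shows "C_k_on k S (\<lambda>x. l (f x))"
  using assms(3)
proof (induction k arbitrary: f)
  case 0
  then show ?case using bounded_linear.continuous_on[OF assms(1)] by auto
next
  case (Suc k)
  show ?case
    by (rule C_k_on_SucI[OF \<open>open S\<close>, where f' = "\<lambda>x v. l (frechet_derivative f (at x) v)"])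
      (use Suc in \<open>auto intro!: bounded_linear.has_derivative[OF assms(1)] C_k_on_SucD simp del: C_k_on.simps intro: Suc.IH C_k_on_SucD'\<close>)
qed

lemma C_k_on_minus: "open S \<Longrightarrow> C_k_on k S f \<Longrightarrow> C_k_on k S (\<lambda>x. - f x)"
  by (rule C_k_on_bounded_linear_compose) (auto intro: bounded_linear_minus bounded_linear_ident)

lemma C_k_on_diff:
  "open S \<Longrightarrow> C_k_on k S f \<Longrightarrow> C_k_on k S g \<Longrightarrow> C_k_on k S (\<lambda>x. f x - g x)"
  using C_k_on_add[of S k f "\<lambda>x. - g x"] C_k_on_minus[of S k g] by simp

lemma C_k_on_Pair:
  assumes "open S" "C_k_on k S f" "C_k_on k S g"
  shows "C_k_on k S (\<lambda>x. (f x, g x))"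
proof -
  have "bounded_linear (\<lambda>x. (x, 0::'c))" "bounded_linear (\<lambda>x. (0::'b, x))"
    by (auto intro!: bounded_linear_Pair bounded_linear_ident bounded_linear_zero)
  from C_k_on_add[OF assms(1) C_k_on_bounded_linear_compose[OF this(1) assms(1,2)]
      C_k_on_bounded_linear_compose[OF this(2) assms(1,3)]]
  show ?thesis by simp
qed

lemma C_k_on_componentwise:
  fixes f :: "'a::real_normed_vector \<Rightarrow> 'b::euclidean_space"
  assumes "open S" "\<And>b. b \<in> Basis \<Longrightarrow> C_k_on k S (\<lambda>x. f x \<bullet> b)"
  shows "C_k_on k S f"
proof -
  have "C_k_on k S (\<lambda>x. \<Sum>b\<in>Basis. (f x \<bullet> b) *\<^sub>R b)"
    by (intro C_k_on_sum C_k_on_scaleR assms C_k_on_const)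
  then show ?thesis by (simp add: euclidean_representation)
qed

lemma frechet_derivative_Basis:
  fixes f :: "'a::euclidean_space \<Rightarrow> 'b::real_normed_vector"
  assumes "f differentiable (at x)"
  shows "frechet_derivative f (at x) v = (\<Sum>b\<in>Basis. (v \<bullet> b) *\<^sub>R frechet_derivative f (at x) b)"
proof -
  note l = linear_frechet_derivative[OF assms]
  have "frechet_derivative f (at x) v = frechet_derivative f (at x) (\<Sum>b\<in>Basis. (v \<bullet> b) *\<^sub>R b)"
    by (simp add: euclidean_representation)
  also have "\<dots> = (\<Sum>b\<in>Basis. (v \<bullet> b) *\<^sub>R frechet_derivative f (at x) b)"
    by (simp add: linear_sum[OF l] linear_cmul[OF l])
  finally show ?thesis .
qed

text \<open>In the chain rule the inner derivative is fed into an outer derivative that varies with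
  the point. Expanding it in the basis of the middle space leaves only directional derivatives of
  \<open>g\<close> in fixed directions, to which the induction hypothesis applies; hence the finite
  dimension there and the generalization over \<open>g\<close>.\<close>

lemma C_k_on_compose:
  fixes f :: "'a::real_normed_vector \<Rightarrow> 'b::euclidean_space" and g :: "'b \<Rightarrow> 'c::real_normed_vector"
  assumes "open S" "C_k_on k S f" "C_k_on k T g" "f ` S \<subseteq> T"
  shows "C_k_on k S (\<lambda>x. g (f x))"
  using assms(2,3)
proof (induction k arbitrary: g)
  case 0
  then show ?case using continuous_on_compose2[of T g S f] assms(4) by auto
next
  case (Suc k)
  let ?g = "\<lambda>x v. \<Sum>b\<in>Basis. (frechet_derivative f (at x) v \<bullet> b) *\<^sub>R frechet_derivative g (at (f x)) b"
  show ?case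
  proof (rule C_k_on_SucI[OF \<open>open S\<close>])
    fix x assume x: "x \<in> S"
    have d: "((\<lambda>x. g (f x)) has_derivative (\<lambda>v. frechet_derivative g (at (f x)) (frechet_derivative f (at x) v))) (at x)"
      using diff_chain_at[OF C_k_on_SucD[OF Suc.prems(1) x] C_k_on_SucD[OF Suc.prems(2)]] x assms(4)
      by (auto simp: o_def)
    have "(\<lambda>v. frechet_derivative g (at (f x)) (frechet_derivative f (at x) v)) = ?g x"
      using Suc.prems(2) x assms(4) by (intro ext frechet_derivative_Basis) auto
    with d show "((\<lambda>x. g (f x)) has_derivative ?g x) (at x)"
      by metis
  next
    fix v
    have "C_k_on k S (\<lambda>x. frechet_derivative g (at (f x)) b)" for b
      by (rule Suc.IH[OF C_k_on_Suc_imp[OF Suc.prems(1)] C_k_on_SucD'[OF Suc.prems(2)]])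
    then show "C_k_on k S (\<lambda>x. ?g x v)"
      by (intro C_k_on_sum C_k_on_scaleR C_k_on_inner C_k_on_const \<open>open S\<close> C_k_on_SucD'[OF Suc.prems(1)])
  qed
qed

lemma C_k_on_real_deriv:
  fixes f :: "real \<Rightarrow> 'b::real_normed_vector"
  assumes "open S" "\<And>x. x \<in> S \<Longrightarrow> (f has_vector_derivative f' x) (at x)" "C_k_on k S f'"
  shows "C_k_on (Suc k) S f"
  by (rule C_k_on_SucI[OF \<open>open S\<close>, where f' = "\<lambda>x v. v *\<^sub>R f' x"])
    (use assms in \<open>auto simp: has_vector_derivative_def intro!: C_k_on_scaleR\<close>)

lemma C_k_on_inverse: "C_k_on k (- {0::real}) inverse"
proof (induction k)
  case 0
  then show ?case by (auto intro!: continuous_intros)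
next
  case (Suc k)
  show ?case
  proof (rule C_k_on_real_deriv)
    show "(inverse has_vector_derivative - (inverse x * inverse x)) (at x)" if "x \<in> - {0}" for x :: real
      using that by (auto intro!: derivative_eq_intros simp: has_real_derivative_iff_has_vector_derivative[symmetric])
    show "C_k_on k (- {0}) (\<lambda>x::real. - (inverse x * inverse x))"
      by (intro C_k_on_minus C_k_on_mult Suc) auto
  qed auto
qed

lemma C_k_on_exp: "C_k_on k S (exp :: real \<Rightarrow> real)"
proof -
  have "C_k_on k UNIV (exp :: real \<Rightarrow> real)"
  proof (induction k)
    case (Suc k)
    show ?case
      by (rule C_k_on_real_deriv[OF _ _ Suc])
        (auto intro!: derivative_eq_intros simp: has_real_derivative_iff_has_vector_derivative[symmetric])
  qed (auto intro!: continuous_intros)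
  then show ?thesis using C_k_on_subset by blast
qed

lemma C_1_on_sqrt: "C_k_on (Suc 0) {0<..} sqrt"
  by (rule C_k_on_real_deriv[where f' = "\<lambda>x. inverse (sqrt x) / 2"])
    (auto intro!: derivative_eq_intros continuous_intros simp: has_real_derivative_iff_has_vector_derivative[symmetric])

lemma C_k_on_det:
  fixes A :: "'a::real_normed_vector \<Rightarrow> real^'n^'n"
  assumes "open S" "\<And>i j. C_k_on k S (\<lambda>x. A x $ i $ j)"
  shows "C_k_on k S (\<lambda>x. det (A x))"
  unfolding det_def by (intro C_k_on_sum C_k_on_mult C_k_on_prod assms C_k_on_const)

lemma C_k_on_vec:
  fixes f :: "'a::real_normed_vector \<Rightarrow> 'b::euclidean_space^'n"
  assumes "open S" "\<And>i. C_k_on k S (\<lambda>x. f x $ i)"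
  shows "C_k_on k S f"
  by (rule C_k_on_componentwise[OF \<open>open S\<close>])
    (auto simp: Basis_vec_def inner_axis intro!: C_k_on_inner[OF \<open>open S\<close> assms(2) C_k_on_const])

section \<open>Rules for infinitely differentiable maps\<close>

lemma smooth_on_C_k: "smooth_on S f \<Longrightarrow> C_k_on k S f"
  by (simp add: smooth_on_def)

lemma smooth_on_has_derivative:
  "smooth_on S f \<Longrightarrow> x \<in> S \<Longrightarrow> (f has_derivative frechet_derivative f (at x)) (at x)"
  by (rule C_k_on_SucD[OF smooth_on_C_k])

lemma smooth_on_frechet_derivative:
  "smooth_on S f \<Longrightarrow> smooth_on S (\<lambda>x. frechet_derivative f (at x) v)"
  unfolding smooth_on_def by (metis C_k_on_SucD')

lemma smooth_on_subset: "smooth_on S f \<Longrightarrow> T \<subseteq> S \<Longrightarrow> smooth_on T f"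
  unfolding smooth_on_def using C_k_on_subset by blast

lemma smooth_on_cong:
  "open S \<Longrightarrow> (\<And>x. x \<in> S \<Longrightarrow> f x = g x) \<Longrightarrow> smooth_on S f \<longleftrightarrow> smooth_on S g"
  unfolding smooth_on_def by (metis C_k_on_cong_aux)

lemma smooth_on_local:
  "(\<And>x. x \<in> S \<Longrightarrow> \<exists>U. open U \<and> x \<in> U \<and> smooth_on U f) \<Longrightarrow> smooth_on S f"
  unfolding smooth_on_def by (metis C_k_on_local)

lemma smooth_on_compose:
  fixes f :: "'a::real_normed_vector \<Rightarrow> 'b::euclidean_space" and g :: "'b \<Rightarrow> 'c::real_normed_vector"
  shows "open S \<Longrightarrow> smooth_on S f \<Longrightarrow> smooth_on T g \<Longrightarrow> f ` S \<subseteq> T \<Longrightarrow> smooth_on S (\<lambda>x. g (f x))"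
  unfolding smooth_on_def using C_k_on_compose by blast

lemma smooth_on_const [simp]: "smooth_on S (\<lambda>x. c)"
  by (simp add: smooth_on_def)

lemma smooth_on_bounded_linear: "bounded_linear f \<Longrightarrow> smooth_on S f"
  by (simp add: smooth_on_def C_k_on_bounded_linear)

lemma smooth_on_ident [simp]: "smooth_on S (\<lambda>x. x)"
  by (simp add: smooth_on_bounded_linear bounded_linear_ident)

lemma smooth_on_fst [simp]: "smooth_on S fst" and smooth_on_snd [simp]: "smooth_on S snd"
  by (simp_all add: smooth_on_bounded_linear bounded_linear_fst bounded_linear_snd)

lemma smooth_on_add:
  "open S \<Longrightarrow> smooth_on S f \<Longrightarrow> smooth_on S g \<Longrightarrow> smooth_on S (\<lambda>x. f x + g x)"
  by (simp add: smooth_on_def C_k_on_add)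

lemma smooth_on_minus: "open S \<Longrightarrow> smooth_on S f \<Longrightarrow> smooth_on S (\<lambda>x. - f x)"
  by (simp add: smooth_on_def C_k_on_minus)

lemma smooth_on_diff:
  "open S \<Longrightarrow> smooth_on S f \<Longrightarrow> smooth_on S g \<Longrightarrow> smooth_on S (\<lambda>x. f x - g x)"
  by (simp add: smooth_on_def C_k_on_diff)

lemma smooth_on_scaleR:
  "open S \<Longrightarrow> smooth_on S f \<Longrightarrow> smooth_on S g \<Longrightarrow> smooth_on S (\<lambda>x. f x *\<^sub>R g x)"
  by (simp add: smooth_on_def C_k_on_scaleR)

lemma smooth_on_mult:
  fixes f g :: "_ \<Rightarrow> real"
  shows "open S \<Longrightarrow> smooth_on S f \<Longrightarrow> smooth_on S g \<Longrightarrow> smooth_on S (\<lambda>x. f x * g x)"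
  by (simp add: smooth_on_def C_k_on_mult)

lemma smooth_on_inner:
  "open S \<Longrightarrow> smooth_on S f \<Longrightarrow> smooth_on S g \<Longrightarrow> smooth_on S (\<lambda>x. f x \<bullet> g x)"
  by (simp add: smooth_on_def C_k_on_inner)

lemma smooth_on_Pair:
  "open S \<Longrightarrow> smooth_on S f \<Longrightarrow> smooth_on S g \<Longrightarrow> smooth_on S (\<lambda>x. (f x, g x))"
  by (simp add: smooth_on_def C_k_on_Pair)

lemma smooth_on_det:
  fixes A :: "'a::real_normed_vector \<Rightarrow> real^'n^'n"
  assumes "open S" "\<And>i j. smooth_on S (\<lambda>x. A x $ i $ j)"
  shows "smooth_on S (\<lambda>x. det (A x))"
  using assms C_k_on_det unfolding smooth_on_def by blast

lemma smooth_on_vec: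
  fixes f :: "'a::real_normed_vector \<Rightarrow> 'b::euclidean_space^'n"
  assumes "open S" "\<And>i. smooth_on S (\<lambda>x. f x $ i)"
  shows "smooth_on S f"
  using assms C_k_on_vec unfolding smooth_on_def by blast

lemma smooth_on_divide:
  fixes f g :: "'a::real_normed_vector \<Rightarrow> real"
  assumes "open S" "smooth_on S f" "smooth_on S g" "\<And>x. x \<in> S \<Longrightarrow> g x \<noteq> 0"
  shows "smooth_on S (\<lambda>x. f x / g x)"
proof -
  have "smooth_on (- {0::real}) inverse"
    by (simp add: smooth_on_def C_k_on_inverse)
  moreover have "g ` S \<subseteq> - {0}" using assms(4) by force
  ultimately have "smooth_on S (\<lambda>x. inverse (g x))"
    using smooth_on_compose[OF assms(1,3)] by blast
  from smooth_on_mult[OF assms(1,2) this] show ?thesis by (simp add: divide_inverse)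
qed

lemma smooth_on_imp_continuous: "smooth_on S f \<Longrightarrow> continuous_on S f"
  using smooth_on_C_k C_k_on_imp_continuous by blast

text \<open>In finite dimension, continuity of each directional derivative is continuity in operator
  norm. This yields the bounds on compact sets used for differential equations.\<close>

lemma C_1_on_continuous_blinfun:
  fixes f :: "'a::euclidean_space \<Rightarrow> 'b::real_normed_vector"
  assumes "C_k_on (Suc 0) S f"
  shows "continuous_on S (\<lambda>x. Blinfun (frechet_derivative f (at x)))"
proof (rule continuous_on_blinfun_componentwise)
  fix b :: 'a
  have "continuous_on S (\<lambda>x. frechet_derivative f (at x) b)"
    using assms by auto
  then show "continuous_on S (\<lambda>x. blinfun_apply (Blinfun (frechet_derivative f (at x))) b)"
    by (rule continuous_on_eq)
      (metis C_k_on_SucD[OF assms] has_derivative_bounded_linear bounded_linear_Blinfun_apply)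
qed

subsection \<open>Symmetry of second derivatives\<close>

text \<open>The mean value theorem, used once in direction \<open>a\<close> and once in direction
  \<open>b\<close>, turns the quotient into a second derivative at a nearby point. The quotient is
  symmetric in \<open>a\<close> and \<open>b\<close>, which yields the symmetry of second
  derivatives.\<close>

lemma second_difference_real:
  fixes f :: "'a::euclidean_space \<Rightarrow> real"
  assumes "open S" "C_k_on 2 S f" "x \<in> S"
  shows "((\<lambda>s. (f (x + s *\<^sub>R a + s *\<^sub>R b) - f (x + s *\<^sub>R a) - f (x + s *\<^sub>R b) + f x) / s^2)
     \<longlongrightarrow> frechet_derivative (\<lambda>y. frechet_derivative f (at y) a) (at x) b) (at_right 0)"
    (is "(?q \<longlongrightarrow> ?L x) _")
proof (rule tendstoI)
  fix e :: real assume "e > 0"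
  have "C_k_on (Suc (Suc 0)) S f" using assms(2) by (simp add: numeral_2_eq_2)
  then have C1: "C_k_on (Suc 0) S f" and C1a: "C_k_on (Suc 0) S (\<lambda>y. frechet_derivative f (at y) a)"
    and cont: "continuous_on S ?L"
    using C_k_on_Suc_imp C_k_on_SucD' by (blast, blast, auto)
  from cont have "isCont ?L x"
    using assms by (simp add: continuous_on_eq_continuous_at)
  then obtain d where d: "d > 0" "\<And>y. dist y x < d \<Longrightarrow> dist (?L y) (?L x) < e"
    using \<open>e > 0\<close> unfolding continuous_at_eps_delta by metis
  obtain d' where d': "d' > 0" "ball x d' \<subseteq> S"
    using assms openE by blast
  define r where "r = min d d'"
  have r: "r > 0" using d d' by (auto simp: r_def)
  \<comment> \<open>Small enough for the parallelogram with sides \<open>s *\<^sub>R a\<close> and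
    \<open>s *\<^sub>R b\<close> to stay in the ball of radius \<open>r\<close>; the added 1 keeps
    the denominator positive.\<close>
  define s0 where "s0 = r / (norm a + norm b + 1)"
  have "norm a + norm b + 1 > 0" by (smt (verit) norm_ge_zero)
  then have s0: "s0 > 0" using r by (simp add: s0_def)
  have inb: "dist (x + s *\<^sub>R a + t *\<^sub>R b) x < r" if "0 \<le> s" "s < s0" "0 \<le> t" "t < s0" for s t
  proof -
    have "norm (s *\<^sub>R a + t *\<^sub>R b) \<le> s * norm a + t * norm b"
      using norm_triangle_ineq[of "s *\<^sub>R a" "t *\<^sub>R b"] that by simp
    also have "\<dots> \<le> s0 * norm a + s0 * norm b"
      using that by (intro add_mono mult_right_mono) auto
    also have "\<dots> < s0 * (norm a + norm b + 1)" using s0 by (simp add: algebra_simps)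
    also have "\<dots> = r" using \<open>norm a + norm b + 1 > 0\<close> by (simp add: s0_def)
    finally show ?thesis by (simp add: dist_norm add.assoc)
  qed
  have "dist (?q s) (?L x) < e" if s: "0 < s" "s < s0" for s
  proof -
    let ?\<phi> = "\<lambda>\<sigma>. f (x + \<sigma> *\<^sub>R a + s *\<^sub>R b) - f (x + \<sigma> *\<^sub>R a)"
    let ?\<psi> = "\<lambda>\<sigma> t. frechet_derivative f (at (x + \<sigma> *\<^sub>R a + t *\<^sub>R b)) a"
    have "(?\<phi> has_real_derivative ?\<psi> \<sigma> s - ?\<psi> \<sigma> 0) (at \<sigma>)" if \<sigma>: "0 \<le> \<sigma>" "\<sigma> \<le> s" for \<sigma>
    proof -
      have 1: "((\<lambda>\<sigma>. f (x + \<sigma> *\<^sub>R a + t *\<^sub>R b)) has_real_derivative ?\<psi> \<sigma> t) (at \<sigma>)" if "0 \<le> t" "t \<le> s" for t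
      proof -
        have m: "x + \<sigma> *\<^sub>R a + t *\<^sub>R b \<in> S"
          using inb[of \<sigma> t] \<sigma> s that d'(2) by (auto simp: r_def dist_commute)
        have "((\<lambda>\<sigma>. x + \<sigma> *\<^sub>R a + t *\<^sub>R b) has_derivative (\<lambda>h. h *\<^sub>R a)) (at \<sigma>)"
          by (auto intro!: derivative_eq_intros)
        from has_derivative_compose[OF this, where g = f, OF C_k_on_SucD[OF C1 m]]
        have "((\<lambda>\<sigma>. f (x + \<sigma> *\<^sub>R a + t *\<^sub>R b)) has_derivative
           (\<lambda>h. frechet_derivative f (at (x + \<sigma> *\<^sub>R a + t *\<^sub>R b)) (h *\<^sub>R a))) (at \<sigma>)" .
        moreover have "frechet_derivative f (at (x + \<sigma> *\<^sub>R a + t *\<^sub>R b)) (h *\<^sub>R a) = h *\<^sub>R ?\<psi> \<sigma> t" for h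
          using linear_cmul[OF linear_frechet_derivative[of f "at (x + \<sigma> *\<^sub>R a + t *\<^sub>R b)"]] C1 m by auto
        ultimately show ?thesis by (simp add: has_field_derivative_def mult_commute_abs)
      qed
      show ?thesis using DERIV_diff[OF 1[of s] 1[of 0]] s by simp
    qed
    from MVT2[OF s(1) this] obtain \<sigma> where \<sigma>: "0 < \<sigma>" "\<sigma> < s"
      "?\<phi> s - ?\<phi> 0 = (s - 0) * (?\<psi> \<sigma> s - ?\<psi> \<sigma> 0)" by auto
    have "((\<lambda>t. ?\<psi> \<sigma> t) has_real_derivative ?L (x + \<sigma> *\<^sub>R a + t *\<^sub>R b)) (at t)" if "0 \<le> t" "t \<le> s" for t
    proof -
      have m: "x + \<sigma> *\<^sub>R a + t *\<^sub>R b \<in> S"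
        using inb[of \<sigma> t] \<sigma> s that d'(2) by (auto simp: r_def dist_commute)
      have "((\<lambda>t. x + \<sigma> *\<^sub>R a + t *\<^sub>R b) has_derivative (\<lambda>h. h *\<^sub>R b)) (at t)"
        by (auto intro!: derivative_eq_intros)
      from has_derivative_compose[OF this, where g = "\<lambda>y. frechet_derivative f (at y) a", OF C_k_on_SucD[OF C1a m]]
      have "((\<lambda>t. ?\<psi> \<sigma> t) has_derivative
          (\<lambda>h. frechet_derivative (\<lambda>y. frechet_derivative f (at y) a) (at (x + \<sigma> *\<^sub>R a + t *\<^sub>R b)) (h *\<^sub>R b))) (at t)" .
      moreover have "frechet_derivative (\<lambda>y. frechet_derivative f (at y) a) (at (x + \<sigma> *\<^sub>R a + t *\<^sub>R b)) (h *\<^sub>R b)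
         = h *\<^sub>R ?L (x + \<sigma> *\<^sub>R a + t *\<^sub>R b)" for h
        using linear_cmul[OF linear_frechet_derivative[of "\<lambda>y. frechet_derivative f (at y) a"
            "at (x + \<sigma> *\<^sub>R a + t *\<^sub>R b)"]] C1a m by auto
      ultimately show ?thesis by (simp add: has_field_derivative_def mult_commute_abs)
    qed
    from MVT2[OF s(1) this] obtain \<tau> where \<tau>: "0 < \<tau>" "\<tau> < s"
      "?\<psi> \<sigma> s - ?\<psi> \<sigma> 0 = (s - 0) * ?L (x + \<sigma> *\<^sub>R a + \<tau> *\<^sub>R b)" by auto
    have "?q s = ?L (x + \<sigma> *\<^sub>R a + \<tau> *\<^sub>R b)"
      using \<sigma>(3) \<tau>(3) s by (simp add: power2_eq_square field_simps)
    then show ?thesis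
      using d(2)[of "x + \<sigma> *\<^sub>R a + \<tau> *\<^sub>R b"] inb[of \<sigma> \<tau>] \<sigma> \<tau> s unfolding r_def by simp
  qed
  then show "\<forall>\<^sub>F s in at_right 0. dist (?q s) (?L x) < e"
    using s0 eventually_at_right[of 0 1] by (auto simp: eventually_at_right_field)
qed

lemma frechet_derivative_commute_real:
  fixes f :: "'a::euclidean_space \<Rightarrow> real"
  assumes "open S" "C_k_on 2 S f" "x \<in> S"
  shows "frechet_derivative (\<lambda>y. frechet_derivative f (at y) a) (at x) b =
    frechet_derivative (\<lambda>y. frechet_derivative f (at y) b) (at x) a"
proof -
  have "((\<lambda>s. (f (x + s *\<^sub>R a + s *\<^sub>R b) - f (x + s *\<^sub>R a) - f (x + s *\<^sub>R b) + f x) / s^2)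
     \<longlongrightarrow> frechet_derivative (\<lambda>y. frechet_derivative f (at y) b) (at x) a) (at_right 0)"
    using second_difference_real[OF assms, of b a] by (simp add: algebra_simps)
  then show ?thesis
    using second_difference_real[OF assms, of a b] tendsto_unique trivial_limit_at_right_real by blast
qed

text \<open>A vector is determined by its inner products, so the real case is applied to each
  function \<open>c \<bullet> f y\<close>.\<close>

lemma frechet_derivative_commute:
  fixes f :: "'a::euclidean_space \<Rightarrow> 'b::real_inner"
  assumes "open S" "C_k_on 2 S f" "x \<in> S"
  shows "frechet_derivative (\<lambda>y. frechet_derivative f (at y) a) (at x) b =
    frechet_derivative (\<lambda>y. frechet_derivative f (at y) b) (at x) a"
proof (rule vector_eq_ldot[THEN iffD1], rule allI)
  fix c :: 'b
  have C2: "C_k_on (Suc (Suc 0)) S f" using assms(2) by (simp add: numeral_2_eq_2)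
  have 1: "frechet_derivative (\<lambda>y. c \<bullet> f y) (at y) v = c \<bullet> frechet_derivative f (at y) v" if "y \<in> S" for y v
    using frechet_derivative_at[OF has_derivative_inner_right[OF C_k_on_SucD[OF C2 that], of c]] by metis
  have 2: "frechet_derivative (\<lambda>y. frechet_derivative (\<lambda>y. c \<bullet> f y) (at y) v) (at x) w
     = c \<bullet> frechet_derivative (\<lambda>y. frechet_derivative f (at y) v) (at x) w" for v w
  proof -
    have "((\<lambda>y. frechet_derivative (\<lambda>y. c \<bullet> f y) (at y) v) has_derivative
       (\<lambda>w. c \<bullet> frechet_derivative (\<lambda>y. frechet_derivative f (at y) v) (at x) w)) (at x)"
      by (rule has_derivative_transform_within_open[OF has_derivative_inner_right[OF C_k_on_SucD[OF C_k_on_SucD'[OF C2] assms(3)]]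
            assms(1,3)]) (simp add: 1)
    from frechet_derivative_at[OF this] show ?thesis by metis
  qed
  have "C_k_on 2 S (\<lambda>y. c \<bullet> f y)"
    using C_k_on_inner[OF assms(1) C_k_on_const assms(2)] .
  from frechet_derivative_commute_real[OF assms(1) this assms(3)] show
    "c \<bullet> frechet_derivative (\<lambda>y. frechet_derivative f (at y) a) (at x) b =
     c \<bullet> frechet_derivative (\<lambda>y. frechet_derivative f (at y) b) (at x) a"
    unfolding 2 .
qed

section \<open>Ordinary differential equations depending on parameters\<close>

lemma vector_derivative_mean_bound:
  fixes e :: "real \<Rightarrow> 'b::real_normed_vector"
  assumes "convex S" "\<And>t. t \<in> S \<Longrightarrow> (e has_vector_derivative e' t) (at t within S)"
    and "\<And>t. t \<in> S \<Longrightarrow> norm (e' t) \<le> B" "s \<in> S" "t \<in> S"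
  shows "norm (e s - e t) \<le> B * \<bar>s - t\<bar>"
proof -
  have "norm (e s - e t) \<le> B * norm (s - t)"
  proof (rule differentiable_bound[OF assms(1) _ _ assms(4,5)])
    show "(e has_derivative (\<lambda>h. h *\<^sub>R e' x)) (at x within S)" if "x \<in> S" for x
      using assms(2)[OF that] by (simp add: has_vector_derivative_def)
    show "onorm (\<lambda>h. h *\<^sub>R e' x) \<le> B" if "x \<in> S" for x
    proof (rule onorm_le)
      show "norm (h *\<^sub>R e' x) \<le> B * norm h" for h
        using mult_left_mono[OF assms(3)[OF that] norm_ge_zero[of h]] by (simp add: mult.commute)
    qed
  qed
  then show ?thesis by simp
qed

text \<open>Substitute for Gronwall's inequality. At a point \<open>s\<close> where the norm of
  \<open>e\<close> is maximal, the mean value bound gives at most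
  \<open>L * norm (e s) * T + T * \<delta>\<close>, and since \<open>2 * L * T \<le> 1\<close> the
  first term is absorbed as half of the left side. With \<open>\<delta> = 0\<close> it is a
  uniqueness statement.\<close>

lemma ode_estimate:
  fixes e :: "real \<Rightarrow> 'b::real_normed_vector"
  assumes der: "\<And>t. \<bar>t\<bar> < T \<Longrightarrow> (e has_vector_derivative e' t) (at t)" and "e 0 = 0"
    and bd: "\<And>t. \<bar>t\<bar> < T \<Longrightarrow> norm (e' t) \<le> L * norm (e t) + \<delta>"
    and L: "0 \<le> L" "2 * L * T \<le> 1" and t: "\<bar>t\<bar> < T"
  shows "norm (e t) \<le> 2 * T * \<delta>"
proof -
  let ?S = "{-\<bar>t\<bar>..\<bar>t\<bar>}"
  have in_T: "\<bar>s\<bar> < T" "\<bar>s\<bar> \<le> T" if "s \<in> ?S" for s using that t by auto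
  have "continuous_on ?S e"
    using der in_T has_vector_derivative_continuous
    by (intro continuous_at_imp_continuous_on) blast
  then have "continuous_on ?S (\<lambda>s. norm (e s))" by (intro continuous_intros)
  then obtain s where s: "s \<in> ?S" "\<And>r. r \<in> ?S \<Longrightarrow> norm (e r) \<le> norm (e s)"
    using continuous_attains_sup[of ?S "\<lambda>s. norm (e s)"] by auto
  have "0 \<le> norm (e' 0)" by simp
  also have "\<dots> \<le> \<delta>" using bd[of 0] t \<open>e 0 = 0\<close> by simp
  finally have \<delta>: "0 \<le> \<delta>" .
  have "norm (e s - e 0) \<le> (L * norm (e s) + \<delta>) * \<bar>s - 0\<bar>"
  proof (rule vector_derivative_mean_bound[where S = ?S and e' = e'])
    show "(e has_vector_derivative e' r) (at r within ?S)" if "r \<in> ?S" for r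
      using der[OF in_T(1)[OF that]] has_vector_derivative_at_within by blast
    show "norm (e' r) \<le> L * norm (e s) + \<delta>" if "r \<in> ?S" for r
      using bd[OF in_T(1)[OF that]] mult_left_mono[OF s(2)[OF that] L(1)] by linarith
  qed (use s in auto)
  also have "\<dots> \<le> (L * norm (e s) + \<delta>) * T"
    using in_T[OF s(1)] L \<delta> by (intro mult_left_mono) auto
  also have "\<dots> \<le> norm (e s) / 2 + T * \<delta>"
    using mult_right_mono[OF L(2) norm_ge_zero[of "e s"]] by (simp add: algebra_simps)
  finally have "norm (e s) \<le> 2 * T * \<delta>" using \<open>e 0 = 0\<close> by simp
  moreover have "t \<in> ?S" using abs_ge_self[of t] abs_ge_minus_self[of t] by simp
  ultimately show ?thesis using s(2)[of t] by linarith
qed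

text \<open>Picard iteration: the integral operator is a contraction with factor 1/2 in the supremum
  norm, because \<open>L * T\<close> is at most 1/2.\<close>

lemma ode_exists:
  fixes g :: "real \<Rightarrow> 'b::euclidean_space \<Rightarrow> 'b"
  assumes T: "0 < T" and cont: "continuous_on ({-T..T} \<times> UNIV) (\<lambda>(t, z). g t z)"
    and lip: "\<And>t z w. \<bar>t\<bar> \<le> T \<Longrightarrow> norm (g t z - g t w) \<le> L * norm (z - w)"
    and L: "0 \<le> L" "2 * L * T \<le> 1"
  shows "\<exists>z. z 0 = 0 \<and> (\<forall>t. \<bar>t\<bar> < T \<longrightarrow> (z has_vector_derivative g t (z t)) (at t))"
proof -
  \<comment> \<open>Clamping the time to the interval turns curves on it into bounded continuous
    functions on the whole line, where the fixed point theorem applies to a complete type.\<close>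
  define c where "c t = max (-T) (min T t)" for t
  have c: "\<bar>c t\<bar> \<le> T" "c t \<in> {-T..T}" for t using T by (auto simp: c_def)
  have c_id: "c t = t" if "\<bar>t\<bar> \<le> T" for t using that by (auto simp: c_def)
  \<comment> \<open>The integral from 0 to \<open>t\<close> for either sign of \<open>t\<close>,
    written as a difference of integrals from \<open>-T\<close>.\<close>
  define J where "J z t = integral {-T..t} (\<lambda>s. g s (z s)) - integral {-T..0} (\<lambda>s. g s (z s))" for z t
  have gcont: "continuous_on {-T..T} (\<lambda>s. g s (z s))" if "continuous_on UNIV z" for z
  proof -
    have "continuous_on {-T..T} (\<lambda>s. (s, z s))"
      using continuous_on_subset[OF that] by (intro continuous_intros) auto
    from continuous_on_compose2[OF cont this] show ?thesis by auto
  qed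
  have Jd: "(J z has_vector_derivative g t (z t)) (at t within {-T..T})"
    if "continuous_on UNIV z" "t \<in> {-T..T}" for z t
    unfolding J_def using integral_has_vector_derivative[OF gcont[OF that(1)] that(2)]
    by (auto intro!: derivative_eq_intros)
  have Jc: "continuous_on {-T..T} (J z)" if "continuous_on UNIV z" for z
    unfolding continuous_on_eq_continuous_within
    by (intro ballI) (rule has_vector_derivative_continuous, rule Jd[OF that])
  have J0: "J z 0 = 0" for z by (simp add: J_def)
  have cc: "continuous_on UNIV c" unfolding c_def by (intro continuous_intros)
  have "(\<lambda>t. J z (c t)) \<in> bcontfun" if "continuous_on UNIV z" for z
  proof -
    have "continuous_on UNIV (\<lambda>t. J z (c t))"
      by (rule continuous_on_compose2[OF Jc[OF that] cc]) (use c in blast)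
    moreover have "bounded (range (\<lambda>t. J z (c t)))"
    proof (rule bounded_subset)
      show "bounded (J z ` {-T..T})"
        using compact_continuous_image[OF Jc[OF that]] compact_imp_bounded by blast
    qed (use c in blast)
    ultimately show ?thesis by (simp add: bcontfun_def)
  qed
  then have P: "apply_bcontfun (Bcontfun (\<lambda>t. J (apply_bcontfun z) (c t))) t = J (apply_bcontfun z) (c t)" for z t
    using continuous_on_apply_bcontfun[of UNIV z] by (simp add: Bcontfun_inverse)
  define P where "P z = Bcontfun (\<lambda>t. J (apply_bcontfun z) (c t))" for z
  have "dist (P z) (P w) \<le> (1/2) * dist z w" for z w
  proof (rule dist_bound)
    fix t
    have cz: "continuous_on UNIV (apply_bcontfun z)" "continuous_on UNIV (apply_bcontfun w)"
      using continuous_on_apply_bcontfun by blast+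
    let ?D = "\<lambda>t. J (apply_bcontfun z) t - J (apply_bcontfun w) t"
    have "norm (?D (c t) - ?D 0) \<le> (L * dist z w) * \<bar>c t - 0\<bar>"
    proof (rule vector_derivative_mean_bound[where S = "{-T..T}" and
            e' = "\<lambda>t. g t (apply_bcontfun z t) - g t (apply_bcontfun w t)"])
      show "(?D has_vector_derivative g s (apply_bcontfun z s) - g s (apply_bcontfun w s)) (at s within {-T..T})"
        if "s \<in> {-T..T}" for s
        using Jd[OF cz(1) that] Jd[OF cz(2) that] by (rule has_vector_derivative_diff)
      show "norm (g s (apply_bcontfun z s) - g s (apply_bcontfun w s)) \<le> L * dist z w" if "s \<in> {-T..T}" for s
      proof -
        have "norm (g s (apply_bcontfun z s) - g s (apply_bcontfun w s)) \<le> L * norm (apply_bcontfun z s - apply_bcontfun w s)"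
          using that by (intro lip) auto
        also have "\<dots> \<le> L * dist z w"
          using dist_bounded[of z s w] by (intro mult_left_mono L) (simp add: dist_norm)
        finally show ?thesis .
      qed
    qed (use c T in auto)
    also have "\<dots> \<le> L * dist z w * T"
      using c L by (intro mult_left_mono) auto
    also have "\<dots> \<le> 1/2 * dist z w"
      using mult_right_mono[OF L(2) zero_le_dist[of z w]] by (simp add: algebra_simps)
    finally show "dist (apply_bcontfun (P z) t) (apply_bcontfun (P w) t) \<le> (1/2) * dist z w"
      by (simp add: P_def P dist_norm J0)
  qed
  then obtain z where z: "P z = z"
    using banach_fix_type[of "1/2" P] by auto
  have zt: "apply_bcontfun z t = J (apply_bcontfun z) (c t)" for t
    using P[of z t] z by (simp add: P_def)
  have cz: "continuous_on UNIV (apply_bcontfun z)" using continuous_on_apply_bcontfun by blast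
  show ?thesis
  proof (intro exI[of _ "apply_bcontfun z"] conjI allI impI)
    show "apply_bcontfun z 0 = 0" using zt[of 0] c_id[of 0] T by (simp add: J_def)
    fix t assume t: "\<bar>t\<bar> < T"
    have "(J (apply_bcontfun z) has_vector_derivative g t (apply_bcontfun z t)) (at t within {-T<..<T})"
      by (rule has_vector_derivative_within_subset[OF Jd[OF cz]]) (use t in auto)
    then have "(J (apply_bcontfun z) has_vector_derivative g t (apply_bcontfun z t)) (at t)"
      using t by (subst (asm) at_within_open) auto
    moreover have "apply_bcontfun z s = J (apply_bcontfun z) s" if "s \<in> {-T<..<T}" for s
      using zt[of s] c_id[of s] that by auto
    ultimately show "(apply_bcontfun z has_vector_derivative g t (apply_bcontfun z t)) (at t)"
      using t by (auto elim!: has_vector_derivative_transform_within_open[where S = "{-T<..<T}"])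
  qed
qed

section \<open>Uniform estimates near a compact set\<close>

text \<open>Uniform continuity in which the second point may leave \<open>K\<close>: a Lebesgue
  number for the cover by open sets on which \<open>h\<close> varies by less than
  \<open>\<eta>\<close>.\<close>

lemma continuous_near_compact:
  fixes h :: "'a::metric_space \<Rightarrow> 'b::metric_space"
  assumes "open S" "continuous_on S h" "compact K" "K \<subseteq> S" "0 < \<eta>"
  obtains d where "0 < d" "\<And>x x'. x \<in> K \<Longrightarrow> dist x' x < d \<Longrightarrow> x' \<in> S \<and> dist (h x') (h x) < \<eta>"
proof -
  let ?G = "{G. open G \<and> G \<subseteq> S \<and> (\<forall>x\<in>G. \<forall>x'\<in>G. dist (h x) (h x') < \<eta>)}"
  have cov: "K \<subseteq> \<Union>?G"
  proof
    fix x assume "x \<in> K"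
    then have x: "x \<in> S" using assms by auto
    then have "isCont h x" using assms by (simp add: continuous_on_eq_continuous_at)
    then obtain d1 where d1: "d1 > 0" "\<And>y. dist y x < d1 \<Longrightarrow> dist (h y) (h x) < \<eta>/2"
      unfolding continuous_at_eps_delta using \<open>0 < \<eta>\<close> by (metis half_gt_zero)
    obtain d2 where d2: "d2 > 0" "ball x d2 \<subseteq> S" using x assms openE by blast
    have "ball x (min d1 d2) \<in> ?G"
      using d1 d2 by (auto simp: dist_commute subset_iff intro!: dist_triangle_half_r[of "h x" _ \<eta>])
    then show "x \<in> \<Union>?G" by (rule UnionI) (use d1 d2 in simp)
  qed
  obtain e where e: "0 < e" "\<And>x. x \<in> K \<Longrightarrow> \<exists>G\<in>?G. ball x e \<subseteq> G"
  proof (rule Heine_Borel_lemma[OF assms(3) cov])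
    show "open G" if "G \<in> ?G" for G using that by blast
  qed (rule that)
  show ?thesis
  proof (rule that[OF e(1)])
    fix x x' assume "x \<in> K" "dist x' x < e"
    from e(2)[OF \<open>x \<in> K\<close>] obtain G where G: "G \<in> ?G" "ball x e \<subseteq> G" by (rule bexE)
    then have "x \<in> G" "x' \<in> G" using \<open>dist x' x < e\<close> e(1) by (auto simp: dist_commute)
    with G(1) show "x' \<in> S \<and> dist (h x') (h x) < \<eta>" by blast
  qed
qed

text \<open>On a ball around \<open>x\<close> the derivative differs from the one at
  \<open>x\<close> by at most \<open>\<eta>\<close>, with one radius for all \<open>x\<close> in
  \<open>K\<close>; the mean value inequality converts this into the first order error.\<close>

lemma C_1_on_uniform_linearization:
  fixes h :: "'a::euclidean_space \<Rightarrow> 'b::real_normed_vector"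
  assumes "open S" "C_k_on (Suc 0) S h" "compact K" "K \<subseteq> S" "0 < \<eta>"
  obtains d where "0 < d"
    "\<And>x v. x \<in> K \<Longrightarrow> norm v < d \<Longrightarrow> x + v \<in> S \<and> norm (h (x + v) - h x - frechet_derivative h (at x) v) \<le> \<eta> * norm v"
proof -
  let ?D = "\<lambda>x. Blinfun (frechet_derivative h (at x))"
  have der: "(h has_derivative blinfun_apply (?D x)) (at x)" if "x \<in> S" for x
    using C_k_on_SucD[OF assms(2) that] has_derivative_bounded_linear by (metis bounded_linear_Blinfun_apply)
  obtain d where d: "0 < d" "\<And>x x'. x \<in> K \<Longrightarrow> dist x' x < d \<Longrightarrow> x' \<in> S \<and> dist (?D x') (?D x) < \<eta>"
    by (rule continuous_near_compact[OF assms(1) C_1_on_continuous_blinfun[OF assms(2)] assms(3,4,5)]) (rule that)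
  show ?thesis
  proof (rule that[OF d(1)])
    fix x v :: 'a assume x: "x \<in> K" and v: "norm v < d"
    have near: "dist x' x < d" if "x' \<in> ball x d" for x' using that by (simp add: dist_commute)
    have "norm (h (x + v) - h x - blinfun_apply (?D x) (x + v - x)) \<le> norm (x + v - x) * \<eta>"
    proof (rule differentiable_bound_linearization[where S = "ball x d" and f' = "\<lambda>x. blinfun_apply (?D x)" and ?x0.0 = x])
      show "\<And>t. t \<in> {0..1} \<Longrightarrow> x + t *\<^sub>R (x + v - x) \<in> ball x d"
        using v by (auto simp: dist_norm intro: le_less_trans[OF mult_left_le_one_le])
      show "(h has_derivative blinfun_apply (?D x')) (at x' within ball x d)" if "x' \<in> ball x d" for x'
        using d(2)[OF x near[OF that]] der has_derivative_at_withinI by blast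
      show "onorm (blinfun_apply (?D x') - blinfun_apply (?D x)) \<le> \<eta>" if "x' \<in> ball x d" for x'
        using d(2)[OF x near[OF that]]
        by (simp add: dist_norm norm_blinfun.rep_eq minus_blinfun.rep_eq fun_diff_def)
      show "x \<in> ball x d" using d by simp
    qed
    moreover have "blinfun_apply (?D x) v = frechet_derivative h (at x) v"
      using frechet_derivative_at[OF der] x assms(4) by auto
    moreover have "x + v \<in> S" using d(2)[OF x, of "x + v"] v by (simp add: dist_norm)
    ultimately show "x + v \<in> S \<and> norm (h (x + v) - h x - frechet_derivative h (at x) v) \<le> \<eta> * norm v"
      by (simp add: mult.commute)
  qed
qed

text \<open>A solution of \<open>z' = g(t, y, z)\<close>, \<open>z(0) = 0\<close> for every parameter \<open>y\<close>, on a time interval so short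
  that the integral operator is a contraction.\<close>

definition ode_solution ::
    "real \<Rightarrow> 'a::euclidean_space set \<Rightarrow> 'b::euclidean_space set \<Rightarrow> real \<Rightarrow> (real \<times> 'a \<times> 'b \<Rightarrow> 'b) \<Rightarrow> (real \<times> 'a \<Rightarrow> 'b) \<Rightarrow> bool"
  where "ode_solution T U W L g z \<longleftrightarrow> open U \<and> open W \<and> convex W \<and> 0 \<le> L \<and> 2 * L * T \<le> 1 \<and>
    (\<forall>t y z w. \<bar>t\<bar> < T \<longrightarrow> y \<in> U \<longrightarrow> z \<in> W \<longrightarrow> w \<in> W \<longrightarrow> norm (g (t, y, z) - g (t, y, w)) \<le> L * norm (z - w)) \<and>
    (\<forall>y\<in>U. z (0, y) = 0 \<and> (\<forall>t. \<bar>t\<bar> < T \<longrightarrow> z (t, y) \<in> W \<and>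
      ((\<lambda>s. z (s, y)) has_vector_derivative g (t, y, z (t, y))) (at t)))"

lemma ode_solution_mono: "ode_solution T U W L g z \<Longrightarrow> T' \<le> T \<Longrightarrow> ode_solution T' U W L g z"
  unfolding ode_solution_def by (auto intro: order_trans[OF mult_left_mono])

lemma ode_solution_curve_compact:
  assumes "ode_solution T U W L g z" "y \<in> U" "T' < T"
  shows "compact ((\<lambda>t. (t, y, z (t, y))) ` {-T'..T'})"
    and "(\<lambda>t. (t, y, z (t, y))) ` {-T'..T'} \<subseteq> {-T<..<T} \<times> U \<times> W"
proof -
  have "continuous_on {-T'..T'} (\<lambda>t. z (t, y))"
  proof (intro continuous_at_imp_continuous_on ballI)
    fix t assume "t \<in> {-T'..T'}"
    then have "\<bar>t\<bar> < T" using assms(3) by auto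
    then show "isCont (\<lambda>t. z (t, y)) t"
      using assms has_vector_derivative_continuous unfolding ode_solution_def by blast
  qed
  then show "compact ((\<lambda>t. (t, y, z (t, y))) ` {-T'..T'})"
    by (intro compact_continuous_image continuous_intros) auto
  show "(\<lambda>t. (t, y, z (t, y))) ` {-T'..T'} \<subseteq> {-T<..<T} \<times> U \<times> W"
    using assms unfolding ode_solution_def by auto
qed

section \<open>Dependence of solutions on the parameter\<close>

text \<open>The difference of the two right-hand sides splits into a change of \<open>z\<close> at
  the new parameter, controlled by \<open>L\<close>, and a change of parameter along the old curve,
  uniformly small since that curve is compact. \<open>ode_estimate\<close> then applies.\<close>

lemma ode_solution_near:
  assumes sol: "ode_solution T U W L g z" and cont: "continuous_on ({-T<..<T} \<times> U \<times> W) g"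
    and y: "y \<in> U" and T': "T' < T" and "0 < \<eta>"
  obtains d where "0 < d" "\<And>t y'. \<bar>t\<bar> < T' \<Longrightarrow> dist y' y < d \<Longrightarrow> y' \<in> U \<and> dist (z (t, y')) (z (t, y)) < \<eta>"
proof -
  have op: "open ({-T<..<T} \<times> U \<times> W)" using sol by (auto simp: ode_solution_def open_Times)
  \<comment> \<open>Makes the final bound \<open>2 * T' * \<eta>'\<close> smaller than
    \<open>\<eta>\<close>; the absolute value is there because the sign of \<open>T'\<close> is open
    at this point.\<close>
  define \<eta>' where "\<eta>' = \<eta> / (2 * \<bar>T'\<bar> + 1)"
  have \<eta>': "0 < \<eta>'" "2 * T' * \<eta>' < \<eta>" using \<open>0 < \<eta>\<close> by (auto simp: \<eta>'_def field_simps abs_if)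
  obtain d where d: "0 < d" "\<And>x x'. x \<in> (\<lambda>t. (t, y, z (t, y))) ` {-T'..T'} \<Longrightarrow> dist x' x < d \<Longrightarrow>
      x' \<in> {-T<..<T} \<times> U \<times> W \<and> dist (g x') (g x) < \<eta>'"
    by (rule continuous_near_compact[OF op cont ode_solution_curve_compact[OF sol y T'] \<eta>'(1)]) (rule that)
  show ?thesis
  proof (rule that[OF d(1)])
    fix t y' assume t: "\<bar>t\<bar> < T'" and y': "dist y' y < d"
    have near: "(s, y', z (s, y)) \<in> {-T<..<T} \<times> U \<times> W \<and> norm (g (s, y', z (s, y)) - g (s, y, z (s, y))) < \<eta>'"
      if "\<bar>s\<bar> < T'" for s
    proof -
      have "(s, y, z (s, y)) \<in> (\<lambda>t. (t, y, z (t, y))) ` {-T'..T'}"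
        using that by (intro imageI) auto
      from d(2)[OF this, of "(s, y', z (s, y))"] y' show ?thesis
        by (auto simp: dist_Pair_Pair dist_norm)
    qed
    have yU: "y' \<in> U" using near[OF t] by auto
    have "norm (z (t, y') - z (t, y)) \<le> 2 * T' * \<eta>'"
    proof (rule ode_estimate[where e' = "\<lambda>t. g (t, y', z (t, y')) - g (t, y, z (t, y))" and L = L])
      show "((\<lambda>t. z (t, y') - z (t, y)) has_vector_derivative g (s, y', z (s, y')) - g (s, y, z (s, y))) (at s)"
        if "\<bar>s\<bar> < T'" for s
        using sol y yU that T' unfolding ode_solution_def by (intro has_vector_derivative_diff) auto
      show "z (0, y') - z (0, y) = 0" using sol y yU unfolding ode_solution_def by auto
      show "norm (g (s, y', z (s, y')) - g (s, y, z (s, y))) \<le> L * norm (z (s, y') - z (s, y)) + \<eta>'"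
        if "\<bar>s\<bar> < T'" for s
      proof -
        have "norm (g (s, y', z (s, y')) - g (s, y', z (s, y))) \<le> L * norm (z (s, y') - z (s, y))"
          using sol y yU that T' unfolding ode_solution_def by auto
        moreover have "norm (g (s, y', z (s, y)) - g (s, y, z (s, y))) \<le> \<eta>'" using near[OF that] by auto
        ultimately show ?thesis
          using norm_triangle_ineq[of "g (s, y', z (s, y')) - g (s, y', z (s, y))" "g (s, y', z (s, y)) - g (s, y, z (s, y))"]
          by simp
      qed
      show "0 \<le> L" "2 * L * T' \<le> 1"
        using sol ode_solution_mono[OF sol less_imp_le[OF T']] by (auto simp: ode_solution_def)
    qed (rule t)
    then show "y' \<in> U \<and> dist (z (t, y')) (z (t, y)) < \<eta>" using yU \<eta>' by (simp add: dist_norm)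
  qed
qed

lemma ode_solution_continuous:
  assumes sol: "ode_solution T U W L g z" and cont: "continuous_on ({-T<..<T} \<times> U \<times> W) g"
  shows "continuous_on ({-T<..<T} \<times> U) z"
proof (intro continuous_at_imp_continuous_on ballI)
  fix x assume "x \<in> {-T<..<T} \<times> U"
  then obtain t y where x: "x = (t, y)" and t: "\<bar>t\<bar> < T" and y: "y \<in> U" by force
  then obtain T' where T': "\<bar>t\<bar> < T'" "T' < T" using dense by blast
  have c: "isCont (\<lambda>t. z (t, y)) t"
    using sol y t has_vector_derivative_continuous unfolding ode_solution_def by blast
  show "isCont z x"
    unfolding continuous_at_eps_delta
  proof (intro allI impI)
    fix \<eta> :: real assume "0 < \<eta>"
    then have "0 < \<eta>/2" by simp
    obtain d where d: "0 < d" "\<And>t y'. \<bar>t\<bar> < T' \<Longrightarrow> dist y' y < d \<Longrightarrow> y' \<in> U \<and> dist (z (t, y')) (z (t, y)) < \<eta>/2"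
      by (rule ode_solution_near[OF sol cont y T'(2) \<open>0 < \<eta>/2\<close>]) (rule that)
    obtain d' where d': "0 < d'" "\<And>s. dist s t < d' \<Longrightarrow> dist (z (s, y)) (z (t, y)) < \<eta>/2"
      using c \<open>0 < \<eta>/2\<close> unfolding continuous_at_eps_delta by metis
    let ?r = "min (min d d') (T' - \<bar>t\<bar>)"
    show "\<exists>r>0. \<forall>x'. dist x' x < r \<longrightarrow> dist (z x') (z x) < \<eta>"
    proof (intro exI[of _ ?r] conjI allI impI)
      show "0 < ?r" using d d' T' by auto
      fix x' assume r: "dist x' x < ?r"
      obtain s y' where x': "x' = (s, y')" by force
      have "dist s t < ?r" "dist y' y < ?r"
        using r dist_fst_le[of x' x] dist_snd_le[of x' x] by (auto simp: x x')
      then have "\<bar>s\<bar> < T'" "dist y' y < d" "dist s t < d'" by (auto simp: dist_real_def)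
      then show "dist (z x') (z x) < \<eta>"
        using d(2)[of s y'] d'(2)[of s] x x' dist_triangle_half_r[of "z (s, y)" "z (s, y')" \<eta> "z (t, y)"]
        by (auto simp: dist_commute)
    qed
  qed
qed

lemma lipschitz_imp_derivative_bound:
  fixes f :: "'a::real_normed_vector \<Rightarrow> 'b::real_normed_vector"
  assumes der: "(f has_derivative f') (at x)" and "0 < r"
    and lip: "\<And>s. \<bar>s\<bar> < r \<Longrightarrow> norm (f (x + s *\<^sub>R v) - f x) \<le> \<bar>s\<bar> * C"
  shows "norm (f' v) \<le> C"
proof -
  have "((\<lambda>s::real. x + s *\<^sub>R v) has_derivative (\<lambda>s. s *\<^sub>R v)) (at 0)"
    by (auto intro!: derivative_eq_intros)
  from has_derivative_compose[OF this, of f f'] der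
  have "((\<lambda>s. f (x + s *\<^sub>R v)) has_derivative (\<lambda>s. f' (s *\<^sub>R v))) (at 0)" by simp
  then have "((\<lambda>s. norm (f (x + s *\<^sub>R v) - f x - f' (s *\<^sub>R v)) / norm s) \<longlongrightarrow> 0) (at 0)"
    by (simp add: has_derivative_at)
  moreover have "\<forall>\<^sub>F s in at 0. norm (f' v) - norm (f (x + s *\<^sub>R v) - f x - f' (s *\<^sub>R v)) / norm s \<le> C"
  proof -
    have "norm (f' v) - norm (f (x + s *\<^sub>R v) - f x - f' (s *\<^sub>R v)) / norm s \<le> C" if s: "\<bar>s\<bar> < r" "s \<noteq> 0" for s :: real
    proof -
      have "f' (s *\<^sub>R v) = s *\<^sub>R f' v"
        using linear_cmul[OF has_derivative_linear[OF der]] .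
      then have "\<bar>s\<bar> * norm (f' v) \<le> norm (f (x + s *\<^sub>R v) - f x - f' (s *\<^sub>R v)) + norm (f (x + s *\<^sub>R v) - f x)"
        using norm_triangle_ineq2[of "s *\<^sub>R f' v" "f (x + s *\<^sub>R v) - f x"] by (simp add: norm_minus_commute)
      then show ?thesis using lip[OF s(1)] s(2) by (simp add: field_simps)
    qed
    then show ?thesis
      using \<open>0 < r\<close> by (auto simp: eventually_at dist_norm)
  qed
  ultimately have "norm (f' v) - 0 \<le> C"
    by (intro tendsto_upperbound[OF tendsto_diff[OF tendsto_const]]) auto
  then show ?thesis by simp
qed

section \<open>The linearized equation and differentiability in the parameter\<close>

text \<open>Right-hand side of the variational equation: differentiating the differential equation
  in the parameter direction \<open>v\<close> says that the derivative of \<open>z\<close> must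
  solve this equation, which is linear in \<open>\<zeta>\<close>.\<close>

definition variation_rhs ::
    "(real \<times> 'a::euclidean_space \<times> 'b::euclidean_space \<Rightarrow> 'b) \<Rightarrow> (real \<times> 'a \<Rightarrow> 'b) \<Rightarrow> 'a \<Rightarrow> real \<times> 'a \<times> 'b \<Rightarrow> 'b"
  where "variation_rhs g z v = (\<lambda>(t, y, \<zeta>). frechet_derivative g (at (t, y, z (t, y))) (0, v, \<zeta>))"

lemma open_time_interval [simp]: "open U \<Longrightarrow> open ({-T<..<T::real} \<times> U)"
  by (simp add: open_Times)

lemma frechet_derivative_split:
  fixes g :: "'t::real_normed_vector \<times> 'a::real_normed_vector \<times> 'b::euclidean_space \<Rightarrow> 'c::real_normed_vector"
  assumes "g differentiable (at x)"
  shows "frechet_derivative g (at x) (0, a *\<^sub>R v, \<zeta>) =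
    a *\<^sub>R frechet_derivative g (at x) (0, v, 0) + (\<Sum>b\<in>Basis. (\<zeta> \<bullet> b) *\<^sub>R frechet_derivative g (at x) (0, 0, b))"
proof -
  note l = linear_frechet_derivative[OF assms]
  have "(0 :: 't, a *\<^sub>R v, \<zeta>) = a *\<^sub>R (0, v, 0) + (\<Sum>b\<in>Basis. (\<zeta> \<bullet> b) *\<^sub>R (0, 0, b))"
    by (simp add: prod_eq_iff fst_sum snd_sum euclidean_representation)
  then show ?thesis by (simp only: linear_add[OF l] linear_cmul[OF l] linear_sum[OF l])
qed

lemma C_1_on_differentiable_triple:
  fixes T :: real
  assumes "C_k_on (Suc 0) ({-T<..<T} \<times> U \<times> W) g" "\<bar>t\<bar> < T" "y \<in> U" "z \<in> W"
  shows "g differentiable (at (t, y, z))"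
proof -
  have "-T < t \<and> t < T" using assms(2) by linarith
  then have "(t, y, z) \<in> {-T<..<T} \<times> U \<times> W" using assms(3-) by auto
  with assms(1) show ?thesis unfolding C_k_on.simps by blast
qed

text \<open>One order of \<open>g\<close> is spent on differentiating it. Splitting the argument
  \<open>(0, v, \<zeta>)\<close> into fixed directions leaves coefficients that are compositions of
  directional derivatives of \<open>g\<close> with \<open>z\<close>.\<close>

lemma C_k_on_variation_rhs:
  assumes sol: "ode_solution T U W L g z"
    and g: "C_k_on (Suc k) ({-T<..<T} \<times> U \<times> W) g" and z: "C_k_on k ({-T<..<T} \<times> U) z"
  shows "C_k_on k ({-T<..<T} \<times> U \<times> UNIV) (variation_rhs g z v)"
proof -
  let ?S = "{-T<..<T} \<times> U \<times> UNIV :: (real \<times> 'a \<times> 'b) set"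
  have op: "open ?S" using sol by (auto simp: ode_solution_def open_Times)
  define P where "P x = (fst x, fst (snd x), z (fst x, fst (snd x)))" for x :: "real \<times> 'a \<times> 'b"
  have lin: "C_k_on k ?S fst" "C_k_on k ?S (\<lambda>x. fst (snd x))" "C_k_on k ?S (\<lambda>x. snd (snd x))"
    by (auto intro!: C_k_on_bounded_linear bounded_linear_intros)
  have "C_k_on k ?S (\<lambda>x. z (fst x, fst (snd x)))"
    by (rule C_k_on_compose[OF op C_k_on_Pair[OF op lin(1,2)] z]) auto
  then have PC: "C_k_on k ?S P"
    unfolding P_def by (intro C_k_on_Pair op lin)
  have PS: "P ` ?S \<subseteq> {-T<..<T} \<times> U \<times> W"
    using sol by (auto simp: P_def ode_solution_def)
  have D: "C_k_on k ?S (\<lambda>x. frechet_derivative g (at (P x)) e)" for e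
    by (rule C_k_on_compose[OF op PC C_k_on_SucD'[OF g] PS])
  have "C_k_on k ?S (\<lambda>x. frechet_derivative g (at (P x)) (0, v, 0) +
     (\<Sum>b\<in>Basis. (snd (snd x) \<bullet> b) *\<^sub>R frechet_derivative g (at (P x)) (0, 0, b)))"
    by (intro C_k_on_add C_k_on_sum C_k_on_scaleR C_k_on_inner D lin C_k_on_const op)
  moreover have "frechet_derivative g (at (P x)) (0, v, 0) +
     (\<Sum>b\<in>Basis. (snd (snd x) \<bullet> b) *\<^sub>R frechet_derivative g (at (P x)) (0, 0, b)) = variation_rhs g z v x" if "x \<in> ?S" for x
  proof -
    have "P x \<in> {-T<..<T} \<times> U \<times> W" using PS that by blast
    then have "g differentiable (at (P x))" using g by auto
    from frechet_derivative_split[OF this, of 1 v "snd (snd x)"] show ?thesis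
      by (simp add: variation_rhs_def P_def split_beta)
  qed
  ultimately show ?thesis by (rule C_k_on_cong_aux[OF op, rotated])
qed

text \<open>The Lipschitz constant of \<open>g\<close> bounds its derivative in the last argument,
  so the linearized equation has the same \<open>L\<close> and the same smallness condition.\<close>

lemma variation_rhs_bound:
  assumes sol: "ode_solution T U W L g z" and g: "C_k_on (Suc 0) ({-T<..<T} \<times> U \<times> W) g"
    and "\<bar>t\<bar> < T" "y \<in> U" "\<zeta> \<in> W"
  shows "norm (frechet_derivative g (at (t, y, \<zeta>)) (0, 0, e)) \<le> L * norm e"
proof -
  obtain r where r: "0 < r" "ball \<zeta> r \<subseteq> W"
    using sol assms(5) openE unfolding ode_solution_def by blast
  show ?thesis
  proof (rule lipschitz_imp_derivative_bound[OF C_k_on_SucD[OF g]])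
    show "0 < r / (norm e + 1)" using r by (intro divide_pos_pos) (auto intro: add_nonneg_pos)
    fix s assume s: "\<bar>s\<bar> < r / (norm e + 1)"
    have ne: "0 < norm e + 1" using norm_ge_zero[of e] by linarith
    have "norm (s *\<^sub>R e) \<le> \<bar>s\<bar> * (norm e + 1)" by (simp add: mult_left_mono)
    also have "\<dots> < r" using s ne by (simp add: pos_less_divide_eq)
    finally have "\<zeta> + s *\<^sub>R e \<in> W" using r by (auto simp: dist_norm)
    then have "norm (g (t, y, \<zeta> + s *\<^sub>R e) - g (t, y, \<zeta>)) \<le> L * norm (\<zeta> + s *\<^sub>R e - \<zeta>)"
      using sol assms(3-5) unfolding ode_solution_def by blast
    then show "norm (g ((t, y, \<zeta>) + s *\<^sub>R (0, 0, e)) - g (t, y, \<zeta>)) \<le> \<bar>s\<bar> * (L * norm e)"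
      by (simp add: mult_ac)
  qed (use assms in auto)
qed

text \<open>Being linear in \<open>\<zeta>\<close>, the equation is globally Lipschitz and needs no
  restriction to a convex set, so \<open>UNIV\<close> takes the place of \<open>W\<close>. Time
  shrinks to \<open>T'\<close> because \<open>ode_exists\<close> wants continuity on a closed time
  interval.\<close>

lemma variation_exists:
  assumes sol: "ode_solution T U W L g z" and g: "C_k_on (Suc 0) ({-T<..<T} \<times> U \<times> W) g"
    and T': "0 < T'" "T' < T"
  obtains w where "\<And>v. ode_solution T' U UNIV L (variation_rhs g z v) (w v)"
proof -
  have zc: "continuous_on ({-T<..<T} \<times> U) z"
    using ode_solution_continuous[OF sol C_k_on_imp_continuous[OF g]] .
  have sol': "0 \<le> L" "2 * L * T' \<le> 1" "open U"
    using ode_solution_mono[OF sol less_imp_le[OF T'(2)]] by (auto simp: ode_solution_def)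
  have lip: "norm (variation_rhs g z v (t, y, \<zeta>) - variation_rhs g z v (t, y, \<zeta>')) \<le> L * norm (\<zeta> - \<zeta>')"
    if "\<bar>t\<bar> < T" "y \<in> U" for t y v \<zeta> \<zeta>'
  proof -
    have zW: "z (t, y) \<in> W" using sol that unfolding ode_solution_def by blast
    have "g differentiable (at (t, y, z (t, y)))" using C_1_on_differentiable_triple[OF g that zW] .
    from linear_diff[OF linear_frechet_derivative[OF this], of "(0, v, \<zeta>)" "(0, v, \<zeta>')"]
    have "variation_rhs g z v (t, y, \<zeta>) - variation_rhs g z v (t, y, \<zeta>') =
       frechet_derivative g (at (t, y, z (t, y))) (0, 0, \<zeta> - \<zeta>')"
      by (simp add: variation_rhs_def)
    then show ?thesis using variation_rhs_bound[OF sol g that zW] by simp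
  qed
  have "\<exists>w. w 0 = 0 \<and> (\<forall>t. \<bar>t\<bar> < T' \<longrightarrow> (w has_vector_derivative variation_rhs g z v (t, y, w t)) (at t))"
    if y: "y \<in> U" for v y
  proof (rule ode_exists[where L = L and g = "\<lambda>t \<zeta>. variation_rhs g z v (t, y, \<zeta>)"])
    have "continuous_on ({-T<..<T} \<times> U \<times> UNIV) (variation_rhs g z v)"
      using C_k_on_variation_rhs[OF sol g] zc by simp
    moreover have "continuous_on ({-T'..T'} \<times> UNIV) (\<lambda>(t, \<zeta>). (t, y, \<zeta>))"
      by (simp add: split_beta) (intro continuous_intros)
    ultimately show "continuous_on ({-T'..T'} \<times> UNIV) (\<lambda>(t, \<zeta>). variation_rhs g z v (t, y, \<zeta>))"
      unfolding split_beta by (rule continuous_on_compose2) (use T' y in auto)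
  qed (use T' sol' lip y in auto)
  then have "\<forall>v. \<forall>y\<in>U. \<exists>w. w 0 = 0 \<and> (\<forall>t. \<bar>t\<bar> < T' \<longrightarrow> (w has_vector_derivative variation_rhs g z v (t, y, w t)) (at t))"
    by blast
  then obtain w where w: "\<And>v y. y \<in> U \<Longrightarrow> w v y 0 = 0 \<and>
      (\<forall>t. \<bar>t\<bar> < T' \<longrightarrow> (w v y has_vector_derivative variation_rhs g z v (t, y, w v y t)) (at t))"
    unfolding choice_iff bchoice_iff by blast
  show ?thesis
  proof (rule that[of "\<lambda>v (t, y). w v y t"])
    show "ode_solution T' U UNIV L (variation_rhs g z v) (\<lambda>(t, y). w v y t)" for v
      using w sol' lip T' unfolding ode_solution_def by auto
  qed
qed

context
  fixes T L :: real and U :: "'a::euclidean_space set" and W :: "'b::euclidean_space set" and g z w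
  assumes sol: "ode_solution T U W L g z" and g: "C_k_on (Suc 0) ({-T<..<T} \<times> U \<times> W) g"
    and w: "\<And>v. ode_solution T U UNIV L (variation_rhs g z v) (w v)"
begin

text \<open>Both sides of additivity and of homogeneity solve the same linear equation with initial
  value 0; \<open>ode_estimate\<close> with error 0 identifies them.\<close>

lemma variation_linear:
  assumes "\<bar>t\<bar> < T" "y \<in> U"
  shows "linear (\<lambda>v. w v (t, y))"
proof -
  have zW: "z (s, y) \<in> W" if "\<bar>s\<bar> < T" for s using sol that assms(2) unfolding ode_solution_def by blast
  have lin: "linear (frechet_derivative g (at (s, y, z (s, y))))" if "\<bar>s\<bar> < T" for s
    by (rule linear_frechet_derivative[OF C_1_on_differentiable_triple[OF g that assms(2) zW[OF that]]])
  have TL: "0 \<le> L" "2 * L * T \<le> 1" using sol by (auto simp: ode_solution_def)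
  have w0: "w v (0, y) = 0" for v using w assms(2) by (auto simp: ode_solution_def)
  have wd: "((\<lambda>s. w v (s, y)) has_vector_derivative
      frechet_derivative g (at (s, y, z (s, y))) (0, v, w v (s, y))) (at s)" if "\<bar>s\<bar> < T" for v s
    using w[of v] that assms(2) by (auto simp: ode_solution_def variation_rhs_def)
  have lb: "norm (frechet_derivative g (at (s, y, z (s, y))) (0, 0, e)) \<le> L * norm e + 0" if "\<bar>s\<bar> < T" for s e
    using variation_rhs_bound[OF sol g that assms(2) zW[OF that]] by simp
  have "w (a + b) (t, y) - (w a (t, y) + w b (t, y)) = 0" for a b
  proof -
    have "norm (w (a + b) (t, y) - (w a (t, y) + w b (t, y))) \<le> 2 * T * 0"
    proof (rule ode_estimate[where e = "\<lambda>t. w (a + b) (t, y) - (w a (t, y) + w b (t, y))" and L = L])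
      fix s assume s: "\<bar>s\<bar> < T"
      let ?D = "frechet_derivative g (at (s, y, z (s, y)))"
      show "((\<lambda>t. w (a + b) (t, y) - (w a (t, y) + w b (t, y))) has_vector_derivative
        ?D (0, a + b, w (a + b) (s, y)) - (?D (0, a, w a (s, y)) + ?D (0, b, w b (s, y)))) (at s)"
        by (intro has_vector_derivative_diff has_vector_derivative_add wd s)
      have "?D (0, a + b, w (a + b) (s, y)) - (?D (0, a, w a (s, y)) + ?D (0, b, w b (s, y))) =
        ?D (0, 0, w (a + b) (s, y) - (w a (s, y) + w b (s, y)))"
        by (simp add: linear_add[OF lin[OF s], symmetric] linear_diff[OF lin[OF s], symmetric])
      then show "norm (?D (0, a + b, w (a + b) (s, y)) - (?D (0, a, w a (s, y)) + ?D (0, b, w b (s, y)))) \<le>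
        L * norm (w (a + b) (s, y) - (w a (s, y) + w b (s, y))) + 0"
        using lb[OF s] by metis
    qed (use TL w0 assms in auto)
    then show ?thesis by simp
  qed
  moreover have "w (c *\<^sub>R a) (t, y) - c *\<^sub>R w a (t, y) = 0" for a c
  proof -
    have "norm (w (c *\<^sub>R a) (t, y) - c *\<^sub>R w a (t, y)) \<le> 2 * T * 0"
    proof (rule ode_estimate[where e = "\<lambda>t. w (c *\<^sub>R a) (t, y) - c *\<^sub>R w a (t, y)" and L = L])
      fix s assume s: "\<bar>s\<bar> < T"
      let ?D = "frechet_derivative g (at (s, y, z (s, y)))"
      show "((\<lambda>t. w (c *\<^sub>R a) (t, y) - c *\<^sub>R w a (t, y)) has_vector_derivative
        ?D (0, c *\<^sub>R a, w (c *\<^sub>R a) (s, y)) - c *\<^sub>R ?D (0, a, w a (s, y))) (at s)"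
        using bounded_linear.has_vector_derivative[OF bounded_linear_scaleR_right wd[OF s]]
        by (intro has_vector_derivative_diff wd s)
      have "?D (0, c *\<^sub>R a, w (c *\<^sub>R a) (s, y)) - c *\<^sub>R ?D (0, a, w a (s, y)) =
        ?D (0, 0, w (c *\<^sub>R a) (s, y) - c *\<^sub>R w a (s, y))"
        by (simp add: linear_cmul[OF lin[OF s], symmetric] linear_diff[OF lin[OF s], symmetric])
      then show "norm (?D (0, c *\<^sub>R a, w (c *\<^sub>R a) (s, y)) - c *\<^sub>R ?D (0, a, w a (s, y))) \<le>
        L * norm (w (c *\<^sub>R a) (s, y) - c *\<^sub>R w a (s, y)) + 0"
        using lb[OF s] by metis
    qed (use TL w0 assms in auto)
    then show ?thesis by simp
  qed
  ultimately show ?thesis by (intro linearI) auto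
qed

text \<open>Two rounds of \<open>ode_estimate\<close>: the first shows that the solutions are
  Lipschitz in the parameter, the second bounds the difference between their increment and the
  candidate \<open>w\<close> by an arbitrarily small multiple of the parameter increment.\<close>

lemma variation_has_derivative_parameter:
  assumes t: "\<bar>t\<bar> < T" and y: "y \<in> U"
  shows "((\<lambda>y. z (t, y)) has_derivative (\<lambda>v. w v (t, y))) (at y)"
proof -
  have TL: "0 \<le> L" "2 * L * T \<le> 1" "open U" "open W" using sol by (auto simp: ode_solution_def)
  obtain T' where T': "\<bar>t\<bar> < T'" "T' < T" using t dense by blast
  have T'L: "2 * L * T' \<le> 1" "0 < T'"
    using TL T' mult_left_mono[of T' T "2 * L"] by auto
  have op: "open ({-T<..<T} \<times> U \<times> W)" using TL by (auto simp: open_Times)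
  let ?K = "(\<lambda>t. (t, y, z (t, y))) ` {-T'..T'}"
  note K = ode_solution_curve_compact[OF sol y T'(2)]
  let ?D = "\<lambda>s. frechet_derivative g (at (s, y, z (s, y)))"
  have zW: "z (s, y) \<in> W" if "\<bar>s\<bar> < T" "y \<in> U" for s y using sol that unfolding ode_solution_def by blast
  have lin: "linear (?D s)" if "\<bar>s\<bar> < T" for s
    by (rule linear_frechet_derivative[OF C_1_on_differentiable_triple[OF g that y zW[OF that y]]])
  have wd: "((\<lambda>s. w v (s, y)) has_vector_derivative ?D s (0, v, w v (s, y))) (at s)" if "\<bar>s\<bar> < T" for v s
    using w[of v] that y by (auto simp: ode_solution_def variation_rhs_def)
  have lb: "norm (?D s (0, 0, e)) \<le> L * norm e" if "\<bar>s\<bar> < T" for s e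
    using variation_rhs_bound[OF sol g that y zW[OF that y]] .
  have zd: "((\<lambda>s. z (s, y)) has_vector_derivative g (s, y, z (s, y))) (at s)" "z (0, y) = 0"
    if "\<bar>s\<bar> < T" "y \<in> U" for s y using sol that unfolding ode_solution_def by auto
  have "continuous_on ?K (\<lambda>x. Blinfun (frechet_derivative g (at x)))"
    by (rule continuous_on_subset[OF C_1_on_continuous_blinfun[OF g] K(2)])
  from compact_imp_bounded[OF compact_continuous_image[OF this K(1)]]
  obtain B where B: "0 < B" "\<And>x. x \<in> ?K \<Longrightarrow> norm (Blinfun (frechet_derivative g (at x))) \<le> B"
    unfolding bounded_pos by auto
  have DB: "norm (?D s v) \<le> B * norm v" if "\<bar>s\<bar> \<le> T'" for s v
  proof -
    have "(s, y, z (s, y)) \<in> ?K" using that by (intro imageI) auto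
    then have 1: "norm (Blinfun (?D s)) \<le> B" using B by blast
    have "bounded_linear (?D s)" using lin[of s] that T' by (auto intro: linear_conv_bounded_linear[THEN iffD1])
    then have "?D s v = blinfun_apply (Blinfun (?D s)) v" by (simp add: bounded_linear_Blinfun_apply)
    then show ?thesis
      using norm_blinfun[of "Blinfun (?D s)" v] mult_right_mono[OF 1 norm_ge_zero[of v]] by simp
  qed
  \<comment> \<open>Lipschitz constant in the parameter: \<open>B\<close> bounds the derivative of
    \<open>g\<close> along the curve, 1 covers the linearization error since
    \<open>\<eta> \<le> 1\<close>, and \<open>2 * T'\<close> comes from
    \<open>ode_estimate\<close>.\<close>
  define C where "C = 2 * T' * (B + 1)"
  have C: "0 \<le> C" using B T'L by (auto simp: C_def)
  have main: "\<exists>d>0. \<forall>y'. dist y' y < d \<longrightarrow> norm (z (t, y') - z (t, y) - w (y' - y) (t, y)) \<le> \<epsilon> * norm (y' - y)"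
    if \<epsilon>: "0 < \<epsilon>" for \<epsilon>
  proof -
    \<comment> \<open>The first bound serves the Lipschitz estimate; the second makes the final
      error \<open>2 * T' * \<eta> * (1 + C)\<close> at most \<open>\<epsilon>\<close>.\<close>
    define \<eta> where "\<eta> = min 1 (\<epsilon> / (2 * T' * (1 + C)))"
    have \<eta>: "0 < \<eta>" "\<eta> \<le> 1" using \<epsilon> T'L C by (auto simp: \<eta>_def)
    have "\<eta> \<le> \<epsilon> / (2 * T' * (1 + C))" by (simp add: \<eta>_def)
    moreover have "0 < 2 * T' * (1 + C)" using T'L C by simp
    ultimately have \<eta>2: "2 * T' * (\<eta> * (1 + C)) \<le> \<epsilon>"
      by (simp add: pos_le_divide_eq mult_ac)
    obtain d where d: "0 < d" "\<And>x v. x \<in> ?K \<Longrightarrow> norm v < d \<Longrightarrow> x + v \<in> {-T<..<T} \<times> U \<times> W \<and>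
        norm (g (x + v) - g x - frechet_derivative g (at x) v) \<le> \<eta> * norm v"
      by (rule C_1_on_uniform_linearization[OF op g K \<eta>(1)]) (rule that)
    have "0 < d / 2" using d by simp
    obtain d' where d': "0 < d'" "\<And>s y'. \<bar>s\<bar> < T' \<Longrightarrow> dist y' y < d' \<Longrightarrow> y' \<in> U \<and> dist (z (s, y')) (z (s, y)) < d / 2"
      by (rule ode_solution_near[OF sol C_k_on_imp_continuous[OF g] y T'(2) \<open>0 < d / 2\<close>]) (rule that)
    show ?thesis
    proof (intro exI[of _ "min d' (d / 2)"] conjI allI impI)
      show "0 < min d' (d / 2)" using d d' by simp
      fix y' assume y': "dist y' y < min d' (d / 2)"
      define h where "h = y' - y"
      have h: "norm h < d / 2" using y' by (simp add: h_def dist_norm)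
      have yU: "y' \<in> U" using d'(2)[of 0 y'] y' T'L by auto
      define k where "k s = z (s, y') - z (s, y)" for s
      have k: "norm (k s) < d / 2" if "\<bar>s\<bar> < T'" for s
        using d'(2)[OF that, of y'] y' by (simp add: k_def dist_norm)
      have lin_est: "norm (g (s, y', z (s, y) + e) - g (s, y, z (s, y)) - ?D s (0, h, e)) \<le> \<eta> * norm (0::real, h, e)"
        if "\<bar>s\<bar> < T'" "norm e < d / 2" for s e
      proof -
        have "norm (0::real, h, e) \<le> norm h + norm e"
          using norm_Pair_le[of "0::real" "(h, e)"] norm_Pair_le[of h e] by simp
        then have "norm (0::real, h, e) < d" using h that by linarith
        moreover have "(s, y, z (s, y)) \<in> ?K" using that by (intro imageI) auto
        ultimately show ?thesis using d(2)[of "(s, y, z (s, y))" "(0, h, e)"] by (simp add: h_def)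
      qed
      have kd: "(k has_vector_derivative g (s, y', z (s, y')) - g (s, y, z (s, y))) (at s)" if "\<bar>s\<bar> < T'" for s
        unfolding k_def using that T' by (intro has_vector_derivative_diff zd yU y) auto
      have kC: "norm (k s) \<le> C * norm h" if s: "\<bar>s\<bar> < T'" for s
      proof -
        have "norm (k s) \<le> 2 * T' * ((B + 1) * norm h)"
        proof (rule ode_estimate[OF kd _ _ TL(1) T'L(1) s])
          show "k 0 = 0" using zd(2)[of 0] y yU T' by (auto simp: k_def)
          fix r assume r: "\<bar>r\<bar> < T'"
          have n: "norm (0::real, h, 0::'b) \<le> norm h"
            using norm_Pair_le[of "0::real" "(h, 0::'b)"] norm_Pair_le[of h "0::'b"] by simp
          have "norm (g (r, y', z (r, y)) - g (r, y, z (r, y))) \<le> norm (?D r (0, h, 0)) + \<eta> * norm (0::real, h, 0::'b)"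
            using lin_est[OF r, of 0] d(1)
              norm_triangle_ineq2[of "g (r, y', z (r, y)) - g (r, y, z (r, y))" "?D r (0, h, 0)"] by simp
          also have "\<dots> \<le> B * norm (0::real, h, 0::'b) + 1 * norm (0::real, h, 0::'b)"
            using DB[of r "(0, h, 0)"] r \<eta> by (intro add_mono mult_right_mono) auto
          also have "\<dots> \<le> (B + 1) * norm h"
            using mult_left_mono[OF n, of "B + 1"] B by (simp add: algebra_simps)
          finally have 1: "norm (g (r, y', z (r, y)) - g (r, y, z (r, y))) \<le> (B + 1) * norm h" .
          have "norm (g (r, y', z (r, y')) - g (r, y', z (r, y))) \<le> L * norm (k r)"
            using sol yU zW[of r] y r T' unfolding k_def ode_solution_def by auto
          with 1 show "norm (g (r, y', z (r, y')) - g (r, y, z (r, y))) \<le> L * norm (k r) + (B + 1) * norm h"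
            using norm_triangle_ineq[of "g (r, y', z (r, y')) - g (r, y', z (r, y))" "g (r, y', z (r, y)) - g (r, y, z (r, y))"]
            by simp
        qed
        then show ?thesis by (simp add: C_def)
      qed
      have "norm (k t - w h (t, y)) \<le> 2 * T' * (\<eta> * ((1 + C) * norm h))"
      proof (rule ode_estimate[OF _ _ _ TL(1) T'L(1) T'(1)])
        fix s assume s: "\<bar>s\<bar> < T'"
        show "((\<lambda>s. k s - w h (s, y)) has_vector_derivative
          (g (s, y', z (s, y')) - g (s, y, z (s, y)) - ?D s (0, h, w h (s, y)))) (at s)"
          using s T' by (intro has_vector_derivative_diff kd wd) auto
        have n: "norm (0::real, h, k s) \<le> (1 + C) * norm h"
          using norm_Pair_le[of "0::real" "(h, k s)"] norm_Pair_le[of h "k s"] kC[OF s] by (simp add: algebra_simps)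
        \<comment> \<open>The increment is linearized at \<open>(0, h, k s)\<close>. By linearity,
          replacing \<open>k s\<close> with \<open>w h (s, y)\<close> costs a term in their
          difference alone, which \<open>L\<close> controls.\<close>
        have "g (s, y', z (s, y')) - g (s, y, z (s, y)) - ?D s (0, h, w h (s, y)) =
          (g (s, y', z (s, y) + k s) - g (s, y, z (s, y)) - ?D s (0, h, k s)) + ?D s (0, 0, k s - w h (s, y))"
          using linear_diff[OF lin[of s], of "(0, h, k s)" "(0, h, w h (s, y))"] s T' by (simp add: k_def)
        also have "norm \<dots> \<le> \<eta> * norm (0::real, h, k s) + L * norm (k s - w h (s, y))"
          using s T' by (intro order_trans[OF norm_triangle_ineq] add_mono lin_est lb k) auto
        also have "\<dots> \<le> \<eta> * ((1 + C) * norm h) + L * norm (k s - w h (s, y))"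
          using mult_left_mono[OF n less_imp_le[OF \<eta>(1)]] by simp
        finally show "norm (g (s, y', z (s, y')) - g (s, y, z (s, y)) - ?D s (0, h, w h (s, y))) \<le>
          L * norm (k s - w h (s, y)) + \<eta> * ((1 + C) * norm h)" by simp
      next
        show "k 0 - w h (0, y) = 0"
          using zd(2)[of 0] y yU T' w[of h] by (auto simp: k_def ode_solution_def)
      qed
      also have "\<dots> \<le> \<epsilon> * norm h" using mult_right_mono[OF \<eta>2 norm_ge_zero[of h]] by (simp add: mult_ac)
      finally show "norm (z (t, y') - z (t, y) - w (y' - y) (t, y)) \<le> \<epsilon> * norm (y' - y)"
        by (simp add: k_def h_def)
    qed
  qed
  show ?thesis
    unfolding has_derivative_at_alt
    using variation_linear[OF t y] main by (auto simp: linear_conv_bounded_linear dist_norm)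
qed

text \<open>The differential equation gives the time derivative; the parameter derivative is jointly
  continuous because each \<open>w v\<close> is a solution and hence continuous. Together they give
  joint differentiability.\<close>

lemma variation_has_derivative:
  assumes t: "\<bar>t\<bar> < T" and y: "y \<in> U"
  shows "(z has_derivative (\<lambda>(\<tau>, v). \<tau> *\<^sub>R g (t, y, z (t, y)) + w v (t, y))) (at (t, y))"
proof -
  have "open U" using sol by (auto simp: ode_solution_def)
  then obtain r where r: "0 < r" "ball y r \<subseteq> U" using y openE by blast
  let ?fy = "\<lambda>t y. Blinfun (\<lambda>v. w v (t, y))"
  have fy: "blinfun_apply (?fy s x) = (\<lambda>v. w v (s, x))" if "\<bar>s\<bar> < T" "x \<in> U" for s x
    using variation_linear[OF that] by (simp add: bounded_linear_Blinfun_apply linear_conv_bounded_linear)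
  have zc: "continuous_on ({-T<..<T} \<times> U) z"
    using ode_solution_continuous[OF sol C_k_on_imp_continuous[OF g]] .
  have wc: "continuous_on ({-T<..<T} \<times> U) (w v)" for v
    using ode_solution_continuous[OF w] C_k_on_variation_rhs[OF sol g] zc by simp
  have "continuous_on ({-T<..<T} \<times> ball y r) (\<lambda>(t, y). ?fy t y)"
  proof (rule continuous_on_blinfun_componentwise)
    fix i :: 'a
    have "continuous_on ({-T<..<T} \<times> ball y r) (w i)"
      using continuous_on_subset[OF wc] r(2) by (metis Sigma_mono order_refl)
    then show "continuous_on ({-T<..<T} \<times> ball y r) (\<lambda>x. blinfun_apply (case x of (t, y) \<Rightarrow> ?fy t y) i)"
      by (rule continuous_on_eq) (use r(2) in \<open>auto simp: fy subset_iff\<close>)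
  qed
  then have c: "continuous (at (t, y) within {-T<..<T} \<times> ball y r) (\<lambda>(t, y). ?fy t y)"
    unfolding continuous_on_eq_continuous_within
    by (rule bspec) (use t r in \<open>simp add: abs_less_iff\<close>)
  have "((\<lambda>(t, y). z (t, y)) has_derivative (\<lambda>(tx, ty). tx *\<^sub>R g (t, y, z (t, y)) + blinfun_apply (?fy t y) ty))
     (at (t, y) within {-T<..<T} \<times> ball y r)"
  proof (rule has_derivative_partialsI)
    have "((\<lambda>s. z (s, y)) has_vector_derivative g (t, y, z (t, y))) (at t)"
      using sol t y unfolding ode_solution_def by blast
    then show "((\<lambda>s. z (s, y)) has_derivative (\<lambda>s. s *\<^sub>R g (t, y, z (t, y)))) (at t within {-T<..<T})"
      unfolding has_vector_derivative_def by (rule has_derivative_at_withinI)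
    show "((\<lambda>y. z (s, y)) has_derivative blinfun_apply (?fy s x)) (at x within ball y r)"
      if "s \<in> {-T<..<T}" "x \<in> ball y r" for s x
    proof -
      have sx: "\<bar>s\<bar> < T" "x \<in> U" using that r(2) by (simp add: abs_less_iff, blast)
      show ?thesis
        unfolding fy[OF sx] by (rule has_derivative_at_withinI[OF variation_has_derivative_parameter[OF sx]])
    qed
    show "y \<in> ball y r" using r by simp
  qed (use c in auto)
  then have "(z has_derivative (\<lambda>(\<tau>, v). \<tau> *\<^sub>R g (t, y, z (t, y)) + w v (t, y))) (at (t, y) within {-T<..<T} \<times> ball y r)"
    unfolding fy[OF t y] by (simp only: case_prod_eta)
  moreover have "at (t, y) within {-T<..<T} \<times> ball y r = at (t, y)"
    by (rule at_within_open) (use t r in auto)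
  ultimately show ?thesis by metis
qed

end

text \<open>The total derivative of \<open>z\<close> is made of \<open>g\<close> along
  \<open>z\<close> and of the solutions \<open>w v\<close>. Each \<open>w v\<close> is again an
  \<open>ode_solution\<close> with the same \<open>U\<close> and \<open>L\<close> and a right-hand
  side of class one order lower, so the induction hypothesis applies to it as well as to
  \<open>z\<close>; hence the generalization over \<open>T\<close>, \<open>W\<close>,
  \<open>g\<close> and \<open>z\<close>. The loss of time from \<open>T\<close> to \<open>T'\<close>
  is harmless since the class is a local property.\<close>

theorem ode_solution_C_k:
  assumes "ode_solution T U W L g z" "C_k_on k ({-T<..<T} \<times> U \<times> W) g"
  shows "C_k_on k ({-T<..<T} \<times> U) z"
  using assms
proof (induction k arbitrary: T W g z)
  case 0
  then show ?case using ode_solution_continuous by auto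
next
  case (Suc k)
  note sol = Suc.prems(1)
  have op: "open U" "open W" using sol by (auto simp: ode_solution_def)
  have zk: "C_k_on k ({-T<..<T} \<times> U) z" by (rule Suc.IH[OF sol C_k_on_Suc_imp[OF Suc.prems(2)]])
  have loc: "C_k_on (Suc k) ({-T'<..<T'} \<times> U) z" if T': "0 < T'" "T' < T" for T'
  proof -
    have g1: "C_k_on (Suc 0) ({-T<..<T} \<times> U \<times> W) g" by (rule C_k_on_le[OF Suc.prems(2)]) simp
    obtain w where w: "\<And>v. ode_solution T' U UNIV L (variation_rhs g z v) (w v)"
      by (rule variation_exists[OF sol g1 T']) (rule that)
    have sol': "ode_solution T' U W L g z" using ode_solution_mono[OF sol] T' by simp
    have sub: "{-T'<..<T'} \<times> V \<subseteq> {-T<..<T} \<times> V" for V :: "'c set" using T' by auto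
    have gs: "C_k_on (Suc k) ({-T'<..<T'} \<times> U \<times> W) g" by (rule C_k_on_subset[OF Suc.prems(2) sub])
    have g1s: "C_k_on (Suc 0) ({-T'<..<T'} \<times> U \<times> W) g" by (rule C_k_on_le[OF gs]) simp
    have zs: "C_k_on k ({-T'<..<T'} \<times> U) z" by (rule C_k_on_subset[OF zk sub])
    have wk: "C_k_on k ({-T'<..<T'} \<times> U) (w v)" for v
      by (rule Suc.IH[OF w C_k_on_variation_rhs[OF sol' gs zs]])
    show ?thesis
    proof (rule C_k_on_SucI[where f' = "\<lambda>x (\<tau>, v). \<tau> *\<^sub>R g (fst x, snd x, z x) + w v x"])
      show "open ({-T'<..<T'} \<times> U)" using op by simp
      show "(z has_derivative (\<lambda>(\<tau>, v). \<tau> *\<^sub>R g (fst x, snd x, z x) + w v x)) (at x)"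
        if "x \<in> {-T'<..<T'} \<times> U" for x
        using variation_has_derivative[OF sol' g1s w, of "fst x" "snd x"] that by auto
      have "C_k_on k ({-T'<..<T'} \<times> U) (\<lambda>x. g (fst x, snd x, z x))"
      proof (rule C_k_on_compose[where f = "\<lambda>x. (fst x, snd x, z x)" and g = g])
        show "C_k_on k ({-T'<..<T'} \<times> U) (\<lambda>x. (fst x, snd x, z x))"
          using op by (intro C_k_on_Pair C_k_on_bounded_linear zs bounded_linear_fst bounded_linear_snd) auto
        show "C_k_on k ({-T'<..<T'} \<times> U \<times> W) g" using C_k_on_Suc_imp[OF gs] .
      qed (use op sol' in \<open>auto simp: ode_solution_def\<close>)
      then show "C_k_on k ({-T'<..<T'} \<times> U) (\<lambda>x. case v of (\<tau>, v) \<Rightarrow> \<tau> *\<^sub>R g (fst x, snd x, z x) + w v x)" for v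
        using op by (cases v) (auto intro!: C_k_on_add C_k_on_scaleR wk)
    qed
  qed
  show ?case
  proof (rule C_k_on_local)
    fix x assume "x \<in> {-T<..<T} \<times> U"
    then have "\<bar>fst x\<bar> < T" "snd x \<in> U" by auto
    moreover from this obtain T' where "\<bar>fst x\<bar> < T'" "T' < T" using dense by blast
    ultimately show "\<exists>V. open V \<and> x \<in> V \<and> C_k_on (Suc k) V z"
      using loc[of T'] op by (intro exI[of _ "{-T'<..<T'} \<times> U"]) (auto simp: mem_Times_iff)
  qed
qed

text \<open>The radial projection onto a closed ball makes the vector field globally Lipschitz without
  changing it along short trajectories.\<close>

theorem smooth_local_flow:
  fixes Z :: "real \<times> 'a::euclidean_space \<Rightarrow> 'a"
  assumes "open S" "smooth_on S Z" "(0, y0) \<in> S"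
  obtains r T \<phi> where "0 < r" "0 < T" "smooth_on ({-T<..<T} \<times> ball y0 r) \<phi>"
    "\<And>y. y \<in> ball y0 r \<Longrightarrow> \<phi> (0, y) = y"
    "\<And>t y. \<bar>t\<bar> < T \<Longrightarrow> y \<in> ball y0 r \<Longrightarrow> (t, \<phi> (t, y)) \<in> S \<and>
       ((\<lambda>s. \<phi> (s, y)) has_vector_derivative Z (t, \<phi> (t, y))) (at t)"
proof -
  obtain a b where ab: "0 < a" "0 < b" "{-a..a} \<times> cball y0 b \<subseteq> S"
  proof -
    obtain A B where AB: "open A" "open B" "0 \<in> A" "y0 \<in> B" "A \<times> B \<subseteq> S"
      using assms(1,3) by (metis open_prod_elim mem_Times_iff fst_conv snd_conv)
    obtain a where "0 < a" "cball 0 a \<subseteq> A" using AB open_contains_cball by blast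
    moreover obtain b where "0 < b" "cball y0 b \<subseteq> B" using AB open_contains_cball by blast
    moreover have "cball 0 a = {-a..a}" by (auto simp: dist_real_def)
    ultimately show ?thesis using that[of a b] AB(5) by blast
  qed
  \<comment> \<open>A start within \<open>r\<close> of \<open>y0\<close> and a displacement of at
    most \<open>r\<close> stay within \<open>b\<close>, where the bounds on \<open>Z\<close>
    hold.\<close>
  define r where "r = b / 2"
  have r: "0 < r" using ab by (simp add: r_def)
  let ?C = "{-a..a} \<times> cball y0 b"
  have Ck: "compact ?C" by (intro compact_Times) auto
  have "continuous_on ?C Z" using smooth_on_imp_continuous[OF assms(2)] ab(3) continuous_on_subset by blast
  from compact_imp_bounded[OF compact_continuous_image[OF this Ck]]
  obtain M where M: "0 < M" "\<And>x. x \<in> ?C \<Longrightarrow> norm (Z x) \<le> M" unfolding bounded_pos by auto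
  have "continuous_on ?C (\<lambda>x. Blinfun (frechet_derivative Z (at x)))"
    using C_1_on_continuous_blinfun[OF smooth_on_C_k[OF assms(2)]] ab(3) continuous_on_subset by blast
  from compact_imp_bounded[OF compact_continuous_image[OF this Ck]]
  obtain L where L: "0 < L" "\<And>x. x \<in> ?C \<Longrightarrow> norm (Blinfun (frechet_derivative Z (at x))) \<le> L"
    unfolding bounded_pos by auto
  have lip: "norm (Z (t, y) - Z (t, y')) \<le> L * norm (y - y')"
    if t: "t \<in> {-a..a}" and y: "y \<in> cball y0 b" "y' \<in> cball y0 b" for t y y'
  proof -
    have cv: "convex ?C" by (intro convex_Times) auto
    have "norm (Z (t, y) - Z (t, y')) \<le> L * norm ((t, y) - (t, y'))"
    proof (rule differentiable_bound[OF cv])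
      show "(Z has_derivative frechet_derivative Z (at x)) (at x within ?C)" if "x \<in> ?C" for x
        using smooth_on_has_derivative[OF assms(2)] that ab(3) has_derivative_at_withinI by blast
      show "onorm (frechet_derivative Z (at x)) \<le> L" if "x \<in> ?C" for x
      proof -
        have "bounded_linear (frechet_derivative Z (at x))"
          using smooth_on_has_derivative[OF assms(2)] that ab(3) has_derivative_bounded_linear by blast
        then show ?thesis using L(2)[OF that] by (simp add: norm_blinfun.rep_eq bounded_linear_Blinfun_apply)
      qed
    qed (use t y in auto)
    then show ?thesis by (simp add: norm_Pair)
  qed
  \<comment> \<open>The three bounds keep the time in the domain, the displacement
    \<open>M * T\<close> strictly below \<open>r\<close>, and \<open>2 * L * T\<close> at most
    1.\<close>
  define T where "T = Min {a, r / (M + 1), 1 / (2 * L)}"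
  have T: "0 < T" "T \<le> a" "T \<le> r / (M + 1)" "T \<le> 1 / (2 * L)"
    using ab r M L by (auto simp: T_def)
  have TM: "M * T < r"
  proof -
    have "M * T < (M + 1) * T" using T(1) by simp
    also have "\<dots> \<le> r" using T(3) M by (simp add: field_simps)
    finally show ?thesis .
  qed
  have TL: "2 * L * T \<le> 1" using T(4) L by (simp add: field_simps)
  \<comment> \<open>The unknown is the displacement from the starting point, which has initial value
    0 for every parameter, as \<open>ode_solution\<close> requires.\<close>
  define g where "g = (\<lambda>(t, y, \<zeta>). Z (t, y + \<zeta>))"
  let ?U = "ball y0 r" and ?W = "ball 0 r :: 'a set"
  have inC: "y + \<zeta> \<in> cball y0 b" if "y \<in> ?U" "\<zeta> \<in> cball 0 r" for y \<zeta>
  proof -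
    have "dist y0 (y + \<zeta>) \<le> dist y0 y + norm \<zeta>"
      using norm_triangle_ineq4[of "y0 - y" \<zeta>] by (simp add: dist_norm algebra_simps)
    then show ?thesis using that by (simp add: r_def)
  qed
  have "\<exists>\<zeta>. \<zeta> 0 = 0 \<and> (\<forall>t. \<bar>t\<bar> < T \<longrightarrow> \<zeta> t \<in> ?W \<and> (\<zeta> has_vector_derivative g (t, y, \<zeta> t)) (at t))"
    if y: "y \<in> ?U" for y
  proof -
    let ?p = "closest_point (cball 0 r) :: 'a \<Rightarrow> 'a"
    have cl: "closed (cball (0::'a) r)" "cball (0::'a) r \<noteq> {}" using r by auto
    have p: "?p \<zeta> \<in> cball 0 r" for \<zeta> using closest_point_in_set[OF cl] .
    have pl: "norm (?p \<zeta> - ?p \<zeta>') \<le> norm (\<zeta> - \<zeta>')" for \<zeta> \<zeta>'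
      using closest_point_lipschitz[OF convex_cball cl] by (simp add: dist_norm)
    have "\<exists>\<zeta>. \<zeta> 0 = 0 \<and> (\<forall>t. \<bar>t\<bar> < T \<longrightarrow> (\<zeta> has_vector_derivative Z (t, y + ?p (\<zeta> t))) (at t))"
    proof (rule ode_exists[where L = L and g = "\<lambda>t \<zeta>. Z (t, y + ?p \<zeta>)"])
      have pc: "continuous_on UNIV ?p" by (rule continuous_on_closest_point[OF convex_cball cl])
      have "continuous_on ({-T..T} \<times> UNIV) (\<lambda>x. (fst x, y + ?p (snd x)))"
        by (intro continuous_intros continuous_on_compose2[OF pc]) auto
      moreover have "(\<lambda>x. (fst x, y + ?p (snd x))) ` ({-T..T} \<times> UNIV) \<subseteq> S"
      proof -
        have "(fst x, y + ?p (snd x)) \<in> ?C" if "x \<in> {-T..T} \<times> UNIV" for x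
          using inC[OF y p[of "snd x"]] that T(2) by (simp add: mem_Times_iff)
        then show ?thesis using ab(3) by blast
      qed
      ultimately show "continuous_on ({-T..T} \<times> UNIV) (\<lambda>(t, \<zeta>). Z (t, y + ?p \<zeta>))"
        unfolding split_beta by (rule continuous_on_compose2[OF smooth_on_imp_continuous[OF assms(2)]])
      show "norm (Z (t, y + ?p \<zeta>) - Z (t, y + ?p \<zeta>')) \<le> L * norm (\<zeta> - \<zeta>')" if "\<bar>t\<bar> \<le> T" for t \<zeta> \<zeta>'
      proof -
        have "t \<in> {-a..a}" using that T(2) by auto
        from lip[OF this inC[OF y p] inC[OF y p], of \<zeta> \<zeta>']
        have "norm (Z (t, y + ?p \<zeta>) - Z (t, y + ?p \<zeta>')) \<le> L * norm (?p \<zeta> - ?p \<zeta>')" by simp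
        also have "\<dots> \<le> L * norm (\<zeta> - \<zeta>')" using pl L by (intro mult_left_mono) auto
        finally show ?thesis .
      qed
    qed (use T TL L in auto)
    then obtain \<zeta> where \<zeta>: "\<zeta> 0 = 0" "\<And>t. \<bar>t\<bar> < T \<Longrightarrow> (\<zeta> has_vector_derivative Z (t, y + ?p (\<zeta> t))) (at t)" by blast
    have \<zeta>r: "norm (\<zeta> t) < r" if t: "\<bar>t\<bar> < T" for t
    proof -
      have "norm (\<zeta> t - \<zeta> 0) \<le> M * \<bar>t - 0\<bar>"
      proof (rule vector_derivative_mean_bound[where S = "{-T<..<T}" and e' = "\<lambda>t. Z (t, y + ?p (\<zeta> t))"])
        show "(\<zeta> has_vector_derivative Z (s, y + ?p (\<zeta> s))) (at s within {-T<..<T})" if "s \<in> {-T<..<T}" for s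
          using \<zeta>(2)[of s] that by (auto intro: has_vector_derivative_at_within)
        show "norm (Z (s, y + ?p (\<zeta> s))) \<le> M" if "s \<in> {-T<..<T}" for s
          using M(2)[of "(s, y + ?p (\<zeta> s))"] inC[OF y p[of "\<zeta> s"]] that T(2) by (simp add: mem_Times_iff)
      qed (use t in auto)
      also have "\<dots> \<le> M * T" using t M by simp
      finally show ?thesis using TM \<zeta>(1) by simp
    qed
    have "?p (\<zeta> t) = \<zeta> t" if "\<bar>t\<bar> < T" for t
      using \<zeta>r[OF that] by (intro closest_point_self) simp
    then show ?thesis using \<zeta> \<zeta>r by (intro exI[of _ \<zeta>]) (auto simp: g_def)
  qed
  then have "\<forall>y\<in>?U. \<exists>\<zeta>. \<zeta> 0 = 0 \<and> (\<forall>t. \<bar>t\<bar> < T \<longrightarrow> \<zeta> t \<in> ?W \<and> (\<zeta> has_vector_derivative g (t, y, \<zeta> t)) (at t))"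
    by (rule ballI)
  from bchoice[OF this] obtain \<zeta> where
    "\<forall>y\<in>?U. \<zeta> y 0 = 0 \<and> (\<forall>t. \<bar>t\<bar> < T \<longrightarrow> \<zeta> y t \<in> ?W \<and> (\<zeta> y has_vector_derivative g (t, y, \<zeta> y t)) (at t))"
    by (rule exE)
  note \<zeta> = bspec[OF this]
  define z where "z = (\<lambda>(t, y). \<zeta> y t)"
  have inC': "(t, y + w) \<in> ?C" if "\<bar>t\<bar> < T" "y \<in> ?U" "w \<in> ?W" for t y w
  proof -
    have "-a \<le> t \<and> t \<le> a" using that(1) T(2) by linarith
    then have "t \<in> {-a..a}" by simp
    moreover have "w \<in> cball 0 r" using that(3) by simp
    ultimately show ?thesis using inC[OF that(2)] by blast
  qed
  have sol: "ode_solution T ?U ?W L g z"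
    unfolding ode_solution_def
  proof (intro conjI allI impI ballI)
    fix t y v w assume tyvw: "\<bar>t\<bar> < T" "y \<in> ?U" "v \<in> ?W" "w \<in> ?W"
    show "norm (g (t, y, v) - g (t, y, w)) \<le> L * norm (v - w)"
      using lip[of t "y + v" "y + w"] inC'[OF tyvw(1,2,3)] inC'[OF tyvw(1,2,4)] by (simp add: g_def)
  qed (use \<zeta> L TL in \<open>auto simp: z_def\<close>)
  have opT: "open ({-T<..<T} \<times> ?U \<times> ?W)" by (simp add: open_Times)
  have "C_k_on k ({-T<..<T} \<times> ?U \<times> ?W) g" for k
  proof -
    have "C_k_on k ({-T<..<T} \<times> ?U \<times> ?W) (\<lambda>x. Z (fst x, fst (snd x) + snd (snd x)))"
    proof (rule C_k_on_compose[where f = "\<lambda>x. (fst x, fst (snd x) + snd (snd x))" and g = Z])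
      show "C_k_on k ({-T<..<T} \<times> ?U \<times> ?W) (\<lambda>x. (fst x, fst (snd x) + snd (snd x)))"
        by (intro C_k_on_Pair C_k_on_add opT C_k_on_bounded_linear bounded_linear_intros)
      show "(\<lambda>x. (fst x, fst (snd x) + snd (snd x))) ` ({-T<..<T} \<times> ?U \<times> ?W) \<subseteq> S"
      proof (rule image_subsetI)
        fix x assume "x \<in> {-T<..<T} \<times> ?U \<times> ?W"
        then have "(fst x, fst (snd x) + snd (snd x)) \<in> ?C"
          by (intro inC') (auto simp: mem_Times_iff)
        then show "(fst x, fst (snd x) + snd (snd x)) \<in> S" using ab(3) by blast
      qed
    qed (use opT smooth_on_C_k[OF assms(2)] in auto)
    then show ?thesis by (simp add: g_def case_prod_unfold)
  qed
  from ode_solution_C_k[OF sol this] have zs: "smooth_on ({-T<..<T} \<times> ?U) z"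
    by (simp add: smooth_on_def)
  show ?thesis
  proof (rule that[OF r T(1), of "\<lambda>x. snd x + z x"])
    show "smooth_on ({-T<..<T} \<times> ?U) (\<lambda>x. snd x + z x)"
      by (intro smooth_on_add zs smooth_on_snd) auto
    show "snd (0, y) + z (0, y) = y" if "y \<in> ?U" for y
      using \<zeta>[OF that] by (simp add: z_def)
    fix t y assume t: "\<bar>t\<bar> < T" and y: "y \<in> ?U"
    have "\<zeta> y t \<in> ?W" using \<zeta>[OF y] t by blast
    from inC'[OF t y this] have "(t, y + z (t, y)) \<in> S" using ab(3) by (auto simp: z_def)
    moreover have "((\<lambda>s. y + \<zeta> y s) has_vector_derivative Z (t, y + \<zeta> y t)) (at t)"
    proof -
      have "(\<zeta> y has_vector_derivative Z (t, y + \<zeta> y t)) (at t)"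
        using \<zeta>[OF y] t by (simp add: g_def)
      from has_vector_derivative_add[OF has_vector_derivative_const this] show ?thesis by simp
    qed
    ultimately show "(t, snd (t, y) + z (t, y)) \<in> S \<and>
       ((\<lambda>s. snd (s, y) + z (s, y)) has_vector_derivative Z (t, snd (t, y) + z (t, y))) (at t)"
      by (simp add: z_def)
  qed
qed

section \<open>Linear algebra of first fundamental forms\<close>

lemma matrix_inv_right_unique:
  fixes A :: "real^'n^'n"
  assumes "A ** B = mat 1"
  shows "matrix_inv A = B"
proof -
  have "B ** A = mat 1" using assms matrix_left_right_inverse by blast
  then have "A ** matrix_inv A = mat 1 \<and> matrix_inv A ** A = mat 1"
    unfolding matrix_inv_def using assms by (intro someI[of "\<lambda>A'. A ** A' = mat 1 \<and> A' ** A = mat 1"]) simp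
  then show ?thesis
    using \<open>B ** A = mat 1\<close> by (metis matrix_mul_assoc matrix_mul_lid matrix_mul_rid)
qed

lemma matrix_inv_inverse:
  fixes A :: "real^'n^'n"
  assumes "det A \<noteq> 0"
  shows "A ** matrix_inv A = mat 1" "matrix_inv A ** A = mat 1"
proof -
  obtain B where "A ** B = mat 1" using assms invertible_det_nz invertible_right_inverse by blast
  then show "A ** matrix_inv A = mat 1" "matrix_inv A ** A = mat 1"
    using matrix_inv_right_unique matrix_left_right_inverse by blast+
qed

lemma matrix_inv_symmetric:
  fixes A :: "real^'n^'n"
  assumes "det A \<noteq> 0" "transpose A = A"
  shows "matrix_inv A $ i $ j = matrix_inv A $ j $ i"
proof -
  have "transpose (matrix_inv A ** A) = mat 1" using matrix_inv_inverse[OF assms(1)] by (simp add: transpose_mat)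
  then have "A ** transpose (matrix_inv A) = mat 1" by (simp add: matrix_transpose_mul assms(2))
  from matrix_inv_right_unique[OF this] have "matrix_inv A = transpose (matrix_inv A)" .
  from arg_cong[OF this, of "\<lambda>M. M $ i $ j"] show ?thesis by (simp add: transpose_def)
qed

text \<open>A permutation other than the identity moves at least two indices. After one factor is
  differentiated, an off-diagonal entry of the identity matrix remains and kills the term, so only
  the trace survives.\<close>

lemma det_one_plus_has_derivative:
  fixes M :: "real \<Rightarrow> real^'n^'n"
  assumes der: "\<And>i j. ((\<lambda>t. M t $ i $ j) has_real_derivative B $ i $ j) (at z)" and "M z = mat 1"
  shows "((\<lambda>t. det (M t)) has_real_derivative trace B) (at z)"
proof -
  let ?S = "\<lambda>p. \<Sum>i\<in>UNIV. B $ i $ p i * (\<Prod>j\<in>UNIV - {i}. M z $ j $ p j)"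
  have "((\<lambda>t. det (M t)) has_real_derivative
     (\<Sum>p\<in>{p. p permutes UNIV}. of_int (sign p) * ?S p)) (at z)"
    unfolding det_def by (intro DERIV_sum DERIV_cmult has_field_derivative_prod der)
  also have "(\<Sum>p\<in>{p. p permutes UNIV}. of_int (sign p) * ?S p) = (\<Sum>p\<in>{p :: 'n \<Rightarrow> 'n. p permutes UNIV}. if p = id then trace B else 0)"
  proof (intro sum.cong refl)
    fix p :: "'n \<Rightarrow> 'n" assume "p \<in> {p. p permutes UNIV}"
    then have p: "p permutes UNIV" by simp
    show "of_int (sign p) * ?S p = (if p = id then trace B else 0)"
    proof (cases "p = id")
      case True
      then show ?thesis by (simp add: assms(2) mat_def trace_def)
    next
      case False
      have "(\<Prod>j\<in>UNIV - {i}. M z $ j $ p j) = 0" for i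
      proof -
        obtain k where k: "p k \<noteq> k" using False by fastforce
        then have "p (p k) \<noteq> p k" using permutes_inj[OF p] by (metis injD)
        with k obtain j where "j \<noteq> i" "p j \<noteq> j" by metis
        then show ?thesis by (intro prod_zero bexI[of _ j]) (auto simp: assms(2) mat_def)
      qed
      then show ?thesis using False by (simp del: prod_zero_iff)
    qed
  qed
  also have "\<dots> = trace B"
    by (simp add: sum.delta finite_permutations permutes_id)
  finally show ?thesis .
qed

text \<open>Factoring out the invertible \<open>A z\<close> reduces the claim to a curve through the
  identity matrix.\<close>

lemma Jacobi_formula:
  fixes A :: "real \<Rightarrow> real^'n^'n"
  assumes der: "\<And>i j. ((\<lambda>t. A t $ i $ j) has_real_derivative B $ i $ j) (at z)" and "det (A z) \<noteq> 0"
  shows "((\<lambda>t. det (A t)) has_real_derivative det (A z) * trace (matrix_inv (A z) ** B)) (at z)"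
proof -
  let ?I = "matrix_inv (A z)"
  have "((\<lambda>t. det (?I ** A t)) has_real_derivative trace (?I ** B)) (at z)"
  proof (rule det_one_plus_has_derivative)
    show "((\<lambda>t. (?I ** A t) $ i $ j) has_real_derivative (?I ** B) $ i $ j) (at z)" for i j
      by (simp add: matrix_matrix_mult_def) (intro DERIV_sum DERIV_cmult der)
    show "?I ** A z = mat 1" using matrix_inv_inverse[OF assms(2)] by simp
  qed
  from DERIV_cmult[OF this, of "det (A z)"]
  have "((\<lambda>t. det (A z) * det (?I ** A t)) has_real_derivative det (A z) * trace (?I ** B)) (at z)" .
  moreover have "det (A z) * det (?I ** A t) = det (A t)" for t
    using matrix_inv_inverse(1)[OF assms(2)] by (metis det_mul matrix_mul_assoc matrix_mul_lid)
  ultimately show ?thesis by simp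
qed

text \<open>All matrices on the segment from the identity to \<open>A\<close> are positive definite,
  so the determinant has no zero on it; by the intermediate value theorem it keeps the sign it has
  at the identity.\<close>

lemma det_pos_definite:
  fixes A :: "real^'n^'n"
  assumes "\<And>v. v \<noteq> 0 \<Longrightarrow> 0 < v \<bullet> (A *v v)"
  shows "0 < det A"
proof -
  define M where "M s = (1 - s) *\<^sub>R mat 1 + s *\<^sub>R A" for s :: real
  have M: "0 < v \<bullet> (M s *v v)" if "v \<noteq> 0" "0 \<le> s" "s \<le> 1" for v s
  proof -
    have "v \<bullet> (M s *v v) = (1 - s) * (v \<bullet> v) + s * (v \<bullet> (A *v v))"
      by (simp add: M_def matrix_vector_mult_add_rdistrib inner_add_right scaleR_matrix_vector_assoc[symmetric])
    moreover have "0 < v \<bullet> v" using that by simp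
    ultimately show ?thesis using assms[OF that(1)] that(2,3)
      by (cases "s = 1") (auto intro!: add_pos_nonneg)
  qed
  have nz: "det (M s) \<noteq> 0" if "0 \<le> s" "s \<le> 1" for s
  proof -
    have "inj ((*v) (M s))"
    proof (rule linear_injective_0[THEN iffD2, rule_format])
      show "linear ((*v) (M s))" by simp
      show "v = 0" if "M s *v v = 0" for v
        using M[of v s] that \<open>0 \<le> s\<close> \<open>s \<le> 1\<close> by force
    qed
    then have "det (matrix ((*v) (M s))) \<noteq> 0" by (subst det_nz_iff_inj) auto
    then show ?thesis by simp
  qed
  have "continuous_on {0..1} (\<lambda>s. det (M s))"
    unfolding det_def M_def by (intro continuous_intros)
  show ?thesis
  proof (rule ccontr)
    assume "\<not> 0 < det A"
    then have "det (M 1) \<le> 0" "0 \<le> det (M 0)" by (auto simp: M_def)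
    from IVT2'[OF this(1) this(2) _ \<open>continuous_on {0..1} (\<lambda>s. det (M s))\<close>] obtain s where
      "0 \<le> s" "s \<le> 1" "det (M s) = 0" by auto
    with nz show False by blast
  qed
qed

text \<open>Adding a small positive multiple of the identity gives the definite case; the
  determinant is continuous.\<close>

lemma det_pos_semidefinite:
  fixes A :: "real^'n^'n"
  assumes "\<And>v. 0 \<le> v \<bullet> (A *v v)"
  shows "0 \<le> det A"
proof -
  have "0 < det (A + s *\<^sub>R mat 1)" if "0 < s" for s
  proof (rule det_pos_definite)
    fix v :: "real^'n" assume "v \<noteq> 0"
    then have "0 < s * (v \<bullet> v)" using that by simp
    moreover have "v \<bullet> ((A + s *\<^sub>R mat 1) *v v) = v \<bullet> (A *v v) + s * (v \<bullet> v)"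
      by (simp add: matrix_vector_mult_add_rdistrib inner_add_right scaleR_matrix_vector_assoc[symmetric])
    ultimately show "0 < v \<bullet> ((A + s *\<^sub>R mat 1) *v v)" using assms[of v] by linarith
  qed
  then have "\<forall>\<^sub>F s in at_right 0. 0 \<le> det (A + s *\<^sub>R mat 1)"
    by (auto simp: eventually_at_right_field intro!: exI[of _ 1] less_imp_le)
  moreover have "((\<lambda>s. det (A + s *\<^sub>R mat 1)) \<longlongrightarrow> det (A + 0 *\<^sub>R mat 1)) (at_right 0)"
    unfolding det_def by (intro tendsto_intros)
  ultimately show ?thesis using tendsto_lowerbound[of _ _ "at_right (0::real)" 0] by fastforce
qed

lemma linear_system_solution:
  fixes A :: "real^'n^'n"
  assumes "det A \<noteq> 0"
  shows "A *v (\<chi> k. det (\<chi> i j. if j = k then b $ i else A $ i $ j) / det A) = b"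
  using cramer[OF assms] by blast

text \<open>Writes the entries of the inverse as quotients of determinants, from which their
  continuity can be read off.\<close>

lemma matrix_inv_cramer:
  fixes A :: "real^'n^'n"
  assumes "det A \<noteq> 0"
  shows "matrix_inv A $ i $ j = det (\<chi> k l. if l = i then axis j 1 $ k else A $ k $ l) / det A"
proof -
  let ?x = "\<chi> k. det (\<chi> i l. if l = k then axis j 1 $ i else A $ i $ l) / det A"
  have "matrix_inv A *v (A *v ?x) = matrix_inv A *v axis j 1"
    by (simp only: linear_system_solution[OF assms])
  then have "?x = matrix_inv A *v axis j 1"
    by (simp only: matrix_vector_mul_assoc matrix_inv_inverse[OF assms] matrix_vector_mul_lid)
  from arg_cong[OF this, of "\<lambda>x. x $ i"] show ?thesis
    by (simp add: matrix_vector_mult_basis column_def)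
qed

section \<open>Gram matrices and their behaviour under coordinate changes\<close>

lemma frechet_derivative_partial:
  fixes g :: "real^'n \<Rightarrow> 'b::real_normed_vector"
  assumes "g differentiable (at y)"
  shows "frechet_derivative g (at y) v = (\<Sum>i\<in>UNIV. v $ i *\<^sub>R partial g i y)"
proof -
  note l = linear_frechet_derivative[OF assms]
  have "frechet_derivative g (at y) v = frechet_derivative g (at y) (\<Sum>i\<in>UNIV. v $ i *\<^sub>R axis i 1)"
    using basis_expansion[of v] by (simp add: scalar_mult_eq_scaleR)
  also have "\<dots> = (\<Sum>i\<in>UNIV. v $ i *\<^sub>R partial g i y)"
    by (simp add: linear_sum[OF l] linear_cmul[OF l] partial_def)
  finally show ?thesis .
qed

lemma gram_transpose: "transpose (gram g y) = gram g y"
  by (simp add: gram_def transpose_def vec_eq_iff inner_commute)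

lemma gram_mult_vec:
  fixes g :: "real^'n \<Rightarrow> 'b::real_inner"
  assumes "g differentiable (at y)"
  shows "(gram g y *v v) $ i = partial g i y \<bullet> frechet_derivative g (at y) v"
  by (simp add: matrix_vector_mult_def gram_def frechet_derivative_partial[OF assms] inner_sum_right mult.commute)

lemma gram_quadratic:
  fixes g :: "real^'n \<Rightarrow> 'b::real_inner"
  assumes "g differentiable (at y)"
  shows "v \<bullet> (gram g y *v v) = (norm (frechet_derivative g (at y) v))\<^sup>2"
proof -
  have "v \<bullet> (gram g y *v v) = (\<Sum>i\<in>UNIV. v $ i *\<^sub>R partial g i y) \<bullet> frechet_derivative g (at y) v"
    by (simp add: inner_vec_def gram_mult_vec[OF assms] inner_sum_left)
  then show ?thesis
    using frechet_derivative_partial[OF assms, of v] by (simp add: power2_norm_eq_inner)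
qed

lemma det_gram_pos:
  fixes g :: "real^'n \<Rightarrow> 'b::real_inner"
  assumes "g differentiable (at y)" "inj (frechet_derivative g (at y))"
  shows "0 < det (gram g y)"
proof (rule det_pos_definite)
  fix v :: "real^'n" assume "v \<noteq> 0"
  then have "frechet_derivative g (at y) v \<noteq> 0"
    using linear_injective_0[OF linear_frechet_derivative[OF assms(1)]] assms(2) by blast
  then show "0 < v \<bullet> (gram g y *v v)" by (simp add: gram_quadratic[OF assms(1)])
qed

lemma det_gram_nonneg:
  fixes g :: "real^'n \<Rightarrow> 'b::real_inner"
  assumes "g differentiable (at y)"
  shows "0 \<le> det (gram g y)"
  by (rule det_pos_semidefinite) (simp add: gram_quadratic[OF assms])

lemma partial_compose:
  fixes \<tau> :: "real^'n \<Rightarrow> real^'k"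
  assumes "g differentiable (at (\<tau> y))" "\<tau> differentiable (at y)"
    and "open S" "y \<in> S" "\<And>x. x \<in> S \<Longrightarrow> h x = g (\<tau> x)"
  shows "partial h i y = (\<Sum>k\<in>UNIV. matrix (frechet_derivative \<tau> (at y)) $ k $ i *\<^sub>R partial g k (\<tau> y))"
    and "h differentiable (at y)"
    and "frechet_derivative h (at y) v = frechet_derivative g (at (\<tau> y)) (frechet_derivative \<tau> (at y) v)"
proof -
  have "((\<lambda>x. g (\<tau> x)) has_derivative (\<lambda>v. frechet_derivative g (at (\<tau> y)) (frechet_derivative \<tau> (at y) v))) (at y)"
    by (rule has_derivative_compose) (use assms(1,2) in \<open>simp_all add: frechet_derivative_works[symmetric]\<close>)
  then have d: "(h has_derivative (\<lambda>v. frechet_derivative g (at (\<tau> y)) (frechet_derivative \<tau> (at y) v))) (at y)"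
    by (rule has_derivative_transform_within_open[OF _ assms(3,4)]) (simp add: assms(5))
  then show "h differentiable (at y)" by (auto simp: differentiable_def)
  show D: "frechet_derivative h (at y) v = frechet_derivative g (at (\<tau> y)) (frechet_derivative \<tau> (at y) v)" for v
    using frechet_derivative_at[OF d] by metis
  show "partial h i y = (\<Sum>k\<in>UNIV. matrix (frechet_derivative \<tau> (at y)) $ k $ i *\<^sub>R partial g k (\<tau> y))"
    unfolding partial_def[of h] D frechet_derivative_partial[OF assms(1)] by (simp add: matrix_def)
qed

lemma bilinear_sum_matrix:
  fixes a b :: "'n::finite \<Rightarrow> 'b::real_inner"
  shows "(\<Sum>k\<in>UNIV. J $ k $ i *\<^sub>R a k) \<bullet> (\<Sum>l\<in>UNIV. J $ l $ j *\<^sub>R b l) =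
    (transpose J ** (\<chi> k l. a k \<bullet> b l) ** J) $ i $ j"
  by (simp add: matrix_matrix_mult_def transpose_def inner_sum_left inner_sum_right sum_distrib_left
      sum_distrib_right mult_ac)

lemma gram_compose:
  fixes \<tau> :: "real^'n \<Rightarrow> real^'n"
  assumes "g differentiable (at (\<tau> y))" "\<tau> differentiable (at y)"
    and "open S" "y \<in> S" "\<And>x. x \<in> S \<Longrightarrow> h x = g (\<tau> x)"
  defines "J \<equiv> matrix (frechet_derivative \<tau> (at y))"
  shows "gram h y = transpose J ** gram g (\<tau> y) ** J"
  by (simp add: vec_eq_iff gram_def partial_compose(1)[OF assms(1-5)] bilinear_sum_matrix J_def)

lemma sum_matrix_inv_trace:
  fixes A :: "real^'n^'n"
  shows "(\<Sum>i\<in>UNIV. \<Sum>j\<in>UNIV. A $ i $ j * B $ i $ j) = trace (A ** transpose B)"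
  by (simp add: trace_def matrix_matrix_mult_def transpose_def)

text \<open>The factors of \<open>J\<close> cancel inside the trace by cyclicity. This is the
  coordinate independence of contracting a bilinear form with the inverse metric, hence of the
  surface divergence.\<close>

lemma trace_congruence:
  fixes A J :: "real^'n^'n"
  assumes "det A \<noteq> 0" "det J \<noteq> 0"
  shows "trace (matrix_inv (transpose J ** A ** J) ** transpose (transpose J ** B ** J)) =
    trace (matrix_inv A ** transpose B)"
proof -
  let ?K = "matrix_inv J"
  note J = matrix_inv_inverse[OF assms(2)] and A = matrix_inv_inverse[OF assms(1)]
  have Jt: "transpose J ** transpose ?K = mat 1" "transpose ?K ** transpose J = mat 1"
    using J by (simp_all add: matrix_transpose_mul[symmetric] transpose_mat)
  have "(transpose J ** A ** J) ** (?K ** matrix_inv A ** transpose ?K) =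
    transpose J ** (A ** ((J ** ?K) ** matrix_inv A)) ** transpose ?K"
    by (simp add: matrix_mul_assoc)
  also have "\<dots> = mat 1" by (simp add: J A Jt)
  finally have "matrix_inv (transpose J ** A ** J) = ?K ** matrix_inv A ** transpose ?K"
    by (rule matrix_inv_right_unique)
  then have "trace (matrix_inv (transpose J ** A ** J) ** transpose (transpose J ** B ** J)) =
    trace ((?K ** matrix_inv A ** transpose ?K) ** (transpose J ** (transpose B ** J)))"
    by (simp add: matrix_transpose_mul matrix_mul_assoc)
  also have "(?K ** matrix_inv A ** transpose ?K) ** (transpose J ** (transpose B ** J)) =
    ?K ** (matrix_inv A ** ((transpose ?K ** transpose J) ** transpose B) ** J)"
    by (simp add: matrix_mul_assoc)
  also have "\<dots> = ?K ** ((matrix_inv A ** transpose B) ** J)" by (simp add: Jt)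
  also have "trace \<dots> = trace ((matrix_inv A ** transpose B) ** J ** ?K)"
    by (rule trace_mul_sym)
  also have "(matrix_inv A ** transpose B) ** J ** ?K = matrix_inv A ** transpose B"
    by (simp add: matrix_mul_assoc[symmetric] J)
  finally show ?thesis .
qed

text \<open>The orthogonal complement of the image of \<open>D\<close> has dimension one and
  contains the nonzero vector \<open>N\<close>, so \<open>N\<close> spans it.\<close>

lemma normal_space_one_dimensional:
  fixes D :: "real^'n \<Rightarrow> real^'m"
  assumes "linear D" "inj D" "CARD('m) = CARD('n) + 1" "norm N = 1"
    and N: "\<And>v. N \<bullet> D v = 0" and w: "\<And>v. w \<bullet> D v = 0"
  shows "w = (w \<bullet> N) *\<^sub>R N"
proof -
  let ?C = "{y \<in> UNIV. \<forall>x\<in>range D. orthogonal x y}"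
  have "dim (range D) = CARD('n)"
    using dim_image_eq[OF assms(1), of UNIV] assms(2) by simp
  moreover have "dim ?C + dim (range D) = dim (UNIV :: (real^'m) set)"
    by (rule dim_subspace_orthogonal_to_vectors) (auto intro: linear_subspace_image[OF assms(1)])
  ultimately have dC: "dim ?C = 1" using assms(3) by simp
  have NC: "N \<in> ?C" "w \<in> ?C" using N w by (auto simp: orthogonal_def inner_commute)
  have "N \<noteq> 0" using assms(4) by auto
  have "dim {N} = dim ?C" using dC dim_singleton \<open>N \<noteq> 0\<close> by (simp add: dim_eq_0)
  then have eq: "span {N} = span ?C"
    using NC by (intro dim_eq_span) auto
  have "w \<in> span {N}" unfolding eq by (rule span_base[OF NC(2)])
  then obtain c where "w = c *\<^sub>R N" by (auto simp: span_singleton)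
  moreover have "N \<bullet> N = 1" using assms(4) by (simp add: norm_eq_1)
  ultimately show ?thesis by simp
qed

section \<open>Coordinate changes\<close>

lemma chart_facts:
  assumes "smooth_atlas \<A>" "(V, \<psi>) \<in> \<A>"
  shows "open V" "open (\<psi> ` V)" "inj_on \<psi> V" "continuous_on V \<psi>" "continuous_on (\<psi> ` V) (inv_into V \<psi>)"
proof -
  have "open V \<and> open (\<psi> ` V) \<and> homeomorphism V (\<psi> ` V) \<psi> (inv_into V \<psi>)"
    using assms unfolding smooth_atlas_def by blast
  then show "open V" "open (\<psi> ` V)" "inj_on \<psi> V" "continuous_on V \<psi>" "continuous_on (\<psi> ` V) (inv_into V \<psi>)"
    unfolding homeomorphism_def by (auto intro: inj_on_inverseI)
qed

lemma chart_cover: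
  assumes "smooth_atlas \<A>"
  obtains V \<psi> y where "(V, \<psi>) \<in> \<A>" "y \<in> V" "\<psi> y = p"
proof -
  have "p \<in> (\<Union>(V, \<psi>)\<in>\<A>. \<psi> ` V)" using assms unfolding smooth_atlas_def by (metis UNIV_I)
  then obtain V \<psi> where "(V, \<psi>) \<in> \<A>" "p \<in> \<psi> ` V" by force
  then show thesis using that by blast
qed

lemma param_at:
  assumes "smooth_atlas \<A>" "param_at \<A> p = (V, \<psi>)"
  shows "(V, \<psi>) \<in> \<A>" "p \<in> \<psi> ` V"
proof -
  obtain V' \<psi>' y where "(V', \<psi>') \<in> \<A>" "y \<in> V'" "\<psi>' y = p" by (rule chart_cover[OF assms(1)])
  then have "case (V', \<psi>') of (V, \<psi>) \<Rightarrow> (V, \<psi>) \<in> \<A> \<and> p \<in> \<psi> ` V" by auto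
  then have "case param_at \<A> p of (V, \<psi>) \<Rightarrow> (V, \<psi>) \<in> \<A> \<and> p \<in> \<psi> ` V"
    unfolding param_at_def by (rule someI)
  then show "(V, \<psi>) \<in> \<A>" "p \<in> \<psi> ` V" using assms(2) by auto
qed

definition transition_domain :: "(real^'n) set \<Rightarrow> (real^'n \<Rightarrow> 'p) \<Rightarrow> (real^'n) set \<Rightarrow> (real^'n \<Rightarrow> 'p) \<Rightarrow> (real^'n) set"
  where "transition_domain V \<psi> W \<phi> = V \<inter> \<psi> -` (\<phi> ` W)"

definition transition :: "(real^'n \<Rightarrow> 'p) \<Rightarrow> (real^'n) set \<Rightarrow> (real^'n \<Rightarrow> 'p) \<Rightarrow> real^'n \<Rightarrow> real^'n"
  where "transition \<psi> W \<phi> = inv_into W \<phi> \<circ> \<psi>"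

context
  fixes \<A> :: "('n::finite, 'p::{t2_space,second_countable_topology}) atlas" and V \<psi> W \<phi>
  assumes at: "smooth_atlas \<A>" and c1: "(V, \<psi>) \<in> \<A>" and c2: "(W, \<phi>) \<in> \<A>"
begin

lemma transition_open: "open (transition_domain V \<psi> W \<phi>)"
  unfolding transition_domain_def
  using chart_facts[OF at c1] chart_facts[OF at c2] continuous_open_preimage by blast

lemma transition_smooth: "smooth_on (transition_domain V \<psi> W \<phi>) (transition \<psi> W \<phi>)"
  using at c1 c2 unfolding smooth_atlas_def transition_domain_def transition_def by blast

lemma transition_mem:
  assumes "y \<in> transition_domain V \<psi> W \<phi>"
  shows "transition \<psi> W \<phi> y \<in> transition_domain W \<phi> V \<psi>" "\<phi> (transition \<psi> W \<phi> y) = \<psi> y"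
    "transition \<phi> V \<psi> (transition \<psi> W \<phi> y) = y" "transition \<psi> W \<phi> y \<in> W"
  using assms chart_facts(3)[OF at c1] chart_facts(3)[OF at c2]
  unfolding transition_domain_def transition_def
  by (auto simp: inv_into_into f_inv_into_f inv_into_f_f)

lemma transition_differentiable:
  "y \<in> transition_domain V \<psi> W \<phi> \<Longrightarrow> transition \<psi> W \<phi> differentiable (at y)"
  using smooth_on_has_derivative[OF transition_smooth] by (auto simp: differentiable_def)

end

text \<open>The opposite transition is a left inverse, so by the chain rule the derivative is
  injective, and an injective endomorphism in finite dimension is bijective.\<close>

lemma transition_bij:
  assumes at: "smooth_atlas \<A>" and c1: "(V, \<psi>) \<in> \<A>" and c2: "(W, \<phi>) \<in> \<A>"
    and y: "y \<in> transition_domain V \<psi> W \<phi>"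
  shows "bij (frechet_derivative (transition \<psi> W \<phi>) (at y))"
    "det (matrix (frechet_derivative (transition \<psi> W \<phi>) (at y))) \<noteq> 0"
proof -
  let ?\<tau> = "transition \<psi> W \<phi>" and ?\<sigma> = "transition \<phi> V \<psi>"
  let ?D = "frechet_derivative ?\<tau> (at y)" and ?E = "frechet_derivative ?\<sigma> (at (?\<tau> y))"
  have ty: "?\<tau> y \<in> transition_domain W \<phi> V \<psi>" by (rule transition_mem(1)[OF at c1 c2 y])
  have d: "?\<tau> differentiable (at y)" "?\<sigma> differentiable (at (?\<tau> y))"
    using transition_differentiable[OF at c1 c2 y] transition_differentiable[OF at c2 c1 ty] .
  have "v = ?E (?D v)" for v
    using partial_compose(3)[OF d(2,1) transition_open[OF at c1 c2] y, of "\<lambda>x. x" v]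
      transition_mem(3)[OF at c1 c2] by simp
  then have "inj ?D" by (metis injI)
  moreover have l: "linear ?D" using linear_frechet_derivative[OF d(1)] .
  ultimately show "bij ?D" "det (matrix ?D) \<noteq> 0"
    using linear_injective_imp_surjective[OF l] by (auto simp: bij_def det_nz_iff_inj[OF l])
qed

lemma smooth_map_chart:
  "smooth_map \<A> Y \<Longrightarrow> (V, \<psi>) \<in> \<A> \<Longrightarrow> smooth_on V (Y \<circ> \<psi>)"
  unfolding smooth_map_def by blast

lemma smooth_map_differentiable:
  "smooth_map \<A> Y \<Longrightarrow> (V, \<psi>) \<in> \<A> \<Longrightarrow> y \<in> V \<Longrightarrow> (Y \<circ> \<psi>) differentiable (at y)"
  by (metis smooth_on_has_derivative smooth_map_chart differentiable_def)

lemma chart_change: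
  assumes at: "smooth_atlas \<A>" and c1: "(V, \<psi>) \<in> \<A>" and c2: "(W, \<phi>) \<in> \<A>"
    and d: "(Y \<circ> \<phi>) differentiable (at (transition \<psi> W \<phi> y))" and y: "y \<in> transition_domain V \<psi> W \<phi>"
  defines "J \<equiv> matrix (frechet_derivative (transition \<psi> W \<phi>) (at y))"
  shows "gram (Y \<circ> \<psi>) y = transpose J ** gram (Y \<circ> \<phi>) (transition \<psi> W \<phi> y) ** J"
    and "partial (Y \<circ> \<psi>) i y = (\<Sum>k\<in>UNIV. J $ k $ i *\<^sub>R partial (Y \<circ> \<phi>) k (transition \<psi> W \<phi> y))"
    and "(Y \<circ> \<psi>) differentiable (at y)"
    and "frechet_derivative (Y \<circ> \<psi>) (at y) v =
      frechet_derivative (Y \<circ> \<phi>) (at (transition \<psi> W \<phi> y)) (frechet_derivative (transition \<psi> W \<phi>) (at y) v)"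
proof -
  have eq: "(Y \<circ> \<psi>) x = (Y \<circ> \<phi>) (transition \<psi> W \<phi> x)" if "x \<in> transition_domain V \<psi> W \<phi>" for x
    using transition_mem(2)[OF at c1 c2 that] by simp
  note * = d transition_differentiable[OF at c1 c2 y] transition_open[OF at c1 c2] y eq
  show "gram (Y \<circ> \<psi>) y = transpose J ** gram (Y \<circ> \<phi>) (transition \<psi> W \<phi> y) ** J"
    unfolding J_def by (rule gram_compose[OF *])
  show "partial (Y \<circ> \<psi>) i y = (\<Sum>k\<in>UNIV. J $ k $ i *\<^sub>R partial (Y \<circ> \<phi>) k (transition \<psi> W \<phi> y))"
    unfolding J_def by (rule partial_compose(1)[OF *])
  show "(Y \<circ> \<psi>) differentiable (at y)" by (rule partial_compose(2)[OF *])
  show "frechet_derivative (Y \<circ> \<psi>) (at y) v =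
      frechet_derivative (Y \<circ> \<phi>) (at (transition \<psi> W \<phi> y)) (frechet_derivative (transition \<psi> W \<phi>) (at y) v)"
    by (rule partial_compose(3)[OF *])
qed

lemma immersion_gram_pos:
  assumes "smooth_immersion \<A> X" "(V, \<psi>) \<in> \<A>" "y \<in> V"
  shows "0 < det (gram (X \<circ> \<psi>) y)"
  using assms smooth_map_differentiable unfolding smooth_immersion_def
  by (intro det_gram_pos) blast+

text \<open>The definition evaluates in the chart picked by \<open>param_at\<close>;
  \<open>trace_congruence\<close> transfers the value to any chart around the point.\<close>

lemma surface_div_chart:
  assumes at: "smooth_atlas \<A>" and X: "smooth_immersion \<A> X" and Z: "smooth_map \<A> Z"
    and c: "(V, \<psi>) \<in> \<A>" and y: "y \<in> V"
  shows "surface_div \<A> X Z (\<psi> y) = (\<Sum>i\<in>UNIV. \<Sum>j\<in>UNIV. matrix_inv (gram (X \<circ> \<psi>) y) $ i $ j *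
        (partial (Z \<circ> \<psi>) i y \<bullet> partial (X \<circ> \<psi>) j y))"
proof -
  obtain W \<phi> where W: "param_at \<A> (\<psi> y) = (W, \<phi>)" by force
  note c2 = param_at(1)[OF at W]
  have yT: "y \<in> transition_domain V \<psi> W \<phi>"
    using param_at(2)[OF at W] y by (simp add: transition_domain_def)
  let ?\<tau> = "transition \<psi> W \<phi>"
  have Xm: "smooth_map \<A> X" using X by (simp add: smooth_immersion_def)
  have ty: "?\<tau> y \<in> W" using transition_mem(4)[OF at c c2 yT] .
  let ?J = "matrix (frechet_derivative ?\<tau> (at y))"
  let ?B = "\<lambda>\<psi> y. (\<chi> i j. partial (Z \<circ> \<psi>) i y \<bullet> partial (X \<circ> \<psi>) j y) :: real^'a^'a"
  note cX = chart_change[OF at c c2 smooth_map_differentiable[OF Xm c2 ty] yT]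
  note cZ = chart_change[OF at c c2 smooth_map_differentiable[OF Z c2 ty] yT]
  have B: "?B \<psi> y = transpose ?J ** ?B \<phi> (?\<tau> y) ** ?J"
    by (simp add: vec_eq_iff cX(2) cZ(2) bilinear_sum_matrix)
  have "det (gram (X \<circ> \<phi>) (?\<tau> y)) \<noteq> 0" using immersion_gram_pos[OF X c2 ty] by simp
  from trace_congruence[OF this transition_bij(2)[OF at c c2 yT], of "?B \<phi> (?\<tau> y)"]
  have "trace (matrix_inv (gram (X \<circ> \<psi>) y) ** transpose (?B \<psi> y)) =
    trace (matrix_inv (gram (X \<circ> \<phi>) (?\<tau> y)) ** transpose (?B \<phi> (?\<tau> y)))"
    by (simp add: cX(1) B)
  moreover have "inv_into W \<phi> (\<psi> y) = ?\<tau> y" by (simp add: transition_def)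
  ultimately show ?thesis
    unfolding sum_matrix_inv_trace[symmetric] surface_div_def by (simp add: W Let_def)
qed

section \<open>Change of variables for nonnegative functions\<close>

text \<open>The formula for absolutely integrable maps gives integrability of one side iff that of
  the other, with equal integrals. For nonnegative functions the remaining case is that both sides
  are infinite.\<close>

lemma nn_integral_change_of_variables_wellorder:
  fixes \<tau> :: "real^'m::{finite,wellorder} \<Rightarrow> real^'m::_" and f :: "real^'m::_ \<Rightarrow> real"
  assumes S: "S \<in> sets borel" "\<tau> ` S \<in> sets borel"
    and der: "\<And>x. x \<in> S \<Longrightarrow> (\<tau> has_derivative \<tau>' x) (at x within S)" and inj: "inj_on \<tau> S"
    and f: "f \<in> borel_measurable borel" "\<And>x. 0 \<le> f x"
    and meas: "(\<lambda>x. indicator S x * (\<bar>det (matrix (\<tau>' x))\<bar> * f (\<tau> x))) \<in> borel_measurable borel"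
  shows "(\<integral>\<^sup>+x\<in>S. ennreal (\<bar>det (matrix (\<tau>' x))\<bar> * f (\<tau> x)) \<partial>lborel) = (\<integral>\<^sup>+x\<in>\<tau> ` S. ennreal (f x) \<partial>lborel)"
proof -
  define F where "F = (\<lambda>x. indicator S x * (\<bar>det (matrix (\<tau>' x))\<bar> * f (\<tau> x)))"
  define G where "G = (\<lambda>x. indicator (\<tau> ` S) x * f x)"
  have Fm: "F \<in> borel_measurable lborel" using meas by (simp add: F_def)
  have Gm: "G \<in> borel_measurable lborel" using f S by (simp add: G_def)
  have nn: "0 \<le> F x" "0 \<le> G x" for x using f(2) by (auto simp: F_def G_def)
  \<comment> \<open>Real functions are passed through the isomorphism with \<open>real^1\<close>,
    since the formula is stated for vector-valued maps.\<close>
  let ?v = "\<lambda>r::real. (\<chi> i. r) :: real^1"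
  have blv: "bounded_linear ?v" by (intro linear_conv_bounded_linear[THEN iffD1] linearI) (auto simp: vec_eq_iff)
  have blc: "bounded_linear (\<lambda>v::real^1. v $ 1)" by (rule bounded_linear_vec_nth)
  have int_vec: "(\<lambda>x. ?v (h x)) absolutely_integrable_on T \<longleftrightarrow> integrable lborel (\<lambda>x. indicator T x * h x)" (is ?A)
    and integral_vec: "integrable lborel (\<lambda>x. indicator T x * h x) \<Longrightarrow>
      integral T (\<lambda>x. ?v (h x)) = ?v (LINT x|lborel. indicator T x * h x)"
    if hm: "(\<lambda>x. indicator T x * h x) \<in> borel_measurable lborel" for h :: "real^'m::_ \<Rightarrow> real" and T
  proof -
    have "integrable lebesgue (\<lambda>x. ?v (indicator T x * h x)) \<longleftrightarrow> integrable lebesgue (\<lambda>x. indicator T x * h x)"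
      using integrable_bounded_linear[OF blv] integrable_bounded_linear[OF blc, of lebesgue "\<lambda>x. ?v (indicator T x * h x)"]
      by auto
    also have "\<dots> \<longleftrightarrow> integrable lborel (\<lambda>x. indicator T x * h x)"
      by (rule integrable_completion[OF hm])
    finally have 1: "integrable lebesgue (\<lambda>x. ?v (indicator T x * h x)) \<longleftrightarrow> integrable lborel (\<lambda>x. indicator T x * h x)" .
    have eq: "indicator T x *\<^sub>R ?v (h x) = ?v (indicator T x * h x)" for x
      by (simp add: vec_eq_iff)
    show 2: ?A unfolding set_integrable_def eq by (rule 1)
    assume i: "integrable lborel (\<lambda>x. indicator T x * h x)"
    have "integral T (\<lambda>x. ?v (h x)) = (LINT x|lebesgue. ?v (indicator T x * h x))"
      using set_lebesgue_integral_eq_integral(2)[of T "\<lambda>x. ?v (h x)"] 2 i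
      by (simp add: set_lebesgue_integral_def eq)
    also have "\<dots> = ?v (LINT x|lebesgue. indicator T x * h x)"
      by (rule integral_bounded_linear[OF blv]) (use integrable_completion[OF hm] i in simp)
    also have "(LINT x|lebesgue. indicator T x * h x) = (LINT x|lborel. indicator T x * h x)"
      by (rule integral_completion[OF hm])
    finally show "integral T (\<lambda>x. ?v (h x)) = ?v (LINT x|lborel. indicator T x * h x)" .
  qed
  have eqv: "\<bar>det (matrix (\<tau>' x))\<bar> *\<^sub>R ?v (f (\<tau> x)) = ?v (\<bar>det (matrix (\<tau>' x))\<bar> * f (\<tau> x))" for x
    by (simp add: vec_eq_iff)
  have Sl: "S \<in> sets lebesgue" using S by simp
  note cov = has_absolute_integral_change_of_variables[OF Sl der inj, of "\<lambda>x. ?v (f x)", unfolded eqv]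
  let ?F = "\<lambda>x. ?v (\<bar>det (matrix (\<tau>' x))\<bar> * f (\<tau> x))" and ?G = "\<lambda>x. ?v (f x)"
  have A: "?F absolutely_integrable_on S \<longleftrightarrow> ?G absolutely_integrable_on \<tau> ` S"
    using cov[of "integral S ?F"] cov[of "integral (\<tau> ` S) ?G"] by blast
  have I: "?F absolutely_integrable_on S \<Longrightarrow> integral S ?F = integral (\<tau> ` S) ?G"
    using cov[of "integral S ?F"] by simp
  note iF = int_vec[OF Fm[unfolded F_def]] and iG = int_vec[OF Gm[unfolded G_def]]
  have FG: "integrable lborel F \<longleftrightarrow> integrable lborel G"
    unfolding F_def G_def iF[symmetric] iG[symmetric] by (rule A)
  have FGI: "(LINT x|lborel. F x) = (LINT x|lborel. G x)" if F: "integrable lborel F"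
  proof -
    have "integral S ?F = ?v (LINT x|lborel. F x)"
      using integral_vec[OF Fm[unfolded F_def]] F unfolding F_def by simp
    moreover have "integral (\<tau> ` S) ?G = ?v (LINT x|lborel. G x)"
      using integral_vec[OF Gm[unfolded G_def]] F FG unfolding G_def by simp
    moreover have "integral S ?F = integral (\<tau> ` S) ?G"
      using I iF F unfolding F_def by simp
    ultimately have "?v (LINT x|lborel. F x) $ 1 = ?v (LINT x|lborel. G x) $ 1" by metis
    then show ?thesis by simp
  qed
  have "(\<integral>\<^sup>+x. ennreal (F x) \<partial>lborel) = (\<integral>\<^sup>+x. ennreal (G x) \<partial>lborel)"
  proof (cases "integrable lborel F")
    case True
    then show ?thesis
      using FG FGI nn nn_integral_eq_integral[of lborel F] nn_integral_eq_integral[of lborel G] by simp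
  next
    case False
    then have "(\<integral>\<^sup>+x. ennreal (F x) \<partial>lborel) = \<infinity>" "(\<integral>\<^sup>+x. ennreal (G x) \<partial>lborel) = \<infinity>"
      using FG integrableI_nonneg[OF Fm] integrableI_nonneg[OF Gm] nn by (auto simp: less_top[symmetric])
    then show ?thesis by simp
  qed
  then show ?thesis
    by (simp add: F_def G_def ennreal_mult'' nn f(2) ennreal_indicator mult.commute)
qed

text \<open>The change of variables formula of the library needs a wellordered index type.\<close>

typedef ('a::finite) ordered_index = "{..<CARD('a)}"
  by (rule exI[of _ 0]) simp

instantiation ordered_index :: (finite) wellorder
begin
definition "x \<le> y \<longleftrightarrow> Rep_ordered_index x \<le> Rep_ordered_index y"
definition "x < y \<longleftrightarrow> Rep_ordered_index x < Rep_ordered_index y"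
instance
proof
  fix P :: "'a ordered_index \<Rightarrow> bool" and a
  assume step: "\<And>x. (\<And>y. y < x \<Longrightarrow> P y) \<Longrightarrow> P x"
  show "P a"
  proof (induct a rule: measure_induct_rule[of Rep_ordered_index])
    case (less x)
    show ?case by (rule step, rule less) (simp add: less_ordered_index_def)
  qed
qed (auto simp: less_eq_ordered_index_def less_ordered_index_def Rep_ordered_index_inject)
end

instance ordered_index :: (finite) finite
proof
  show "finite (UNIV :: 'a ordered_index set)"
    unfolding type_definition.univ[OF type_definition_ordered_index] by simp
qed

lemma ordered_index_bij: obtains e :: "'a::finite ordered_index \<Rightarrow> 'a" where "bij e"
proof -
  have "bij_betw Rep_ordered_index (UNIV :: 'a ordered_index set) {..<CARD('a)}"
    using type_definition.Rep_range[OF type_definition_ordered_index]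
    by (auto simp: bij_betw_def inj_on_def Rep_ordered_index_inject)
  moreover obtain h where "bij_betw h {0..<CARD('a)} (UNIV :: 'a set)"
    using ex_bij_betw_nat_finite[of "UNIV :: 'a set"] by auto
  ultimately have "bij (h \<circ> (Rep_ordered_index :: 'a ordered_index \<Rightarrow> nat))"
    by (metis bij_betw_trans atLeast0LessThan)
  then show thesis by (rule that)
qed

text \<open>Conjugation by \<open>e\<close> is a sign-preserving bijection between the permutations
  of the two index types, and it matches the terms of the Leibniz formulas.\<close>

lemma det_reindex:
  fixes A :: "real^'b^'b" and e :: "'a::finite \<Rightarrow> 'b::finite"
  assumes e: "bij e"
  shows "det (\<chi> i j. A $ e i $ e j) = det A"
proof -
  have e': "bij (inv e)" using e bij_imp_bij_inv by blast
  have inv: "e (inv e b) = b" "inv e (e a) = a" for a b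
    using e by (simp_all add: bij_is_surj surj_f_inv_f bij_is_inj)
  show ?thesis
    unfolding det_def
  proof (rule sum.reindex_bij_witness[where j = "map_permutation UNIV e" and i = "map_permutation UNIV (inv e)"])
    fix p assume "p \<in> {p. p permutes (UNIV :: 'a set)}"
    then have p: "p permutes UNIV" by simp
    let ?q = "map_permutation UNIV e p"
    show "map_permutation UNIV (inv e) ?q = p"
      using map_permutation_compose_inv[of e UNIV UNIV p "inv e"] e p inv by auto
    show "?q \<in> {p. p permutes UNIV}" using map_permutation_permutes[of e UNIV UNIV p] e p by simp
    have "(\<Prod>i\<in>UNIV. A $ i $ ?q i) = (\<Prod>i\<in>UNIV. A $ e i $ ?q (e i))"
      by (rule prod.reindex_bij_betw[symmetric]) (use e in simp)
    also have "\<dots> = (\<Prod>i\<in>UNIV. A $ e i $ e (p i))"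
      using e by (simp add: map_permutation_apply bij_is_inj)
    finally show "of_int (sign ?q) * (\<Prod>i\<in>UNIV. A $ i $ ?q i) =
      of_int (sign p) * (\<Prod>i\<in>UNIV. (\<chi> i j. A $ e i $ e j) $ i $ p i)"
      using sign_map_permutation[of e UNIV p] e p by (simp add: bij_is_inj)
  next
    fix p assume "p \<in> {p. p permutes (UNIV :: 'b set)}"
    then have p: "p permutes UNIV" by simp
    show "map_permutation UNIV e (map_permutation UNIV (inv e) p) = p"
      using map_permutation_compose_inv[of "inv e" UNIV UNIV p e] e' p inv by auto
    show "map_permutation UNIV (inv e) p \<in> {p. p permutes UNIV}"
      using map_permutation_permutes[of "inv e" UNIV UNIV p] e' p by simp
  qed
qed

definition reindex :: "('a \<Rightarrow> 'b) \<Rightarrow> real^'b \<Rightarrow> real^'a" where "reindex e x = (\<chi> i. x $ e i)"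

lemma reindex_nth [simp]: "reindex e x $ i = x $ e i"
  by (simp add: reindex_def)

lemma linear_reindex: "linear (reindex e)"
  by (intro linearI) (auto simp: reindex_def vec_eq_iff)

lemma reindex_inverse: "bij e \<Longrightarrow> reindex (inv e) (reindex e x) = x" "bij e \<Longrightarrow> reindex e (reindex (inv e) y) = y"
  by (simp_all add: reindex_def vec_eq_iff bij_is_surj surj_f_inv_f bij_is_inj)

lemma reindex_measurable [measurable]: "reindex e \<in> borel_measurable borel"
  for e :: "'a::finite \<Rightarrow> 'b::finite"
  by (intro borel_measurable_continuous_onI linear_continuous_on linear_conv_bounded_linear[THEN iffD1] linear_reindex)

lemma prod_Basis_vec: "(\<Prod>b\<in>(Basis :: (real^'n) set). f b) = (\<Prod>i\<in>UNIV. f (axis i 1))"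
proof -
  have B: "(Basis :: (real^'n) set) = range (\<lambda>i. axis i 1)" by (auto simp: Basis_vec_def)
  have "inj (\<lambda>i::'n. axis i (1::real))" by (auto simp: inj_def axis_eq_axis)
  from prod.reindex[OF this, of f] show ?thesis unfolding B by (simp add: o_def)
qed

text \<open>Renaming coordinates maps boxes to boxes with the same side lengths, and Lebesgue
  measure is determined by the volume of boxes.\<close>

lemma lborel_reindex:
  fixes e :: "'a::finite \<Rightarrow> 'b::finite"
  assumes e: "bij e"
  shows "distr lborel borel (reindex e) = lborel"
proof (rule lborel_eqI[symmetric])
  fix l u :: "real^'a" assume lu: "\<And>b. b \<in> Basis \<Longrightarrow> l \<bullet> b \<le> u \<bullet> b"
  have le: "l $ i \<le> u $ i" for i using lu[of "axis i 1"] by (simp add: inner_axis)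
  let ?r = "reindex (inv e)"
  have einv: "e (inv e j) = j" "inv e (e i) = i" for i j
    using e by (simp_all add: bij_is_surj surj_f_inv_f bij_is_inj)
  have box: "reindex e -` box l u = box (?r l) (?r u)"
    by (auto simp: mem_box_cart reindex_def) (metis einv)+
  have "emeasure (distr lborel borel (reindex e)) (box l u) = emeasure lborel (box (?r l) (?r u))"
    by (subst emeasure_distr) (auto simp: box)
  also have "\<dots> = (\<Prod>b\<in>Basis. (?r u - ?r l) \<bullet> b)"
    by (rule emeasure_lborel_box) (auto simp: Basis_vec_def inner_axis reindex_def le)
  also have "(\<Prod>b\<in>Basis. (?r u - ?r l) \<bullet> b) = (\<Prod>j\<in>UNIV. u $ inv e j - l $ inv e j)"
    by (simp add: prod_Basis_vec inner_axis reindex_def)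
  also have "\<dots> = (\<Prod>i\<in>UNIV. u $ i - l $ i)"
    by (rule prod.reindex_bij_betw) (use e bij_imp_bij_inv in blast)
  also have "\<dots> = (\<Prod>b\<in>Basis. (u - l) \<bullet> b)"
    by (simp add: prod_Basis_vec inner_axis)
  finally show "emeasure (distr lborel borel (reindex e)) (box l u) = (\<Prod>b\<in>Basis. (u - l) \<bullet> b)" .
qed simp

lemma nn_integral_reindex:
  assumes "bij e" "h \<in> borel_measurable borel"
  shows "(\<integral>\<^sup>+x. h (reindex e x) \<partial>lborel) = (\<integral>\<^sup>+x. h x \<partial>lborel)"
  using assms by (subst lborel_reindex[OF assms(1), symmetric], subst nn_integral_distr) auto

text \<open>\<open>\<tau>\<close> is conjugated by a renaming of coordinates to an ordered index
  type. Renaming preserves Lebesgue measure and the Jacobian determinant.\<close>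

lemma nn_integral_change_of_variables:
  fixes \<tau> :: "real^'n \<Rightarrow> real^'n" and f :: "real^'n \<Rightarrow> real"
  assumes S: "S \<in> sets borel" "\<tau> ` S \<in> sets borel"
    and der: "\<And>x. x \<in> S \<Longrightarrow> (\<tau> has_derivative \<tau>' x) (at x)" and inj: "inj_on \<tau> S"
    and f: "f \<in> borel_measurable borel" "\<And>x. 0 \<le> f x"
    and meas: "(\<lambda>x. indicator S x * (\<bar>det (matrix (\<tau>' x))\<bar> * f (\<tau> x))) \<in> borel_measurable borel"
  shows "(\<integral>\<^sup>+x\<in>S. ennreal (\<bar>det (matrix (\<tau>' x))\<bar> * f (\<tau> x)) \<partial>lborel) = (\<integral>\<^sup>+x\<in>\<tau> ` S. ennreal (f x) \<partial>lborel)"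
proof -
  obtain e :: "'n ordered_index \<Rightarrow> 'n" where e: "bij e" by (rule ordered_index_bij)
  have e': "bij (inv e)" using e bij_imp_bij_inv by blast
  let ?L = "reindex e" and ?K = "reindex (inv e)"
  note inv = reindex_inverse[OF e]
  define S' where "S' = ?L ` S"
  define \<sigma> where "\<sigma> = ?L \<circ> \<tau> \<circ> ?K"
  define \<sigma>' where "\<sigma>' x = ?L \<circ> \<tau>' (?K x) \<circ> ?K" for x
  have Lim: "?L ` B = ?K -` B" for B
    using inv by (auto simp: image_iff) metis
  have Lb: "?L ` B \<in> sets borel" if "B \<in> sets borel" for B
    unfolding Lim using measurable_sets[OF reindex_measurable that] by simp
  have \<sigma>S: "\<sigma> ` S' = ?L ` (\<tau> ` S)" by (auto simp: \<sigma>_def S'_def inv image_iff)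
  have bl: "bounded_linear (reindex e')" for e' :: "'x::finite \<Rightarrow> 'y::finite"
    using linear_reindex linear_conv_bounded_linear by blast
  have det: "det (matrix (\<sigma>' x)) = det (matrix (\<tau>' (?K x)))" for x
  proof -
    have ax: "?K (axis j 1) = axis (e j) 1" for j
      using e by (auto simp: vec_eq_iff axis_def bij_is_surj surj_f_inv_f bij_is_inj)
    have "matrix (\<sigma>' x) $ i $ j = matrix (\<tau>' (?K x)) $ e i $ e j" for i j
      by (simp add: matrix_def \<sigma>'_def ax)
    then have "matrix (\<sigma>' x) = (\<chi> i j. matrix (\<tau>' (?K x)) $ e i $ e j)"
      by (simp add: vec_eq_iff)
    then show ?thesis by (simp add: det_reindex[OF e])
  qed
  have mem: "x \<in> S' \<longleftrightarrow> ?K x \<in> S" for x unfolding S'_def Lim by simp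
  have ind: "indicator S' x = (indicator S (?K x) :: 'z::zero_neq_one)" for x by (simp add: indicator_def mem)
  have meas': "(\<lambda>x. indicator S' x * (\<bar>det (matrix (\<sigma>' x))\<bar> * f (?K (\<sigma> x)))) \<in> borel_measurable borel"
    using measurable_compose[OF reindex_measurable meas, of "inv e"]
    by (simp add: ind det \<sigma>_def inv)
  have "(\<integral>\<^sup>+x\<in>S'. ennreal (\<bar>det (matrix (\<sigma>' x))\<bar> * f (?K (\<sigma> x))) \<partial>lborel) = (\<integral>\<^sup>+x\<in>\<sigma> ` S'. ennreal (f (?K x)) \<partial>lborel)"
  proof (rule nn_integral_change_of_variables_wellorder)
    show "S' \<in> sets borel" "\<sigma> ` S' \<in> sets borel" using S Lb unfolding \<sigma>S by (simp_all add: S'_def)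
    show "(\<sigma> has_derivative \<sigma>' x) (at x within S')" if "x \<in> S'" for x
    proof -
      have K: "(?K has_derivative ?K) (at x)" using bl bounded_linear_imp_has_derivative by blast
      have L: "(?L has_derivative ?L) (at y)" for y using bl bounded_linear_imp_has_derivative by blast
      have "(\<sigma> has_derivative \<sigma>' x) (at x)"
        unfolding \<sigma>_def \<sigma>'_def using der that
        by (intro diff_chain_at K L) (simp add: mem)
      then show ?thesis by (rule has_derivative_at_withinI)
    qed
    show "inj_on \<sigma> S'"
    proof (rule inj_onI)
      fix x y assume "x \<in> S'" "y \<in> S'" "\<sigma> x = \<sigma> y"
      then have "\<tau> (?K x) = \<tau> (?K y)" by (metis \<sigma>_def comp_apply inv(1))
      then have "?K x = ?K y" using inj \<open>x \<in> S'\<close> \<open>y \<in> S'\<close> by (simp add: mem inj_on_eq_iff)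
      then show "x = y" by (metis inv(2))
    qed
    show "(\<lambda>x. f (?K x)) \<in> borel_measurable borel" using f(1) by measurable
  qed (use f meas' in auto)
  moreover have "(\<integral>\<^sup>+x\<in>S'. ennreal (\<bar>det (matrix (\<sigma>' x))\<bar> * f (?K (\<sigma> x))) \<partial>lborel) =
    (\<integral>\<^sup>+x\<in>S. ennreal (\<bar>det (matrix (\<tau>' x))\<bar> * f (\<tau> x)) \<partial>lborel)"
  proof -
    let ?h = "\<lambda>x. ennreal (\<bar>det (matrix (\<tau>' x))\<bar> * f (\<tau> x)) * indicator S x"
    have "?h = (\<lambda>x. ennreal (indicator S x * (\<bar>det (matrix (\<tau>' x))\<bar> * f (\<tau> x))))"
      by (auto simp: fun_eq_iff indicator_def)
    then have "?h \<in> borel_measurable borel" using meas by simp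
    from nn_integral_reindex[OF e' this] show ?thesis by (simp add: ind det \<sigma>_def inv)
  qed
  moreover have "(\<integral>\<^sup>+x\<in>\<sigma> ` S'. ennreal (f (?K x)) \<partial>lborel) = (\<integral>\<^sup>+x\<in>\<tau> ` S. ennreal (f x) \<partial>lborel)"
  proof -
    have "indicator (\<sigma> ` S') x = (indicator (\<tau> ` S) (?K x) :: ennreal)" for x
      by (simp add: \<sigma>S Lim indicator_def)
    moreover have "(\<lambda>x. ennreal (f x) * indicator (\<tau> ` S) x) \<in> borel_measurable borel"
      using f S by simp
    ultimately show ?thesis using nn_integral_reindex[OF e', of "\<lambda>x. ennreal (f x) * indicator (\<tau> ` S) x"] by simp
  qed
  ultimately show ?thesis by simp
qed

section \<open>The area measure\<close>

definition area_density :: "('p \<Rightarrow> 'b::real_inner) \<Rightarrow> (real^'n \<Rightarrow> 'p) \<Rightarrow> real^'n \<Rightarrow> real" where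
  "area_density Y \<psi> y = sqrt (det (gram (Y \<circ> \<psi>) y))"

definition is_area_measure ::
    "('n::finite, 'p::topological_space) atlas \<Rightarrow> ('p \<Rightarrow> 'b::real_inner) \<Rightarrow> 'p measure \<Rightarrow> bool" where
  "is_area_measure \<A> Y \<mu> \<longleftrightarrow> sets \<mu> = sets borel \<and>
     (\<forall>(V, \<psi>)\<in>\<A>. \<forall>B\<in>sets borel. B \<subseteq> \<psi> ` V \<longrightarrow>
        emeasure \<mu> B = (\<integral>\<^sup>+ y\<in>(V \<inter> \<psi> -` B). ennreal (area_density Y \<psi> y) \<partial>lborel))"

lemma area_measure_The: "area_measure \<A> Y = (THE \<mu>. is_area_measure \<A> Y \<mu>)"
  by (simp add: area_measure_def is_area_measure_def area_density_def)

lemma chart_preimage_borel: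
  assumes "smooth_atlas \<A>" "(V, \<psi>) \<in> \<A>" "B \<in> sets borel"
  shows "V \<inter> \<psi> -` B \<in> sets borel"
proof -
  have "\<psi> -` B \<inter> space (restrict_space borel V) \<in> sets (restrict_space borel V)"
    by (rule measurable_sets[OF borel_measurable_continuous_on_restrict[OF chart_facts(4)[OF assms(1,2)]] assms(3)])
  then show ?thesis
    using chart_facts(1)[OF assms(1,2)] by (simp add: sets_restrict_space_iff space_restrict_space Int_commute)
qed

lemma gram_continuous:
  assumes "C_k_on (Suc 0) V g" "open V"
  shows "continuous_on V (\<lambda>y. det (gram g y))"
  unfolding det_def gram_def partial_def
  using assms by (auto intro!: continuous_intros)

lemma area_density_continuous:
  assumes "smooth_map \<A> Y" "smooth_atlas \<A>" "(V, \<psi>) \<in> \<A>"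
  shows "continuous_on V (area_density Y \<psi>)"
  unfolding area_density_def
  by (intro continuous_intros gram_continuous[OF smooth_on_C_k[OF smooth_map_chart[OF assms(1,3)]]]
      chart_facts(1)[OF assms(2,3)])

lemma area_density_measurable:
  assumes "smooth_map \<A> Y" "smooth_atlas \<A>" "(V, \<psi>) \<in> \<A>" "B \<in> sets borel"
  shows "(\<lambda>y. ennreal (area_density Y \<psi> y) * indicator (V \<inter> \<psi> -` B) y) \<in> borel_measurable borel"
proof -
  have "continuous_on (V \<inter> \<psi> -` B) (area_density Y \<psi>)"
    by (rule continuous_on_subset[OF area_density_continuous[OF assms(1-3)]]) simp
  from borel_measurable_continuous_on_indicator[OF chart_preimage_borel[OF assms(2-4)] this]
  have "(\<lambda>y. indicator (V \<inter> \<psi> -` B) y *\<^sub>R area_density Y \<psi> y) \<in> borel_measurable borel" .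
  then have "(\<lambda>y. ennreal (indicator (V \<inter> \<psi> -` B) y *\<^sub>R area_density Y \<psi> y)) \<in> borel_measurable borel"
    by simp
  moreover have "ennreal (indicator (V \<inter> \<psi> -` B) y *\<^sub>R area_density Y \<psi> y) =
    ennreal (area_density Y \<psi> y) * indicator (V \<inter> \<psi> -` B) y" for y
    by (auto simp: indicator_def)
  ultimately show ?thesis by simp
qed

text \<open>The Gram determinant changes by the square of the Jacobian determinant, so its root
  changes by exactly the factor in the change of variables formula.\<close>

lemma chart_area_independent:
  assumes at: "smooth_atlas \<A>" and Y: "smooth_map \<A> Y" and c1: "(V, \<psi>) \<in> \<A>" and c2: "(W, \<phi>) \<in> \<A>"
    and B: "B \<in> sets borel" "B \<subseteq> \<psi> ` V" "B \<subseteq> \<phi> ` W"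
  shows "(\<integral>\<^sup>+ y\<in>(V \<inter> \<psi> -` B). ennreal (area_density Y \<psi> y) \<partial>lborel) =
    (\<integral>\<^sup>+ y\<in>(W \<inter> \<phi> -` B). ennreal (area_density Y \<phi> y) \<partial>lborel)"
proof -
  let ?\<tau> = "transition \<psi> W \<phi>" and ?S = "V \<inter> \<psi> -` B"
  let ?\<tau>' = "\<lambda>y. frechet_derivative ?\<tau> (at y)"
  \<comment> \<open>Cut off by the indicator and by \<open>max 0\<close>, the density is Borel and
    nonnegative on the whole space. Integrals are unaffected, since \<open>ennreal\<close> sends
    negative numbers to 0.\<close>
  let ?f = "\<lambda>x. indicator (W \<inter> \<phi> -` B) x * max 0 (area_density Y \<phi> x)"
  have ST: "?S \<subseteq> transition_domain V \<psi> W \<phi>" using B by (auto simp: transition_domain_def)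
  have Sb: "?S \<in> sets borel" using chart_preimage_borel[OF at c1 B(1)] .
  have im: "?\<tau> ` ?S = W \<inter> \<phi> -` B"
  proof
    show "?\<tau> ` ?S \<subseteq> W \<inter> \<phi> -` B"
      using ST transition_mem(2,4)[OF at c1 c2] by force
    show "W \<inter> \<phi> -` B \<subseteq> ?\<tau> ` ?S"
    proof
      fix x assume x: "x \<in> W \<inter> \<phi> -` B"
      then have "x \<in> transition_domain W \<phi> V \<psi>" using B by (auto simp: transition_domain_def)
      from transition_mem[OF at c2 c1 this] x show "x \<in> ?\<tau> ` ?S"
        by (intro image_eqI[of _ _ "transition \<phi> V \<psi> x"]) auto
    qed
  qed
  have fm: "?f \<in> borel_measurable borel"
  proof -
    have "continuous_on (W \<inter> \<phi> -` B) (\<lambda>x. max 0 (area_density Y \<phi> x))"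
      by (intro continuous_intros continuous_on_subset[OF area_density_continuous[OF Y at c2]]) simp
    from borel_measurable_continuous_on_indicator[OF chart_preimage_borel[OF at c2 B(1)] this]
    show ?thesis by simp
  qed
  have dens: "\<bar>det (matrix (?\<tau>' y))\<bar> * ?f (?\<tau> y) = max 0 (area_density Y \<psi> y)" if y: "y \<in> ?S" for y
  proof -
    have yT: "y \<in> transition_domain V \<psi> W \<phi>" using ST y by blast
    have "det (gram (Y \<circ> \<psi>) y) = (det (matrix (?\<tau>' y)))\<^sup>2 * det (gram (Y \<circ> \<phi>) (?\<tau> y))"
      using chart_change(1)[OF at c1 c2 smooth_map_differentiable[OF Y c2 transition_mem(4)[OF at c1 c2 yT]] yT]
      by (simp add: det_mul det_transpose power2_eq_square)
    then have "area_density Y \<psi> y = \<bar>det (matrix (?\<tau>' y))\<bar> * area_density Y \<phi> (?\<tau> y)"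
      by (simp add: area_density_def real_sqrt_mult)
    moreover have "?\<tau> y \<in> W \<inter> \<phi> -` B" using im y by blast
    ultimately show ?thesis by (simp add: max_mult_distrib_left)
  qed
  have "(\<integral>\<^sup>+x\<in>?S. ennreal (\<bar>det (matrix (?\<tau>' x))\<bar> * ?f (?\<tau> x)) \<partial>lborel) = (\<integral>\<^sup>+x\<in>?\<tau> ` ?S. ennreal (?f x) \<partial>lborel)"
  proof (rule nn_integral_change_of_variables)
    show "?\<tau> ` ?S \<in> sets borel" using im chart_preimage_borel[OF at c2 B(1)] by simp
    show "(?\<tau> has_derivative ?\<tau>' x) (at x)" if "x \<in> ?S" for x
      using smooth_on_has_derivative[OF transition_smooth[OF at c1 c2]] ST that by blast
    show "inj_on ?\<tau> ?S"
      by (rule inj_on_inverseI[of _ "transition \<phi> V \<psi>"]) (use ST transition_mem(3)[OF at c1 c2] in blast)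
    have "continuous_on ?S (\<lambda>y. max 0 (area_density Y \<psi> y))"
      by (intro continuous_intros continuous_on_subset[OF area_density_continuous[OF Y at c1]]) simp
    from borel_measurable_continuous_on_indicator[OF Sb this]
    show "(\<lambda>x. indicator ?S x * (\<bar>det (matrix (?\<tau>' x))\<bar> * ?f (?\<tau> x))) \<in> borel_measurable borel"
      by (rule measurable_cong[THEN iffD1, rotated]) (use dens in \<open>auto simp: indicator_def\<close>)
  qed (use Sb fm in auto)
  also have "(\<integral>\<^sup>+x\<in>?S. ennreal (\<bar>det (matrix (?\<tau>' x))\<bar> * ?f (?\<tau> x)) \<partial>lborel) = (\<integral>\<^sup>+ y\<in>?S. ennreal (area_density Y \<psi> y) \<partial>lborel)"
  proof (rule nn_integral_cong)
    fix x
    have "ennreal (\<bar>det (matrix (?\<tau>' x))\<bar> * ?f (?\<tau> x)) = ennreal (area_density Y \<psi> x)" if "x \<in> ?S"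
      unfolding dens[OF that] by (simp add: max_def ennreal_neg)
    then show "ennreal (\<bar>det (matrix (?\<tau>' x))\<bar> * ?f (?\<tau> x)) * indicator ?S x =
        ennreal (area_density Y \<psi> x) * indicator ?S x"
      by (cases "x \<in> ?S") simp_all
  qed
  also have "(\<integral>\<^sup>+x\<in>?\<tau> ` ?S. ennreal (?f x) \<partial>lborel) = (\<integral>\<^sup>+ y\<in>(W \<inter> \<phi> -` B). ennreal (area_density Y \<phi> y) \<partial>lborel)"
    unfolding im by (intro nn_integral_cong) (auto simp: indicator_def max_def ennreal_neg)
  finally show ?thesis .
qed

text \<open>Second countability makes the cover by charts reducible to a countable one; a sequence
  of charts can then be made disjoint by \<open>disjointed\<close>.\<close>

lemma countable_atlas:
  fixes \<A> :: "('n::finite, 'p::{t2_space,second_countable_topology}) atlas"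
  assumes at: "smooth_atlas \<A>"
  obtains c :: "nat \<Rightarrow> (real^'n) set \<times> (real^'n \<Rightarrow> 'p)"
  where "\<And>k. c k \<in> \<A>" "(\<Union>k. snd (c k) ` fst (c k)) = UNIV"
proof -
  let ?F = "(\<lambda>(V, \<psi>). \<psi> ` V) ` \<A>"
  have "open S" if "S \<in> ?F" for S using that chart_facts(2)[OF at] by auto
  from Lindelof[OF this] obtain F' where F': "F' \<subseteq> ?F" "countable F'" "\<Union>F' = \<Union>?F" by metis
  have cov: "\<Union>?F = UNIV" using at unfolding smooth_atlas_def by blast
  have "F' \<noteq> {}" using F'(3) cov by auto
  then have rng: "range (from_nat_into F') = F'" using F'(2) by (simp add: range_from_nat_into)
  have "\<exists>C. C \<in> \<A> \<and> snd C ` fst C = from_nat_into F' k" for k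
  proof -
    have "from_nat_into F' k \<in> ?F" using rng F'(1) by blast
    then show ?thesis by force
  qed
  then obtain c where c: "\<And>k. c k \<in> \<A> \<and> snd (c k) ` fst (c k) = from_nat_into F' k" by metis
  have "(\<Union>k. snd (c k) ` fst (c k)) = \<Union>F'" using c rng by simp
  then show thesis using that[of c] c F'(3) cov by simp
qed

lemma is_area_measureD:
  assumes "is_area_measure \<A> Y \<mu>" "(V, \<psi>) \<in> \<A>" "B \<in> sets borel" "B \<subseteq> \<psi> ` V"
  shows "emeasure \<mu> B = (\<integral>\<^sup>+ y\<in>(V \<inter> \<psi> -` B). ennreal (area_density Y \<psi> y) \<partial>lborel)"
  using assms unfolding is_area_measure_def by fast

text \<open>Every Borel set is a countable disjoint union of pieces lying in single charts, on which
  the measure is prescribed.\<close>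

lemma is_area_measure_unique:
  fixes \<A> :: "('n::finite, 'p::{t2_space,second_countable_topology}) atlas"
  assumes at: "smooth_atlas \<A>" and "is_area_measure \<A> Y \<mu>" "is_area_measure \<A> Y \<nu>"
  shows "\<mu> = \<nu>"
proof (rule measure_eqI)
  show sets: "sets \<mu> = sets \<nu>" using assms by (simp add: is_area_measure_def)
  fix B assume "B \<in> sets \<mu>"
  then have B: "B \<in> sets borel" using assms by (simp add: is_area_measure_def)
  obtain c :: "nat \<Rightarrow> (real^'n) set \<times> (real^'n \<Rightarrow> 'p)"
    where c: "\<And>k. c k \<in> \<A>" "(\<Union>k. snd (c k) ` fst (c k)) = UNIV" by (rule countable_atlas[OF at]) (rule that)
  define U where "U k = snd (c k) ` fst (c k)" for k
  have U: "U k \<in> sets borel" for k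
    using chart_facts(2)[OF at, of "fst (c k)" "snd (c k)"] c(1)[of k] by (simp add: U_def)
  have D: "disjointed U k \<in> sets borel" for k
    using sets.range_disjointed_sets[of U borel] U by auto
  let ?B = "\<lambda>k. B \<inter> disjointed U k"
  have un: "(\<Union>k. ?B k) = B" using c(2) UN_disjointed_eq[of U] by (auto simp: U_def)
  have dj: "disjoint_family ?B" using disjoint_family_disjointed[of U] by (auto simp: disjoint_family_on_def)
  have eq: "emeasure \<mu> (?B k) = emeasure \<nu> (?B k)" for k
  proof -
    obtain V \<psi> where ck: "c k = (V, \<psi>)" by force
    have sub: "?B k \<subseteq> \<psi> ` V" using disjointed_subset[of U k] by (auto simp: U_def ck)
    have Bk: "?B k \<in> sets borel" using B D by auto
    have ca: "(V, \<psi>) \<in> \<A>" using c(1)[of k] ck by simp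
    show ?thesis
      unfolding is_area_measureD[OF assms(2) ca Bk sub] is_area_measureD[OF assms(3) ca Bk sub] ..
  qed
  have "emeasure \<mu> (\<Union>k. ?B k) = emeasure \<nu> (\<Union>k. ?B k)"
    using suminf_emeasure[of ?B \<mu>] suminf_emeasure[of ?B \<nu>] B D dj eq assms(2,3)
    by (simp add: is_area_measure_def image_subset_iff)
  then show "emeasure \<mu> B = emeasure \<nu> B" by (simp only: un)
qed

text \<open>The measure adds up the chart integrals over a countable disjoint decomposition. That it
  has the right value in every other chart is \<open>chart_area_independent\<close> on each
  piece.\<close>

lemma is_area_measure_exists:
  fixes \<A> :: "('n::finite, 'p::{t2_space,second_countable_topology}) atlas"
  assumes at: "smooth_atlas \<A>" and Y: "smooth_map \<A> Y"
  shows "\<exists>\<mu>. is_area_measure \<A> Y \<mu>"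
proof -
  obtain c :: "nat \<Rightarrow> (real^'n) set \<times> (real^'n \<Rightarrow> 'p)"
    where c: "\<And>k. c k \<in> \<A>" "(\<Union>k. snd (c k) ` fst (c k)) = UNIV" by (rule countable_atlas[OF at]) (rule that)
  define V where "V k = fst (c k)" for k
  define \<psi> where "\<psi> k = snd (c k)" for k
  have V\<psi>: "(V k, \<psi> k) \<in> \<A>" for k using c(1)[of k] by (simp add: V_def \<psi>_def)
  define U where "U k = \<psi> k ` V k" for k
  have UO: "(\<Union>k. U k) = UNIV" using c(2) by (simp add: U_def V_def \<psi>_def)
  have U: "U k \<in> sets borel" for k using chart_facts(2)[OF at V\<psi>] by (simp add: U_def)
  have D: "disjointed U k \<in> sets borel" for k
    using sets.range_disjointed_sets[of U borel] U by auto
  let ?I = "\<lambda>V \<psi> B. \<integral>\<^sup>+ y\<in>(V \<inter> \<psi> -` B). ennreal (area_density Y \<psi> y) \<partial>lborel"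
  \<comment> \<open>Writing the sum as an integral over the counting measure reduces countable
    additivity to an exchange of a sum with an integral.\<close>
  define m where "m B = (\<integral>\<^sup>+k. ?I (V k) (\<psi> k) (B \<inter> disjointed U k) \<partial>count_space UNIV)" for B
  have add: "?I V \<psi> (\<Union>i. B i) = (\<Sum>i. ?I V \<psi> (B i))"
    if "(V, \<psi>) \<in> \<A>" "\<And>i::nat. B i \<in> sets borel" "disjoint_family B" for V \<psi> B
  proof -
    have "(\<Sum>i. ?I V \<psi> (B i)) = (\<integral>\<^sup>+ y. (\<Sum>i. ennreal (area_density Y \<psi> y) * indicator (V \<inter> \<psi> -` B i) y) \<partial>lborel)"
      by (rule nn_integral_suminf[symmetric]) (use area_density_measurable[OF Y at that(1) that(2)] in simp)
    also have "\<dots> = ?I V \<psi> (\<Union>i. B i)"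
    proof (rule nn_integral_cong)
      fix y
      have dj: "disjoint_family (\<lambda>i. V \<inter> \<psi> -` B i)" using that(3) by (auto simp: disjoint_family_on_def)
      have "(\<Sum>i. indicator (V \<inter> \<psi> -` B i) y :: ennreal) = indicator (\<Union>i. V \<inter> \<psi> -` B i) y"
        by (rule suminf_indicator[OF dj])
      also have "(\<Union>i. V \<inter> \<psi> -` B i) = V \<inter> \<psi> -` (\<Union>i. B i)" by auto
      finally show "(\<Sum>i. ennreal (area_density Y \<psi> y) * indicator (V \<inter> \<psi> -` B i) y) =
        ennreal (area_density Y \<psi> y) * indicator (V \<inter> \<psi> -` (\<Union>i. B i)) y" by simp
    qed
    finally show ?thesis by simp
  qed
  define \<mu> where "\<mu> = measure_of UNIV (sets borel) m"
  have em: "emeasure \<mu> B = m B" if "B \<in> sets borel" for B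
    unfolding \<mu>_def
  proof (rule emeasure_measure_of_sigma)
    show "sigma_algebra UNIV (sets borel)" using sets.sigma_algebra_axioms[of borel] by simp
    show "positive (sets borel) m" by (simp add: positive_def m_def)
    show "countably_additive (sets borel) m"
    proof (rule countably_additiveI)
      fix B :: "nat \<Rightarrow> 'p set" assume B: "range B \<subseteq> sets borel" "disjoint_family B"
      have "(\<Sum>i. m (B i)) = (\<integral>\<^sup>+k. (\<Sum>i. ?I (V k) (\<psi> k) (B i \<inter> disjointed U k)) \<partial>count_space UNIV)"
        unfolding m_def by (rule nn_integral_suminf[symmetric]) simp
      also have "\<dots> = m (\<Union>i. B i)"
        unfolding m_def
      proof (intro nn_integral_cong)
        fix k
        have "disjoint_family (\<lambda>i. B i \<inter> disjointed U k)" using B(2) by (auto simp: disjoint_family_on_def)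
        moreover have "B i \<inter> disjointed U k \<in> sets borel" for i using B(1) D by auto
        ultimately show "(\<Sum>i. ?I (V k) (\<psi> k) (B i \<inter> disjointed U k)) = ?I (V k) (\<psi> k) ((\<Union>i. B i) \<inter> disjointed U k)"
          using add[OF V\<psi>, of "\<lambda>i. B i \<inter> disjointed U k" k] by simp
      qed
      finally show "(\<Sum>i. m (B i)) = m (\<Union>i. B i)" .
    qed
  qed (rule that)
  have sm: "sets \<mu> = sets borel"
    using sets.sets_measure_of_eq[of borel m] by (simp add: \<mu>_def)
  have "is_area_measure \<A> Y \<mu>"
    unfolding is_area_measure_def
  proof (rule conjI, fact sm, clarify)
    fix W \<phi> B assume W: "(W, \<phi>) \<in> \<A>" and B: "B \<in> sets borel" "B \<subseteq> \<phi> ` W"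
    have "m B = (\<integral>\<^sup>+k. ?I W \<phi> (B \<inter> disjointed U k) \<partial>count_space UNIV)"
      unfolding m_def
    proof (rule nn_integral_cong, rule chart_area_independent[OF at Y V\<psi> W])
      fix k
      show "B \<inter> disjointed U k \<in> sets borel" using B D by auto
      show "B \<inter> disjointed U k \<subseteq> \<psi> k ` V k" using disjointed_subset[of U k] by (auto simp: U_def)
      show "B \<inter> disjointed U k \<subseteq> \<phi> ` W" using B by auto
    qed
    also have "\<dots> = (\<Sum>k. ?I W \<phi> (B \<inter> disjointed U k))" by (rule nn_integral_count_space_nat)
    also have "\<dots> = ?I W \<phi> (\<Union>k. B \<inter> disjointed U k)"
    proof (rule add[OF W, symmetric])
      show "disjoint_family (\<lambda>k. B \<inter> disjointed U k)"
        using disjoint_family_disjointed[of U] unfolding disjoint_family_on_def by blast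
    qed (use D B in auto)
    also have "(\<Union>k. B \<inter> disjointed U k) = B" using UO UN_disjointed_eq[of U] by auto
    finally show "emeasure \<mu> B = ?I W \<phi> B" by (simp add: em B)
  qed
  then show ?thesis by blast
qed

lemma area_measure:
  fixes \<A> :: "('n::finite, 'p::{t2_space,second_countable_topology}) atlas"
  assumes at: "smooth_atlas \<A>" and Y: "smooth_map \<A> Y"
  shows "is_area_measure \<A> Y (area_measure \<A> Y)"
  unfolding area_measure_The
  using is_area_measure_exists[OF at Y] is_area_measure_unique[OF at] by (metis theI)

lemma continuous_on_charts:
  fixes \<A> :: "('n::finite, 'p::{t2_space,second_countable_topology}) atlas"
  assumes at: "smooth_atlas \<A>" and Y: "\<And>V \<psi>. (V, \<psi>) \<in> \<A> \<Longrightarrow> continuous_on V (Y \<circ> \<psi>)"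
  shows "continuous_on UNIV Y"
proof -
  have "isCont Y p" for p
  proof -
    obtain V \<psi> y where c: "(V, \<psi>) \<in> \<A>" "y \<in> V" "\<psi> y = p" by (rule chart_cover[OF at])
    note f = chart_facts[OF at c(1)]
    have "continuous_on (\<psi> ` V) (\<lambda>q. (Y \<circ> \<psi>) (inv_into V \<psi> q))"
      by (rule continuous_on_compose2[OF Y[OF c(1)] f(5)])
        (auto simp: inv_into_into)
    then have "continuous_on (\<psi> ` V) Y"
      by (rule continuous_on_eq) (simp add: f_inv_into_f)
    then show ?thesis using f(2) c by (auto simp: continuous_on_eq_continuous_at)
  qed
  then show ?thesis by (simp add: continuous_on_eq_continuous_at)
qed

lemma smooth_map_continuous:
  fixes \<A> :: "('n::finite, 'p::{t2_space,second_countable_topology}) atlas"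
  assumes "smooth_atlas \<A>" "smooth_map \<A> Y"
  shows "continuous_on UNIV Y"
  by (rule continuous_on_charts[OF assms(1) smooth_on_imp_continuous[OF smooth_map_chart[OF assms(2)]]])

section \<open>Integration against the area measure inside one chart\<close>

context
  fixes \<A> :: "('n::finite, 'p::{t2_space,second_countable_topology}) atlas" and Y :: "'p \<Rightarrow> 'b::real_inner"
    and V \<psi> and B :: "'p set" and f :: "'b \<Rightarrow> real"
  assumes at: "smooth_atlas \<A>" and Y: "smooth_map \<A> Y" and c: "(V, \<psi>) \<in> \<A>"
    and B: "B \<in> sets borel" "B \<subseteq> \<psi> ` V"
begin

text \<open>Image measures need a map that is measurable on the whole space. The value
  \<open>p0\<close> outside \<open>V\<close> is arbitrary, because the density used with it vanishes
  there.\<close>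

lemma chart_extension_measurable: "(\<lambda>y. if y \<in> V then \<psi> y else p0) \<in> borel_measurable borel"
  using chart_facts[OF at c] by (intro borel_measurable_continuous_on_if) auto

text \<open>Stated as an equality of measures, so that nonnegative and Bochner integrals both
  transfer to the chart through the rules for image measures and densities.\<close>

lemma area_measure_chart:
  "density (area_measure \<A> Y) (indicator B) =
   distr (density lborel (\<lambda>y. ennreal (area_density Y \<psi> y) * indicator (V \<inter> \<psi> -` B) y)) borel
     (\<lambda>y. if y \<in> V then \<psi> y else p0)"
proof (rule measure_eqI)
  let ?e = "\<lambda>y. if y \<in> V then \<psi> y else p0"
  let ?d = "\<lambda>y. ennreal (area_density Y \<psi> y) * indicator (V \<inter> \<psi> -` B) y"
  note area = area_measure[OF at Y, unfolded is_area_measure_def]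
  have d: "?d \<in> borel_measurable borel" by (rule area_density_measurable[OF Y at c B(1)])
  have sets: "sets (area_measure \<A> Y) = sets borel" using area by simp
  then show "sets (density (area_measure \<A> Y) (indicator B)) = sets (distr (density lborel ?d) borel ?e)" by simp
  fix A assume "A \<in> sets (density (area_measure \<A> Y) (indicator B))"
  then have A: "A \<in> sets borel" using sets by simp
  have "emeasure (density (area_measure \<A> Y) (indicator B)) A = emeasure (area_measure \<A> Y) (A \<inter> B)"
  proof -
    have AB: "A \<in> sets (area_measure \<A> Y)" "B \<in> sets (area_measure \<A> Y)" using A B sets by auto
    then have "emeasure (density (area_measure \<A> Y) (indicator B)) A =
        (\<integral>\<^sup>+p. indicator B p * indicator A p \<partial>area_measure \<A> Y)"
      by (intro emeasure_density) simp_all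
    also have "\<dots> = (\<integral>\<^sup>+p. indicator (A \<inter> B) p \<partial>area_measure \<A> Y)"
      by (intro nn_integral_cong) (auto simp: indicator_def)
    also have "\<dots> = emeasure (area_measure \<A> Y) (A \<inter> B)"
      using AB by (intro nn_integral_indicator) simp
    finally show ?thesis .
  qed
  also have "\<dots> = (\<integral>\<^sup>+ y\<in>(V \<inter> \<psi> -` (A \<inter> B)). ennreal (area_density Y \<psi> y) \<partial>lborel)"
    using A B by (intro is_area_measureD[OF area_measure[OF at Y] c]) auto
  also have "\<dots> = (\<integral>\<^sup>+ y\<in>?e -` A. ?d y \<partial>lborel)"
    by (intro nn_integral_cong) (auto simp: indicator_def)
  also have "\<dots> = emeasure (distr (density lborel ?d) borel ?e) A"
  proof -
    have m: "?e -` A \<in> sets borel" using measurable_sets[OF chart_extension_measurable A] by simp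
    have "emeasure (distr (density lborel ?d) borel ?e) A = emeasure (density lborel ?d) (?e -` A)"
      using A chart_extension_measurable by (subst emeasure_distr) simp_all
    also have "\<dots> = (\<integral>\<^sup>+ y\<in>?e -` A. ?d y \<partial>lborel)"
      using d m by (intro emeasure_density) simp_all
    finally show ?thesis by simp
  qed
  finally show "emeasure (density (area_measure \<A> Y) (indicator B)) A = emeasure (distr (density lborel ?d) borel ?e) A" .
qed

lemma nn_integral_area_chart:
  assumes h: "h \<in> borel_measurable borel"
  shows "(\<integral>\<^sup>+p\<in>B. h p \<partial>area_measure \<A> Y) =
    (\<integral>\<^sup>+y\<in>(V \<inter> \<psi> -` B). (ennreal (area_density Y \<psi> y) * h (\<psi> y)) \<partial>lborel)"
proof -
  let ?e = "\<lambda>y. if y \<in> V then \<psi> y else undefined"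
  let ?d = "\<lambda>y. ennreal (area_density Y \<psi> y) * indicator (V \<inter> \<psi> -` B) y"
  have sets: "sets (area_measure \<A> Y) = sets borel"
    using area_measure[OF at Y] by (simp add: is_area_measure_def)
  have d: "?d \<in> borel_measurable borel" by (rule area_density_measurable[OF Y at c B(1)])
  have "(\<integral>\<^sup>+p\<in>B. h p \<partial>area_measure \<A> Y) = (\<integral>\<^sup>+p. h p \<partial>density (area_measure \<A> Y) (indicator B))"
  proof -
    have "B \<in> sets (area_measure \<A> Y)" using B sets by simp
    moreover have "h \<in> borel_measurable (area_measure \<A> Y)" using h by (simp add: measurable_cong_sets[OF sets])
    ultimately show ?thesis by (subst nn_integral_density) (simp_all add: mult.commute)
  qed
  also have "\<dots> = (\<integral>\<^sup>+y. h (?e y) \<partial>density lborel ?d)"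
    unfolding area_measure_chart[of undefined]
    by (rule nn_integral_distr) (use chart_extension_measurable h in auto)
  also have "\<dots> = (\<integral>\<^sup>+y. ?d y * h (?e y) \<partial>lborel)"
    by (rule nn_integral_density) (use d measurable_compose[OF chart_extension_measurable h] in auto)
  also have "\<dots> = (\<integral>\<^sup>+y\<in>(V \<inter> \<psi> -` B). (ennreal (area_density Y \<psi> y) * h (\<psi> y)) \<partial>lborel)"
    by (intro nn_integral_cong) (auto simp: indicator_def)
  finally show ?thesis .
qed

end

lemma weighted_area_measure_emeasure:
  fixes \<A> :: "('n::finite, 'p::{t2_space,second_countable_topology}) atlas" and f :: "'b::real_inner \<Rightarrow> real"
  assumes at: "smooth_atlas \<A>" and Y: "smooth_map \<A> Y" and c: "(V, \<psi>) \<in> \<A>"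
    and B: "B \<in> sets borel" "B \<subseteq> \<psi> ` V" and f: "continuous_on UNIV f"
  shows "emeasure (weighted_area_measure \<A> f Y) B =
    (\<integral>\<^sup>+y. ennreal (indicator (V \<inter> \<psi> -` B) y * (area_density Y \<psi> y * exp (f (Y (\<psi> y))))) \<partial>lborel)"
proof -
  have sets: "sets (area_measure \<A> Y) = sets borel"
    using area_measure[OF at Y] by (simp add: is_area_measure_def)
  have "(\<lambda>p. f (Y p)) \<in> borel_measurable borel"
    using continuous_on_compose2[OF f smooth_map_continuous[OF at Y]] by (intro borel_measurable_continuous_onI) auto
  then have m: "(\<lambda>p. ennreal (exp (f (Y p)))) \<in> borel_measurable borel" by measurable
  have "emeasure (weighted_area_measure \<A> f Y) B = (\<integral>\<^sup>+p\<in>B. ennreal (exp (f (Y p))) \<partial>area_measure \<A> Y)"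
    unfolding weighted_area_measure_def using m B by (subst emeasure_density) (simp_all add: sets measurable_cong_sets[OF sets])
  also have "\<dots> = (\<integral>\<^sup>+y\<in>(V \<inter> \<psi> -` B). (ennreal (area_density Y \<psi> y) * ennreal (exp (f (Y (\<psi> y))))) \<partial>lborel)"
    by (rule nn_integral_area_chart[OF at Y c B m])
  also have "\<dots> = (\<integral>\<^sup>+y. ennreal (indicator (V \<inter> \<psi> -` B) y * (area_density Y \<psi> y * exp (f (Y (\<psi> y))))) \<partial>lborel)"
    by (intro nn_integral_cong) (auto simp: indicator_def ennreal_mult'')
  finally show ?thesis .
qed

lemma weighted_area_measure_sets:
  fixes \<A> :: "('n::finite, 'p::{t2_space,second_countable_topology}) atlas"
  assumes "smooth_atlas \<A>" "smooth_map \<A> Y"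
  shows "sets (weighted_area_measure \<A> f Y) = sets borel"
  using area_measure[OF assms] by (simp add: is_area_measure_def weighted_area_measure_def)

lemma weighted_area_measure_integral:
  fixes \<A> :: "('n::finite, 'p::{t2_space,second_countable_topology}) atlas" and f :: "'b::real_inner \<Rightarrow> real"
    and h :: "'p \<Rightarrow> real"
  assumes at: "smooth_atlas \<A>" and Y: "smooth_map \<A> Y" and c: "(V, \<psi>) \<in> \<A>"
    and B: "B \<in> sets borel" "B \<subseteq> \<psi> ` V" and f: "continuous_on UNIV f" and h: "h \<in> borel_measurable borel"
  shows "(LINT p|weighted_area_measure \<A> f Y. indicator B p * h p) =
      (LINT y|lborel. indicator (V \<inter> \<psi> -` B) y * (area_density Y \<psi> y * exp (f (Y (\<psi> y))) * h (\<psi> y)))"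
    and "integrable (weighted_area_measure \<A> f Y) (\<lambda>p. indicator B p * h p) \<longleftrightarrow>
      integrable lborel (\<lambda>y. indicator (V \<inter> \<psi> -` B) y * (area_density Y \<psi> y * exp (f (Y (\<psi> y))) * h (\<psi> y)))"
proof -
  let ?\<mu> = "area_measure \<A> Y" and ?e = "\<lambda>y. if y \<in> V then \<psi> y else undefined"
  let ?d = "\<lambda>y. ennreal (area_density Y \<psi> y) * indicator (V \<inter> \<psi> -` B) y"
  let ?d' = "\<lambda>y. indicator (V \<inter> \<psi> -` B) y * area_density Y \<psi> y"
  let ?w = "\<lambda>p. exp (f (Y p))"
  have sets: "sets ?\<mu> = sets borel" using area_measure[OF at Y] by (simp add: is_area_measure_def)
  note ms = measurable_cong_sets[OF sets refl]
  have "(\<lambda>p. f (Y p)) \<in> borel_measurable borel"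
    using continuous_on_compose2[OF f smooth_map_continuous[OF at Y]] by (intro borel_measurable_continuous_onI) auto
  then have w: "?w \<in> borel_measurable borel" by measurable
  have e: "?e \<in> borel_measurable borel" by (rule chart_extension_measurable[OF at Y c B])
  have wh: "(\<lambda>p. ?w p * h p) \<in> borel_measurable borel" using w h by measurable
  have dd: "?d = (\<lambda>y. ennreal (?d' y))" by (auto simp: fun_eq_iff indicator_def)
  have dnn: "0 \<le> ?d' y" for y
    using det_gram_nonneg[OF smooth_map_differentiable[OF Y c]] by (auto simp: indicator_def area_density_def)
  have "continuous_on (V \<inter> \<psi> -` B) (area_density Y \<psi>)"
    by (rule continuous_on_subset[OF area_density_continuous[OF Y at c]]) simp
  from borel_measurable_continuous_on_indicator[OF chart_preimage_borel[OF at c B(1)] this]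
  have d: "?d' \<in> borel_measurable borel" by simp
  have eq: "?d' y * (?w (?e y) * h (?e y)) =
     indicator (V \<inter> \<psi> -` B) y * (area_density Y \<psi> y * exp (f (Y (\<psi> y))) * h (\<psi> y))" for y
    by (auto simp: indicator_def)
  have dens: "density ?\<mu> (indicator B) = density ?\<mu> (\<lambda>p. ennreal (indicator B p))"
    by (simp add: ennreal_indicator)
  have "(LINT p|weighted_area_measure \<A> f Y. indicator B p * h p) = (LINT p|?\<mu>. ?w p * (indicator B p * h p))"
    unfolding weighted_area_measure_def using w h B by (subst integral_density) (auto simp: ms)
  also have "\<dots> = (LINT p|?\<mu>. indicator B p * (?w p * h p))" by (simp add: mult_ac)
  also have "\<dots> = (LINT p|density ?\<mu> (indicator B). ?w p * h p)"
    unfolding dens using wh B by (subst integral_density) (auto simp: ms)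
  also have "\<dots> = (LINT y|density lborel ?d. ?w (?e y) * h (?e y))"
    unfolding area_measure_chart[OF at Y c B, of undefined] by (rule integral_distr) (use e wh in auto)
  also have "\<dots> = (LINT y|lborel. ?d' y * (?w (?e y) * h (?e y)))"
    unfolding dd using d dnn measurable_compose[OF e wh] by (subst integral_density) auto
  finally show "(LINT p|weighted_area_measure \<A> f Y. indicator B p * h p) =
      (LINT y|lborel. indicator (V \<inter> \<psi> -` B) y * (area_density Y \<psi> y * exp (f (Y (\<psi> y))) * h (\<psi> y)))"
    unfolding eq .
  have "integrable (weighted_area_measure \<A> f Y) (\<lambda>p. indicator B p * h p) \<longleftrightarrow> integrable ?\<mu> (\<lambda>p. ?w p * (indicator B p * h p))"
    unfolding weighted_area_measure_def using w h B by (subst integrable_density) (auto simp: ms)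
  also have "\<dots> \<longleftrightarrow> integrable ?\<mu> (\<lambda>p. indicator B p * (?w p * h p))" by (simp add: mult_ac)
  also have "\<dots> \<longleftrightarrow> integrable (density ?\<mu> (indicator B)) (\<lambda>p. ?w p * h p)"
    unfolding dens using wh B by (subst integrable_density) (auto simp: ms)
  also have "\<dots> \<longleftrightarrow> integrable (density lborel ?d) (\<lambda>y. ?w (?e y) * h (?e y))"
    unfolding area_measure_chart[OF at Y c B, of undefined] by (rule integrable_distr_eq) (use e wh in auto)
  also have "\<dots> \<longleftrightarrow> integrable lborel (\<lambda>y. ?d' y * (?w (?e y) * h (?e y)))"
    unfolding dd using d dnn measurable_compose[OF e wh] by (subst integrable_density) auto
  finally show "integrable (weighted_area_measure \<A> f Y) (\<lambda>p. indicator B p * h p) \<longleftrightarrow>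
      integrable lborel (\<lambda>y. indicator (V \<inter> \<psi> -` B) y * (area_density Y \<psi> y * exp (f (Y (\<psi> y))) * h (\<psi> y)))"
    unfolding eq .
qed

section \<open>Differentiation under the integral sign\<close>

lemma integrable_continuous_compact:
  fixes g :: "'a::euclidean_space \<Rightarrow> real"
  assumes g: "continuous_on C g" and C: "compact C" and S: "S \<in> sets borel" "S \<subseteq> C"
  shows "integrable lborel (\<lambda>y. indicator S y * g y)"
proof -
  have Sf: "emeasure lborel S < \<infinity>"
    using S C compact_imp_bounded bounded_subset emeasure_bounded_finite by blast
  obtain B where B: "\<And>y. y \<in> C \<Longrightarrow> norm (g y) \<le> B"
    using compact_imp_bounded[OF compact_continuous_image[OF g C]] unfolding bounded_iff by auto
  have "(\<lambda>y. indicator S y *\<^sub>R g y) \<in> borel_measurable lborel"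
    using borel_measurable_continuous_on_indicator[OF S(1) continuous_on_subset[OF g S(2)]] by simp
  from integrableI_bounded_set_indicator[OF _ this Sf, of B] S B
  have "integrable lborel (\<lambda>y. indicator S y *\<^sub>R (indicator S y *\<^sub>R g y))" by (auto simp: indicator_def)
  moreover have "(\<lambda>y. indicator S y *\<^sub>R (indicator S y *\<^sub>R g y)) = (\<lambda>y. indicator S y * g y)"
    by (auto simp: fun_eq_iff indicator_def)
  ultimately show ?thesis by simp
qed

text \<open>Dominated convergence for difference quotients: near time zero the time derivative is
  bounded on a compact product set, and the mean value inequality makes that bound dominate the
  quotients.\<close>

lemma differentiable_under_integral:
  fixes a :: "real \<times> 'a::euclidean_space \<Rightarrow> real"
  assumes O: "open R" "C_k_on (Suc 0) R a" and C: "compact C" "{0} \<times> C \<subseteq> R"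
    and S: "S \<in> sets borel" "S \<subseteq> C"
  defines "a' \<equiv> \<lambda>y. frechet_derivative a (at (0, y)) (1, 0)"
  shows "\<forall>\<^sub>F t in nhds 0. integrable lborel (\<lambda>y. indicator S y * a (t, y))"
    and "integrable lborel (\<lambda>y. indicator S y * a' y)"
    and "((\<lambda>t. LINT y|lborel. indicator S y * a (t, y)) has_real_derivative
      (LINT y|lborel. indicator S y * a' y)) (at 0)"
proof -
  have C0: "compact ({0::real} \<times> C)" using C by (intro compact_Times) auto
  \<comment> \<open>\<open>continuous_near_compact\<close> is applied to a constant function because
    only its first conclusion is wanted: a uniform neighbourhood of the compact slice inside
    \<open>R\<close>.\<close>
  obtain d where d: "0 < d" "\<And>x x'. x \<in> {0} \<times> C \<Longrightarrow> dist x' x < d \<Longrightarrow> x' \<in> R \<and> dist (0::real) 0 < 1"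
    by (rule continuous_near_compact[OF O(1) continuous_on_const[of R "0::real"] C0 C(2), of 1]) (simp, rule that)
  define \<delta> where "\<delta> = d / 2"
  have \<delta>: "0 < \<delta>" using d by (simp add: \<delta>_def)
  have inR: "(t, y) \<in> R" if "\<bar>t\<bar> \<le> \<delta>" "y \<in> C" for t y
    using d(2)[of "(0, y)" "(t, y)"] that d(1) by (simp add: \<delta>_def dist_Pair_Pair)
  have Kc: "compact ({-\<delta>..\<delta>} \<times> C)" using C by (intro compact_Times) auto
  have KR: "{-\<delta>..\<delta>} \<times> C \<subseteq> R" using inR by (auto simp: abs_le_iff)
  have "continuous_on ({-\<delta>..\<delta>} \<times> C) (\<lambda>x. frechet_derivative a (at x) (1, 0))"
    by (rule continuous_on_subset[OF _ KR]) (use O(2) in simp)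
  from compact_imp_bounded[OF compact_continuous_image[OF this Kc]]
  obtain M where M: "0 < M" "\<And>x. x \<in> {-\<delta>..\<delta>} \<times> C \<Longrightarrow> norm (frechet_derivative a (at x) (1, 0)) \<le> M"
    unfolding bounded_pos by auto
  have ad: "((\<lambda>t. a (t, y)) has_vector_derivative frechet_derivative a (at (t, y)) (1, 0)) (at t)"
    if "\<bar>t\<bar> \<le> \<delta>" "y \<in> C" for t y
  proof -
    have "((\<lambda>t. (t, y)) has_derivative (\<lambda>h. h *\<^sub>R (1, 0))) (at t)"
      by (auto intro!: derivative_eq_intros)
    from has_derivative_compose[OF this, where g = a, OF C_k_on_SucD[OF O(2) inR[OF that]]]
    have "((\<lambda>t. a (t, y)) has_derivative (\<lambda>h. frechet_derivative a (at (t, y)) (h *\<^sub>R (1, 0)))) (at t)" .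
    then show ?thesis
      unfolding has_vector_derivative_def
      by (rule has_derivative_eq_rhs)
        (rule ext, rule linear_cmul[OF has_derivative_linear[OF C_k_on_SucD[OF O(2) inR[OF that]]]])
  qed
  have bound: "\<bar>a (t, y) - a (0, y)\<bar> \<le> M * \<bar>t\<bar>" if "\<bar>t\<bar> \<le> \<delta>" "y \<in> C" for t y
  proof -
    have "norm (a (t, y) - a (0, y)) \<le> M * \<bar>t - 0\<bar>"
    proof (rule vector_derivative_mean_bound[where S = "{-\<delta>..\<delta>}" and e = "\<lambda>t. a (t, y)"
            and e' = "\<lambda>t. frechet_derivative a (at (t, y)) (1, 0)"])
      show "((\<lambda>t. a (t, y)) has_vector_derivative frechet_derivative a (at (s, y)) (1, 0)) (at s within {-\<delta>..\<delta>})"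
        if "s \<in> {-\<delta>..\<delta>}" for s
        by (rule has_vector_derivative_at_within, rule ad) (use that \<open>y \<in> C\<close> in \<open>simp_all add: abs_le_iff\<close>)
      show "norm (frechet_derivative a (at (s, y)) (1, 0)) \<le> M" if "s \<in> {-\<delta>..\<delta>}" for s
        by (rule M(2)) (use that \<open>y \<in> C\<close> in simp)
      show "t \<in> {-\<delta>..\<delta>}" using that(1) by (simp add: abs_le_iff)
      show "0 \<in> {-\<delta>..\<delta>}" using \<delta> by simp
    qed (rule convex_real_interval)
    then show ?thesis by simp
  qed
  have int: "integrable lborel (\<lambda>y. indicator S y * g y)" if "continuous_on C g" for g :: "'a \<Rightarrow> real"
    by (rule integrable_continuous_compact[OF that C(1) S])
  have ac: "continuous_on C (\<lambda>y. a (t, y))" if "\<bar>t\<bar> \<le> \<delta>" for t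
    by (rule continuous_on_compose2[OF C_k_on_imp_continuous[OF O(2)]])
      (use inR that in \<open>auto intro!: continuous_intros\<close>)
  have it: "integrable lborel (\<lambda>y. indicator S y * a (t, y))" if "\<bar>t\<bar> \<le> \<delta>" for t
    by (rule int[OF ac[OF that]])
  then show "\<forall>\<^sub>F t in nhds 0. integrable lborel (\<lambda>y. indicator S y * a (t, y))"
    using \<delta> by (auto simp: eventually_nhds_metric dist_real_def intro!: exI[of _ \<delta>])
  have "continuous_on R (\<lambda>x. frechet_derivative a (at x) (1, 0))" using O(2) by simp
  then have a'c: "continuous_on C a'"
    unfolding a'_def by (rule continuous_on_compose2) (use C in \<open>auto intro!: continuous_intros\<close>)
  then show ia': "integrable lborel (\<lambda>y. indicator S y * a' y)" by (rule int)
  show "((\<lambda>t. LINT y|lborel. indicator S y * a (t, y)) has_real_derivative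
      (LINT y|lborel. indicator S y * a' y)) (at 0)"
    unfolding has_field_derivative_iff tendsto_at_iff_sequentially
  proof (intro allI impI)
    fix T :: "nat \<Rightarrow> real" assume T: "\<forall>i. T i \<in> UNIV - {0}" "T \<longlonglongrightarrow> 0"
    let ?q = "\<lambda>t. ((LINT y|lborel. indicator S y * a (t, y)) - (LINT y|lborel. indicator S y * a (0, y))) / (t - 0)"
    have "\<forall>\<^sub>F i in sequentially. \<bar>T i\<bar> < \<delta>"
      using order_tendstoD(2)[OF tendsto_rabs_zero[OF T(2)] \<delta>] .
    then obtain n where n: "\<And>i. n \<le> i \<Longrightarrow> \<bar>T i\<bar> < \<delta>" by (auto simp: eventually_sequentially)
    \<comment> \<open>Shifting the sequence by \<open>n\<close> places all times within the range
      where the bound is valid, as domination is required for every index.\<close>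
    let ?s = "\<lambda>i y. indicator S y * ((a (T (i + n), y) - a (0, y)) / T (i + n))"
    have Tn: "\<bar>T (i + n)\<bar> \<le> \<delta>" "T (i + n) \<noteq> 0" for i using n[of "i + n"] T(1) by auto
    have si: "integrable lborel (?s i)" for i
      by (rule int) (use Tn[of i] \<delta> in \<open>auto intro!: continuous_intros ac\<close>)
    have lim: "(\<lambda>i. LINT y|lborel. ?s i y) \<longlonglongrightarrow> (LINT y|lborel. indicator S y * a' y)"
    proof (rule integral_dominated_convergence[where w = "\<lambda>y. indicator S y * M"])
      show "integrable lborel (\<lambda>y. indicator S y * M)" by (rule int) auto
      show "AE y in lborel. (\<lambda>i. ?s i y) \<longlonglongrightarrow> indicator S y * a' y"
      proof (rule AE_I2)
        fix y :: 'a
        show "(\<lambda>i. ?s i y) \<longlonglongrightarrow> indicator S y * a' y"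
        proof (cases "y \<in> S")
          case True
          then have "((\<lambda>t. a (t, y)) has_real_derivative a' y) (at 0)"
            using ad[of 0 y] S \<delta> by (auto simp: a'_def has_real_derivative_iff_has_vector_derivative)
          then have "((\<lambda>t. (a (t, y) - a (0, y)) / t) \<longlongrightarrow> a' y) (at 0)"
            by (simp add: has_field_derivative_iff)
          moreover have "filterlim (\<lambda>i. T (i + n)) (at 0) sequentially"
            using LIMSEQ_ignore_initial_segment[OF T(2), of n] Tn by (auto simp: filterlim_at)
          ultimately have "(\<lambda>i. (a (T (i + n), y) - a (0, y)) / T (i + n)) \<longlonglongrightarrow> a' y"
            by (rule filterlim_compose)
          then show ?thesis using True by simp
        qed simp
      qed
      show "AE y in lborel. norm (?s i y) \<le> indicator S y * M" for i
      proof (intro AE_I2)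
        fix y :: 'a
        show "norm (?s i y) \<le> indicator S y * M"
        proof (cases "y \<in> S")
          case True
          then have "\<bar>a (T (i + n), y) - a (0, y)\<bar> \<le> M * \<bar>T (i + n)\<bar>"
            using bound[OF Tn(1)] S by blast
          then show ?thesis using True Tn(2)[of i] by (simp add: field_simps abs_divide)
        qed simp
      qed
    qed (use si ia' in auto)
    have eq: "(LINT y|lborel. ?s i y) = ?q (T (i + n))" for i
    proof -
      have "?s i y = (1 / T (i + n)) * (indicator S y * a (T (i + n), y) - indicator S y * a (0, y))" for y
        by (simp add: field_simps)
      then have "(LINT y|lborel. ?s i y) =
        (1 / T (i + n)) * (LINT y|lborel. indicator S y * a (T (i + n), y) - indicator S y * a (0, y))"
        by (simp only: integral_mult_right_zero)
      then show ?thesis using it[OF Tn(1)[of i]] it[of 0] \<delta> by simp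
    qed
    have "(\<lambda>i. ?q (T (i + n))) \<longlonglongrightarrow> (LINT y|lborel. indicator S y * a' y)"
      using lim unfolding eq .
    then show "(?q \<circ> T) \<longlonglongrightarrow> (LINT y|lborel. indicator S y * a' y)"
      using LIMSEQ_offset[of "?q \<circ> T" n] by (simp add: o_def)
  qed
qed

section \<open>The first variation formula\<close>

text \<open>The vector representing the derivative is unique, so the definite description agrees
  with the one assembled from the basis directions.\<close>

lemma gradient_inner:
  fixes f :: "real^'m \<Rightarrow> real"
  assumes "f differentiable (at x)"
  shows "gradient f x \<bullet> v = frechet_derivative f (at x) v"
proof -
  let ?D = "\<Sum>b\<in>Basis. frechet_derivative f (at x) b *\<^sub>R b"
  have d: "frechet_derivative f (at x) v = v \<bullet> ?D" for v
    using frechet_derivative_Basis[OF assms, of v] by (simp add: inner_sum_right mult.commute)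
  have "(f has_derivative frechet_derivative f (at x)) (at x)"
    using assms frechet_derivative_works by blast
  then have "GDERIV f x :> ?D"
    unfolding gderiv_def by (rule has_derivative_eq_rhs) (rule ext, rule d)
  moreover have "D' = ?D" if "GDERIV f x :> D'" for D'
  proof -
    have "(\<lambda>h. h \<bullet> D') = (\<lambda>h. h \<bullet> ?D)"
      using that \<open>GDERIV f x :> ?D\<close> unfolding gderiv_def by (rule has_derivative_unique)
    then show ?thesis by (intro vector_eq_ldot[THEN iffD1] fun_eq_iff[THEN iffD1])
  qed
  ultimately have g: "gradient f x = ?D" unfolding gradient_def by (rule the_equality)
  show ?thesis unfolding g by (subst inner_commute) (rule d[symmetric])
qed

lemma smooth_on_pair_left: "open V \<Longrightarrow> smooth_on V (\<lambda>y. (t, y))"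
  by (intro smooth_on_Pair smooth_on_const smooth_on_ident)

lemma frechet_derivative_slice:
  assumes "(P has_derivative P') (at (t, y))"
  shows "((\<lambda>y. P (t, y)) has_derivative (\<lambda>v. P' (0, v))) (at y)"
    and "((\<lambda>s. P (s, y)) has_vector_derivative P' (1, 0)) (at t)"
proof -
  have "((\<lambda>y. (t, y)) has_derivative (\<lambda>v. (0, v))) (at y)" by (auto intro!: derivative_eq_intros)
  from has_derivative_compose[OF this, where g = P, OF assms]
  show "((\<lambda>y. P (t, y)) has_derivative (\<lambda>v. P' (0, v))) (at y)" .
  have "((\<lambda>s. (s, y)) has_derivative (\<lambda>h. h *\<^sub>R (1, 0))) (at t)" by (auto intro!: derivative_eq_intros)
  from has_derivative_compose[OF this, where g = P, OF assms]
  have "((\<lambda>s. P (s, y)) has_derivative (\<lambda>h. P' (h *\<^sub>R (1, 0)))) (at t)" .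
  moreover have "(\<lambda>h. P' (h *\<^sub>R (1, 0))) = (\<lambda>h. h *\<^sub>R P' (1, 0))"
    using linear_cmul[OF has_derivative_linear[OF assms]] by blast
  ultimately show "((\<lambda>s. P (s, y)) has_vector_derivative P' (1, 0)) (at t)"
    by (simp only: has_vector_derivative_def)
qed

locale hypersurface =
  fixes \<A> :: "('n::finite, 'p::{t2_space,second_countable_topology}) atlas"
    and X N :: "'p \<Rightarrow> real^'m::finite" and f :: "real^'m \<Rightarrow> real"
  assumes f_smooth: "smooth_on UNIV f" and hyp: "two_sided_proper_hypersurface \<A> X N"
begin

lemma atlas: "smooth_atlas \<A>" and imm: "smooth_immersion \<A> X" and X: "smooth_map \<A> X"
  and N: "smooth_map \<A> N" "norm (N p) = 1" "normal_at \<A> X p (N p)" and card: "CARD('m) = CARD('n) + 1"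
  using hyp unfolding two_sided_proper_hypersurface_def smooth_immersion_def unit_normal_field_def by auto

lemma N_orthogonal:
  assumes "(V, \<psi>) \<in> \<A>" "y \<in> V"
  shows "N (\<psi> y) \<bullet> frechet_derivative (X \<circ> \<psi>) (at y) v = 0"
  using N(3)[of "\<psi> y"] assms unfolding normal_at_def by blast

lemma normal_at_iff:
  assumes c: "(V, \<psi>) \<in> \<A>" "y \<in> V" and w: "normal_at \<A> X (\<psi> y) w"
  shows "w = (w \<bullet> N (\<psi> y)) *\<^sub>R N (\<psi> y)"
proof (rule normal_space_one_dimensional[OF _ _ card N(2)])
  show "linear (frechet_derivative (X \<circ> \<psi>) (at y))"
    by (rule linear_frechet_derivative[OF smooth_map_differentiable[OF X c]])
  show "inj (frechet_derivative (X \<circ> \<psi>) (at y))"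
    using imm c unfolding smooth_immersion_def by blast
  show "N (\<psi> y) \<bullet> frechet_derivative (X \<circ> \<psi>) (at y) v = 0" for v by (rule N_orthogonal[OF c])
  show "w \<bullet> frechet_derivative (X \<circ> \<psi>) (at y) v = 0" for v
    using w c unfolding normal_at_def by blast
qed

text \<open>The density of the first variation with respect to the weighted area, called h in the
  overview.\<close>

definition weighted_curvature :: "'p \<Rightarrow> real" where
  "weighted_curvature p = mean_curvature \<A> X N p + gradient f (X p) \<bullet> N p"

lemma weighted_curvature_chart:
  assumes "(V, \<psi>) \<in> \<A>" "y \<in> V"
  shows "weighted_curvature (\<psi> y) = (\<Sum>i\<in>UNIV. \<Sum>j\<in>UNIV. matrix_inv (gram (X \<circ> \<psi>) y) $ i $ j *
        (partial (N \<circ> \<psi>) i y \<bullet> partial (X \<circ> \<psi>) j y)) + frechet_derivative f (at (X (\<psi> y))) (N (\<psi> y))"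
proof -
  have "f differentiable (at x)" for x
    using smooth_on_has_derivative[OF f_smooth] by (auto simp: differentiable_def)
  then show ?thesis
    unfolding weighted_curvature_def mean_curvature_def
    by (simp add: gradient_inner surface_div_chart[OF atlas imm N(1) assms])
qed

context
  fixes \<epsilon> K F u V \<psi>
  assumes var: "compact_normal_variation \<A> X \<epsilon> K F" and u: "smooth_map \<A> u"
    and speed: "\<And>p. vector_derivative (\<lambda>t. F t p) (at 0) \<bullet> N p = u p"
    and c: "(V, \<psi>) \<in> \<A>"
begin

lemma variation_smooth: "smooth_on ({-\<epsilon><..<\<epsilon>} \<times> V) (\<lambda>(t, y). F t (\<psi> y))"
  using var c unfolding compact_normal_variation_def by blast

lemma variation_eps: "0 < \<epsilon>" and variation_zero: "F 0 = X"
  using var unfolding compact_normal_variation_def by auto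

lemma open_V: "open V" "open ({-\<epsilon><..<\<epsilon>} \<times> V)"
  using chart_facts(1)[OF atlas c] by simp_all

abbreviation (input) "P \<equiv> \<lambda>(t, y). F t (\<psi> y)"

lemma variation_partial:
  assumes "\<bar>t\<bar> < \<epsilon>" "y \<in> V"
  shows "partial (F t \<circ> \<psi>) i y = frechet_derivative P (at (t, y)) (0, axis i 1)"
    and "((\<lambda>s. F s (\<psi> y)) has_vector_derivative frechet_derivative P (at (t, y)) (1, 0)) (at t)"
    and "(F t \<circ> \<psi>) differentiable (at y)"
proof -
  have "(t, y) \<in> {-\<epsilon><..<\<epsilon>} \<times> V" using assms by auto
  note d = smooth_on_has_derivative[OF variation_smooth this]
  have 1: "(F t \<circ> \<psi> has_derivative (\<lambda>v. frechet_derivative P (at (t, y)) (0, v))) (at y)"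
    using frechet_derivative_slice(1)[OF d] by (simp add: o_def)
  then show "(F t \<circ> \<psi>) differentiable (at y)" by (auto simp: differentiable_def)
  show "partial (F t \<circ> \<psi>) i y = frechet_derivative P (at (t, y)) (0, axis i 1)"
    unfolding partial_def using frechet_derivative_at[OF 1] by metis
  show "((\<lambda>s. F s (\<psi> y)) has_vector_derivative frechet_derivative P (at (t, y)) (1, 0)) (at t)"
    using frechet_derivative_slice(2)[OF d] by simp
qed

text \<open>Prescribing the component along \<open>N\<close> fixes the whole velocity, because it is
  normal and the normal space is one-dimensional.\<close>

lemma variation_initial_velocity:
  assumes "y \<in> V"
  shows "frechet_derivative P (at (0, y)) (1, 0) = u (\<psi> y) *\<^sub>R N (\<psi> y)"
proof -
  let ?w = "frechet_derivative P (at (0, y)) (1, 0)"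
  have w: "vector_derivative (\<lambda>s. F s (\<psi> y)) (at 0) = ?w"
    by (rule vector_derivative_at[OF variation_partial(2)]) (use variation_eps assms in auto)
  have "normal_at \<A> (F 0) (\<psi> y) (vector_derivative (\<lambda>s. F s (\<psi> y)) (at 0))"
    using var variation_eps unfolding compact_normal_variation_def by auto
  then have "normal_at \<A> X (\<psi> y) ?w" by (simp add: w variation_zero)
  from normal_at_iff[OF c assms this] show ?thesis
    using speed[of "\<psi> y"] by (simp add: w)
qed

text \<open>Gram determinant of the moving surface, written with spatial derivatives of the
  space-time map so that its joint smoothness in time and position is immediate.\<close>

definition "gram_det = (\<lambda>x. det (\<chi> i j. frechet_derivative P (at x) (0, axis i 1) \<bullet> frechet_derivative P (at x) (0, axis j 1)))"

lemma gram_det: "\<bar>t\<bar> < \<epsilon> \<Longrightarrow> y \<in> V \<Longrightarrow> gram_det (t, y) = det (gram (F t \<circ> \<psi>) y)"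
  by (simp add: gram_det_def gram_def variation_partial)

lemma gram_det_smooth: "smooth_on ({-\<epsilon><..<\<epsilon>} \<times> V) gram_det"
  unfolding gram_det_def
  by (rule smooth_on_det) (auto intro!: smooth_on_inner smooth_on_frechet_derivative variation_smooth open_V)

text \<open>The square root is differentiable only where the determinant is positive. A variation is
  not assumed to consist of immersions; positivity is known at time zero and persists on an open
  set.\<close>

definition "regular_set = {x \<in> {-\<epsilon><..<\<epsilon>} \<times> V. 0 < gram_det x}"

lemma regular_set_open: "open regular_set"
proof -
  have "open ({-\<epsilon><..<\<epsilon>} \<times> V \<inter> gram_det -` {0<..})"
    by (rule continuous_open_preimage[OF smooth_on_imp_continuous[OF gram_det_smooth] open_V(2)]) simp
  moreover have "regular_set = {-\<epsilon><..<\<epsilon>} \<times> V \<inter> gram_det -` {0<..}" by (auto simp: regular_set_def)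
  ultimately show ?thesis by simp
qed

lemma regular_set_zero: "y \<in> V \<Longrightarrow> (0, y) \<in> regular_set"
  using variation_eps immersion_gram_pos[OF imm c] by (simp add: regular_set_def gram_det variation_zero)

definition "weighted_density = (\<lambda>x. sqrt (gram_det x) * exp (f (P x)))"

lemma weighted_density_C_1: "C_k_on (Suc 0) regular_set weighted_density"
proof -
  have sub: "regular_set \<subseteq> {-\<epsilon><..<\<epsilon>} \<times> V" by (auto simp: regular_set_def)
  have "C_k_on (Suc 0) regular_set (\<lambda>x. sqrt (gram_det x))"
    by (rule C_k_on_compose[OF regular_set_open smooth_on_C_k[OF smooth_on_subset[OF gram_det_smooth sub]] C_1_on_sqrt])
      (auto simp: regular_set_def)
  moreover have "C_k_on (Suc 0) regular_set (\<lambda>x. f (P x))"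
    by (rule C_k_on_compose[OF regular_set_open smooth_on_C_k[OF smooth_on_subset[OF variation_smooth sub]]
          smooth_on_C_k[OF f_smooth]]) simp
  then have "C_k_on (Suc 0) regular_set (\<lambda>x. exp (f (P x)))"
    by (rule C_k_on_compose[OF regular_set_open _ C_k_on_exp[of _ UNIV]]) simp
  ultimately show ?thesis unfolding weighted_density_def by (rule C_k_on_mult[OF regular_set_open])
qed

text \<open>Time and space derivatives commute, so this is the spatial derivative of the initial
  velocity u N.\<close>

lemma variation_velocity_partial:
  assumes y: "y \<in> V"
  shows "((\<lambda>t. partial (F t \<circ> \<psi>) i y) has_vector_derivative
     partial (u \<circ> \<psi>) i y *\<^sub>R N (\<psi> y) + u (\<psi> y) *\<^sub>R partial (N \<circ> \<psi>) i y) (at 0)"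
proof -
  let ?Q = "\<lambda>x. frechet_derivative P (at x) (0, axis i 1)" and ?R = "\<lambda>x. frechet_derivative P (at x) (1, 0)"
  have m: "(0, y) \<in> {-\<epsilon><..<\<epsilon>} \<times> V" using y variation_eps by simp
  have Rd: "(?R has_derivative frechet_derivative ?R (at (0, y))) (at (0, y))"
    by (rule smooth_on_has_derivative[OF smooth_on_frechet_derivative[OF variation_smooth] m])
  have "((\<lambda>s. ?Q (s, y)) has_vector_derivative frechet_derivative ?Q (at (0, y)) (1, 0)) (at 0)"
    by (rule frechet_derivative_slice(2)[OF smooth_on_has_derivative[OF smooth_on_frechet_derivative[OF variation_smooth] m]])
  then have 1: "((\<lambda>t. partial (F t \<circ> \<psi>) i y) has_vector_derivative frechet_derivative ?Q (at (0, y)) (1, 0)) (at 0)"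
    by (rule has_vector_derivative_transform_within_open[where S = "{-\<epsilon><..<\<epsilon>}"])
      (use variation_eps y in \<open>auto simp: variation_partial(1)\<close>)
  have comm: "frechet_derivative ?Q (at (0, y)) (1, 0) = frechet_derivative ?R (at (0, y)) (0, axis i 1)"
    by (rule frechet_derivative_commute[OF open_V(2) smooth_on_C_k[OF variation_smooth] m])
  have ud: "(u \<circ> \<psi> has_derivative frechet_derivative (u \<circ> \<psi>) (at y)) (at y)"
    and Nd: "(N \<circ> \<psi> has_derivative frechet_derivative (N \<circ> \<psi>) (at y)) (at y)"
    using smooth_on_has_derivative[OF smooth_map_chart[OF _ c] y] u N(1) by blast+
  have "((\<lambda>y. u (\<psi> y) *\<^sub>R N (\<psi> y)) has_derivative
     (\<lambda>v. u (\<psi> y) *\<^sub>R frechet_derivative (N \<circ> \<psi>) (at y) v + frechet_derivative (u \<circ> \<psi>) (at y) v *\<^sub>R N (\<psi> y))) (at y)"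
    using has_derivative_scaleR[OF ud Nd] by (simp add: o_def)
  then have "((\<lambda>y. ?R (0, y)) has_derivative
     (\<lambda>v. u (\<psi> y) *\<^sub>R frechet_derivative (N \<circ> \<psi>) (at y) v + frechet_derivative (u \<circ> \<psi>) (at y) v *\<^sub>R N (\<psi> y))) (at y)"
    by (rule has_derivative_transform_within_open[OF _ open_V(1) y]) (simp add: variation_initial_velocity)
  from has_derivative_unique[OF this frechet_derivative_slice(1)[OF Rd]]
  have "frechet_derivative ?R (at (0, y)) (0, axis i 1) =
    u (\<psi> y) *\<^sub>R partial (N \<circ> \<psi>) i y + partial (u \<circ> \<psi>) i y *\<^sub>R N (\<psi> y)"
    unfolding partial_def by metis
  with 1 comm show ?thesis by (simp add: add.commute)
qed

text \<open>Terms with derivatives of \<open>u\<close> drop out because \<open>N\<close> is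
  orthogonal to the tangent vectors. Jacobi's formula then gives twice \<open>u\<close> times the
  mean curvature, the square root halves it, and the exponential contributes the derivative of
  \<open>f\<close> along \<open>N\<close>.\<close>

lemma weighted_density_derivative:
  assumes y: "y \<in> V"
  shows "frechet_derivative weighted_density (at (0, y)) (1, 0) =
    weighted_density (0, y) * (u (\<psi> y) * weighted_curvature (\<psi> y))"
proof -
  let ?G = "gram (X \<circ> \<psi>) y"
  let ?\<beta> = "\<lambda>i j. partial (N \<circ> \<psi>) i y \<bullet> partial (X \<circ> \<psi>) j y"
  let ?B = "(\<chi> i j. u (\<psi> y) * (?\<beta> i j + ?\<beta> j i)) :: real^'n^'n"
  let ?H = "\<Sum>i\<in>UNIV. \<Sum>j\<in>UNIV. matrix_inv ?G $ i $ j * ?\<beta> i j"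
  have Gpos: "0 < det ?G" by (rule immersion_gram_pos[OF imm c y])
  have NX: "N (\<psi> y) \<bullet> partial (X \<circ> \<psi>) j y = 0" for j
    unfolding partial_def by (rule N_orthogonal[OF c y])
  have "((\<lambda>t. gram (F t \<circ> \<psi>) y $ i $ j) has_real_derivative ?B $ i $ j) (at 0)" for i j
  proof -
    note bounded_bilinear.has_vector_derivative[OF bounded_bilinear_inner
        variation_velocity_partial[OF y, of i] variation_velocity_partial[OF y, of j]]
    then have "((\<lambda>t. gram (F t \<circ> \<psi>) y $ i $ j) has_vector_derivative
      partial (X \<circ> \<psi>) i y \<bullet> (partial (u \<circ> \<psi>) j y *\<^sub>R N (\<psi> y) + u (\<psi> y) *\<^sub>R partial (N \<circ> \<psi>) j y) +
      (partial (u \<circ> \<psi>) i y *\<^sub>R N (\<psi> y) + u (\<psi> y) *\<^sub>R partial (N \<circ> \<psi>) i y) \<bullet> partial (X \<circ> \<psi>) j y) (at 0)"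
      by (simp add: gram_def variation_zero)
    then show ?thesis
      by (simp add: has_real_derivative_iff_has_vector_derivative inner_add_left inner_add_right NX
          inner_commute[of "partial (X \<circ> \<psi>) i y"] algebra_simps)
  qed
  from Jacobi_formula[of "\<lambda>t. gram (F t \<circ> \<psi>) y", OF this]
  have "((\<lambda>t. det (gram (F t \<circ> \<psi>) y)) has_real_derivative det ?G * trace (matrix_inv ?G ** ?B)) (at 0)"
    using Gpos by (simp add: variation_zero)
  moreover have "trace (matrix_inv ?G ** ?B) = 2 * u (\<psi> y) * ?H"
  proof -
    \<comment> \<open>Symmetry of the inverse Gram matrix makes the two sums coming from the product
      rule equal.\<close>
    have sym: "matrix_inv ?G $ i $ j = matrix_inv ?G $ j $ i" for i j
      by (rule matrix_inv_symmetric) (use Gpos gram_transpose in auto)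
    have "(\<Sum>i\<in>UNIV. \<Sum>j\<in>UNIV. matrix_inv ?G $ i $ j * ?\<beta> j i) = (\<Sum>j\<in>UNIV. \<Sum>i\<in>UNIV. matrix_inv ?G $ i $ j * ?\<beta> j i)"
      by (rule sum.swap)
    also have "\<dots> = ?H" by (intro sum.cong refl) (use sym in metis)
    finally have s: "(\<Sum>i\<in>UNIV. \<Sum>j\<in>UNIV. matrix_inv ?G $ i $ j * ?\<beta> j i) = ?H" .
    have "trace (matrix_inv ?G ** ?B) = (\<Sum>i\<in>UNIV. \<Sum>j\<in>UNIV. u (\<psi> y) * (matrix_inv ?G $ i $ j * ?\<beta> j i + matrix_inv ?G $ i $ j * ?\<beta> i j))"
      by (simp add: trace_def matrix_matrix_mult_def algebra_simps)
    also have "\<dots> = u (\<psi> y) * ((\<Sum>i\<in>UNIV. \<Sum>j\<in>UNIV. matrix_inv ?G $ i $ j * ?\<beta> j i) + ?H)"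
      by (simp only: distrib_left sum.distrib sum_distrib_left)
    finally show ?thesis unfolding s by simp
  qed
  ultimately have g: "((\<lambda>t. det (gram (F t \<circ> \<psi>) y)) has_real_derivative det ?G * (2 * u (\<psi> y) * ?H)) (at 0)"
    by simp
  have gd: "((\<lambda>t. gram_det (t, y)) has_real_derivative det ?G * (2 * u (\<psi> y) * ?H)) (at 0)"
    by (rule has_field_derivative_transform_within_open[OF g, of "{-\<epsilon><..<\<epsilon>}"])
      (use variation_eps y in \<open>auto simp: gram_det\<close>)
  have G0: "gram_det (0, y) = det ?G" using variation_eps y by (simp add: gram_det variation_zero)
  have fd: "(f has_derivative frechet_derivative f (at (X (\<psi> y)))) (at (X (\<psi> y)))"
    by (rule smooth_on_has_derivative[OF f_smooth]) simp
  have "((\<lambda>t. F t (\<psi> y)) has_vector_derivative u (\<psi> y) *\<^sub>R N (\<psi> y)) (at 0)"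
    using variation_partial(2)[of 0 y] variation_eps y by (simp add: variation_initial_velocity)
  then have "((\<lambda>t. f (F t (\<psi> y))) has_derivative
      (\<lambda>h. frechet_derivative f (at (X (\<psi> y))) (h *\<^sub>R u (\<psi> y) *\<^sub>R N (\<psi> y)))) (at 0)"
    unfolding has_vector_derivative_def by (rule has_derivative_compose) (simp add: variation_zero fd)
  then have "((\<lambda>t. f (P (t, y))) has_real_derivative u (\<psi> y) * frechet_derivative f (at (X (\<psi> y))) (N (\<psi> y))) (at 0)"
    by (simp add: linear_cmul[OF has_derivative_linear[OF fd]] has_field_derivative_def mult_ac mult_commute_abs)
  note fd' = this
  have pos: "0 < gram_det (0, y)" using G0 Gpos by simp
  have wd: "weighted_density = (\<lambda>x. sqrt (gram_det x) * exp (f (P x)))" by (rule weighted_density_def)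
  have "((\<lambda>t. weighted_density (t, y)) has_real_derivative
    weighted_density (0, y) * (u (\<psi> y) * weighted_curvature (\<psi> y))) (at 0)"
    unfolding wd
  proof (rule DERIV_cong[OF DERIV_mult[OF DERIV_chain2[OF DERIV_real_sqrt[OF pos] gd] DERIV_fun_exp[OF fd']]])
    have s: "sqrt (det ?G) * sqrt (det ?G) = det ?G" "sqrt (det ?G) \<noteq> 0" using Gpos by simp_all
    have "inverse (sqrt (det ?G)) / 2 * (det ?G * (2 * u (\<psi> y) * ?H)) = sqrt (det ?G) * (u (\<psi> y) * ?H)"
      using s by (simp add: field_simps)
    then show "inverse (sqrt (gram_det (0, y))) / 2 * (det ?G * (2 * u (\<psi> y) * ?H)) * exp (f (P (0, y))) +
        exp (f (P (0, y))) * (u (\<psi> y) * frechet_derivative f (at (X (\<psi> y))) (N (\<psi> y))) * sqrt (gram_det (0, y)) =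
      sqrt (gram_det (0, y)) * exp (f (P (0, y))) * (u (\<psi> y) * weighted_curvature (\<psi> y))"
      unfolding weighted_curvature_chart[OF c y] G0 by (simp add: algebra_simps)
  qed
  moreover have "((\<lambda>t. weighted_density (t, y)) has_vector_derivative
      frechet_derivative weighted_density (at (0, y)) (1, 0)) (at 0)"
    by (rule frechet_derivative_slice(2)[OF C_k_on_SucD[OF weighted_density_C_1 regular_set_zero[OF y]]])
  ultimately show ?thesis
    by (metis has_real_derivative_iff_has_vector_derivative vector_derivative_unique_at)
qed

end

end

lemma chart_open_image:
  fixes \<A> :: "('n::finite, 'p::{t2_space,second_countable_topology}) atlas"
  assumes at: "smooth_atlas \<A>" and c: "(V, \<psi>) \<in> \<A>" and "open U" "U \<subseteq> V"
  shows "open (\<psi> ` U)"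
proof -
  note f = chart_facts[OF at c]
  have "open (\<psi> ` V \<inter> inv_into V \<psi> -` U)"
    by (rule continuous_open_preimage[OF f(5,2) assms(3)])
  moreover have "\<psi> ` V \<inter> inv_into V \<psi> -` U = \<psi> ` U"
    using assms(4) f(3) by (force simp: inv_into_f_f)
  ultimately show ?thesis by simp
qed

text \<open>Disjoint Borel pieces make the area additive; the compact sets \<open>C i\<close> inside
  the chart domains supply the compactness needed to differentiate under the integral. The images of
  the smaller sets \<open>U p\<close>, whose closures stay compact in the charts, form the open
  cover.\<close>

lemma compact_chart_decomposition:
  fixes \<A> :: "('n::finite, 'p::{t2_space,second_countable_topology}) atlas"
  assumes at: "smooth_atlas \<A>" and K: "compact K"
  obtains n :: nat and V \<psi> C B where "\<And>i. i < n \<Longrightarrow> (V i, \<psi> i) \<in> \<A>" "\<And>i. i < n \<Longrightarrow> compact (C i) \<and> C i \<subseteq> V i"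
    "\<And>i. i < n \<Longrightarrow> B i \<in> sets borel \<and> B i \<subseteq> \<psi> i ` C i" "disjoint_family_on B {..<n}" "(\<Union>i<n. B i) = K"
proof -
  have "\<exists>V \<psi> U. (V, \<psi>) \<in> \<A> \<and> open U \<and> compact (closure U) \<and> closure U \<subseteq> V \<and> p \<in> \<psi> ` U" for p
  proof -
    obtain V \<psi> y where c: "(V, \<psi>) \<in> \<A>" "y \<in> V" "\<psi> y = p" by (rule chart_cover[OF at])
    then obtain r where "0 < r" "cball y r \<subseteq> V" using chart_facts(1)[OF at] open_contains_cball by blast
    then show ?thesis using c
      by (intro exI[of _ V] exI[of _ \<psi>] exI[of _ "ball y r"]) auto
  qed
  then obtain V \<psi> U where VU: "\<And>p. (V p, \<psi> p) \<in> \<A> \<and> open (U p) \<and> compact (closure (U p)) \<and> closure (U p) \<subseteq> V p \<and> p \<in> \<psi> p ` U p"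
    by metis
  have UV: "U p \<subseteq> V p" for p using VU closure_subset by blast
  have op: "open (\<psi> p ` U p)" for p using chart_open_image[OF at, of "V p" "\<psi> p" "U p"] VU UV by blast
  have cov: "K \<subseteq> (\<Union>p\<in>K. \<psi> p ` U p)" using VU by blast
  obtain D where D: "D \<subseteq> K" "finite D" "K \<subseteq> (\<Union>p\<in>D. \<psi> p ` U p)"
    by (rule compactE_image[OF K op cov]) (rule that)
  obtain q n where q: "D = q ` {i::nat. i < n}" "inj_on q {i. i < n}"
    using finite_imp_nat_seg_image_inj_on[OF D(2)] by blast
  define G where "G i = \<psi> (q i) ` U (q i)" for i
  define B where "B i = K \<inter> disjointed G i" for i
  have G: "G i \<in> sets borel" for i using op by (simp add: G_def)
  have D': "disjointed G i \<in> sets borel" for i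
    using sets.range_disjointed_sets[of G borel] G by auto
  show thesis
  proof (rule that[of n "\<lambda>i. V (q i)" "\<lambda>i. \<psi> (q i)" "\<lambda>i. closure (U (q i))" B])
    show "B i \<in> sets borel \<and> B i \<subseteq> \<psi> (q i) ` closure (U (q i))" for i
    proof
      show "B i \<in> sets borel" unfolding B_def using D' borel_closed[OF compact_imp_closed[OF K]] by blast
      have "B i \<subseteq> G i" unfolding B_def using disjointed_subset[of G i] by blast
      then show "B i \<subseteq> \<psi> (q i) ` closure (U (q i))"
        unfolding G_def using image_mono[OF closure_subset[of "U (q i)"], of "\<psi> (q i)"] by blast
    qed
    show "disjoint_family_on B {..<n}"
      using disjoint_family_disjointed[of G] unfolding disjoint_family_on_def B_def by blast
    have "K \<subseteq> (\<Union>i<n. G i)" using D(3) by (simp add: q(1) G_def lessThan_def)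
    also have "\<dots> = (\<Union>i<n. disjointed G i)"
      using finite_UN_disjointed_eq[of G n] by (simp add: atLeast0LessThan)
    finally show "(\<Union>i<n. B i) = K" unfolding B_def by blast
  qed (use VU in auto)
qed

context hypersurface
begin

text \<open>Needed for measurability of the integrand and for the openness of the sets where the
  curvature lies below or above a level.\<close>

lemma weighted_curvature_continuous: "continuous_on UNIV weighted_curvature"
proof (rule continuous_on_charts[OF atlas])
  fix V \<psi> assume c: "(V, \<psi>) \<in> \<A>"
  note op = chart_facts(1)[OF atlas c]
  have pc: "continuous_on V (\<lambda>y. partial (Z \<circ> \<psi>) i y)" if "smooth_map \<A> Z" for Z :: "'p \<Rightarrow> real^'m" and i
    unfolding partial_def
    by (rule smooth_on_imp_continuous[OF smooth_on_frechet_derivative[OF smooth_map_chart[OF that c]]])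
  have gc: "continuous_on V (\<lambda>y. gram (X \<circ> \<psi>) y $ i $ j)" for i j
    unfolding gram_def by (simp, intro continuous_intros pc X)
  have dc: "continuous_on V (\<lambda>y. det (gram (X \<circ> \<psi>) y))"
    unfolding det_def by (intro continuous_intros gc)
  have nz: "det (gram (X \<circ> \<psi>) y) \<noteq> 0" if "y \<in> V" for y
    using immersion_gram_pos[OF imm c that] by simp
  have ic: "continuous_on V (\<lambda>y. matrix_inv (gram (X \<circ> \<psi>) y) $ i $ j)" for i j
  proof -
    have "continuous_on V (\<lambda>y. if l = i then axis j 1 $ k else gram (X \<circ> \<psi>) y $ k $ l)" for k l
      by (cases "l = i") (auto intro: gc)
    then have "continuous_on V (\<lambda>y. det (\<chi> k l. if l = i then axis j 1 $ k else gram (X \<circ> \<psi>) y $ k $ l) / det (gram (X \<circ> \<psi>) y))"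
      using nz by (intro continuous_on_divide dc) (auto simp: det_def intro!: continuous_intros)
    then show ?thesis by (rule continuous_on_eq) (simp add: matrix_inv_cramer nz)
  qed
  have Nc: "continuous_on V (\<lambda>y. N (\<psi> y) $ i)" for i
    using smooth_on_imp_continuous[OF smooth_map_chart[OF N(1) c]] by (auto simp: o_def intro!: continuous_intros)
  have Xc: "continuous_on V (\<lambda>y. X (\<psi> y))"
    using smooth_on_imp_continuous[OF smooth_map_chart[OF X c]] by (simp add: o_def)
  have fd: "frechet_derivative f (at x) w = (\<Sum>i\<in>UNIV. w $ i *\<^sub>R partial f i x)" for x w
    using smooth_on_has_derivative[OF f_smooth, of x]
    by (intro frechet_derivative_partial) (auto simp: differentiable_def)
  have "continuous_on UNIV (partial f i)" for i
    unfolding partial_def[abs_def] by (rule smooth_on_imp_continuous[OF smooth_on_frechet_derivative[OF f_smooth]])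
  then have pf: "continuous_on V (\<lambda>y. partial f i (X (\<psi> y)))" for i
    by (rule continuous_on_compose2[OF _ Xc]) simp
  have "continuous_on V (\<lambda>y. (\<Sum>i\<in>UNIV. \<Sum>j\<in>UNIV. matrix_inv (gram (X \<circ> \<psi>) y) $ i $ j *
        (partial (N \<circ> \<psi>) i y \<bullet> partial (X \<circ> \<psi>) j y)) + frechet_derivative f (at (X (\<psi> y))) (N (\<psi> y)))"
    unfolding fd by (intro continuous_intros ic pc Nc pf X N(1))
  then show "continuous_on V (weighted_curvature \<circ> \<psi>)"
    by (rule continuous_on_eq) (simp add: weighted_curvature_chart[OF c])
qed

lemma f_continuous: "continuous_on UNIV f"
  by (rule smooth_on_imp_continuous[OF f_smooth])

text \<open>The area of \<open>K\<close> is, for small times, a finite sum of chart integrals, each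
  differentiated under the integral sign. The variation and the compact set are arbitrary, which is
  what the uniqueness in \<open>first_variation\<close> demands.\<close>

theorem first_variation_formula:
  assumes var: "compact_normal_variation \<A> X \<epsilon> K F" and u: "smooth_map \<A> u"
    and speed: "\<And>p. vector_derivative (\<lambda>t. F t p) (at 0) \<bullet> N p = u p"
  shows "((\<lambda>t. measure (weighted_area_measure \<A> f (F t)) K) has_real_derivative
    (LINT p|weighted_area_measure \<A> f X. u p * weighted_curvature p)) (at 0)"
proof -
  have eps: "0 < \<epsilon>" and K: "compact K" and F0: "F 0 = X"
    using var unfolding compact_normal_variation_def by auto
  have off: "F t p = X p" if "\<bar>t\<bar> < \<epsilon>" "p \<notin> K" for t p
  proof -
    have "t \<in> {-\<epsilon><..<\<epsilon>}" using that(1) by (simp add: abs_less_iff)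
    then show ?thesis using var that(2) unfolding compact_normal_variation_def by blast
  qed
  obtain n :: nat and V \<psi> C B where
    c: "\<And>i. i < n \<Longrightarrow> (V i, \<psi> i) \<in> \<A>" and C: "\<And>i. i < n \<Longrightarrow> compact (C i) \<and> C i \<subseteq> V i" and
    B: "\<And>i. i < n \<Longrightarrow> B i \<in> sets borel \<and> B i \<subseteq> \<psi> i ` C i" and dj: "disjoint_family_on B {..<n}" and un: "(\<Union>i<n. B i) = K"
    by (rule compact_chart_decomposition[OF atlas K]) (rule that)
  have BV: "B i \<subseteq> \<psi> i ` V i" if "i < n" for i using B[OF that] C[OF that] by blast
  define S where "S i = V i \<inter> \<psi> i -` B i" for i
  have S: "S i \<in> sets borel" "S i \<subseteq> C i" if i: "i < n" for i
  proof -
    show "S i \<in> sets borel" unfolding S_def using chart_preimage_borel[OF atlas c[OF i]] B[OF i] by blast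
    show "S i \<subseteq> C i"
    proof
      fix y assume "y \<in> S i"
      then have "y \<in> V i" "\<psi> i y \<in> B i" by (auto simp: S_def)
      then obtain x where x: "x \<in> C i" "\<psi> i y = \<psi> i x" using B[OF i] by blast
      then have "y = x" using chart_facts(3)[OF atlas c[OF i]] C[OF i] \<open>y \<in> V i\<close> by (auto dest: inj_onD)
      with x show "y \<in> C i" by simp
    qed
  qed
  let ?a = "\<lambda>i. weighted_density F (\<psi> i)"
  let ?R = "\<lambda>i. regular_set \<epsilon> F (V i) (\<psi> i)"
  have R: "{0} \<times> C i \<subseteq> ?R i" if "i < n" for i
    using regular_set_zero[OF var u speed c[OF that]] C[OF that] by blast
  note diff = differentiable_under_integral[OF regular_set_open[OF var u speed c] weighted_density_C_1[OF var u speed c]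
      conjunct1[OF C] R S]
  have Fs: "smooth_map \<A> (F t)" if "\<bar>t\<bar> < \<epsilon>" for t
    unfolding smooth_map_def
  proof clarify
    fix W \<phi> assume W: "(W, \<phi>) \<in> \<A>"
    have "smooth_on W (\<lambda>y. (\<lambda>(t, y). F t (\<phi> y)) (t, y))"
      by (rule smooth_on_compose[OF chart_facts(1)[OF atlas W] smooth_on_pair_left[OF chart_facts(1)[OF atlas W]]
            variation_smooth[OF var u speed W]]) (use that in auto)
    then show "smooth_on W (F t \<circ> \<phi>)" by (simp add: o_def)
  qed
  have dens: "indicator (S i) y * ?a i (t, y) =
      indicator (S i) y * (area_density (F t) (\<psi> i) y * exp (f (F t (\<psi> i y))))"
    and nonneg: "0 \<le> indicator (S i) y * ?a i (t, y)" if "i < n" "\<bar>t\<bar> < \<epsilon>" for i t y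
  proof -
    have "?a i (t, y) = area_density (F t) (\<psi> i) y * exp (f (F t (\<psi> i y))) \<and> 0 \<le> ?a i (t, y)" if "y \<in> S i"
    proof -
      have y: "y \<in> V i" using that by (simp add: S_def)
      have "0 \<le> det (gram (F t \<circ> \<psi> i) y)"
        by (rule det_gram_nonneg[OF variation_partial(3)[OF var u speed c[OF \<open>i < n\<close>] \<open>\<bar>t\<bar> < \<epsilon>\<close> y]])
      then show ?thesis
        by (simp add: weighted_density_def[OF var u speed c[OF \<open>i < n\<close>]] area_density_def gram_det[OF var u speed c[OF \<open>i < n\<close>] \<open>\<bar>t\<bar> < \<epsilon>\<close> y])
    qed
    then show "indicator (S i) y * ?a i (t, y) =
      indicator (S i) y * (area_density (F t) (\<psi> i) y * exp (f (F t (\<psi> i y))))"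
      "0 \<le> indicator (S i) y * ?a i (t, y)" by (auto simp: indicator_def)
  qed
  have eq: "measure (weighted_area_measure \<A> f (F t)) K = (\<Sum>i<n. LINT y|lborel. indicator (S i) y * ?a i (t, y))"
    if t: "\<bar>t\<bar> < \<epsilon>" and int: "\<And>i. i < n \<Longrightarrow> integrable lborel (\<lambda>y. indicator (S i) y * ?a i (t, y))" for t
  proof -
    have em: "emeasure (weighted_area_measure \<A> f (F t)) (B i) = ennreal (LINT y|lborel. indicator (S i) y * ?a i (t, y))"
      if i: "i < n" for i
    proof -
      have "emeasure (weighted_area_measure \<A> f (F t)) (B i) = (\<integral>\<^sup>+y. ennreal (indicator (S i) y * ?a i (t, y)) \<partial>lborel)"
        unfolding dens[OF i t] unfolding S_def
        by (rule weighted_area_measure_emeasure[OF atlas Fs[OF t] c[OF i] conjunct1[OF B[OF i]] BV[OF i] f_continuous])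
      also have "\<dots> = ennreal (LINT y|lborel. indicator (S i) y * ?a i (t, y))"
        using nonneg[OF i t] by (intro nn_integral_eq_integral int[OF i]) simp
      finally show ?thesis .
    qed
    have nn: "0 \<le> (LINT y|lborel. indicator (S i) y * ?a i (t, y))" if "i < n" for i
      by (rule Bochner_Integration.integral_nonneg) (rule nonneg[OF that t])
    have "emeasure (weighted_area_measure \<A> f (F t)) K = (\<Sum>i<n. emeasure (weighted_area_measure \<A> f (F t)) (B i))"
      unfolding un[symmetric]
      by (rule sum_emeasure[symmetric]) (use B dj in \<open>auto simp: weighted_area_measure_sets[OF atlas Fs[OF t]]\<close>)
    also have "\<dots> = ennreal (\<Sum>i<n. LINT y|lborel. indicator (S i) y * ?a i (t, y))"
    proof -
      have "(\<Sum>i<n. emeasure (weighted_area_measure \<A> f (F t)) (B i)) =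
          (\<Sum>i<n. ennreal (LINT y|lborel. indicator (S i) y * ?a i (t, y)))"
        by (rule sum.cong) (simp_all only: em lessThan_iff)
      also have "\<dots> = ennreal (\<Sum>i<n. LINT y|lborel. indicator (S i) y * ?a i (t, y))"
        by (rule sum_ennreal) (rule nn, simp)
      finally show ?thesis .
    qed
    finally have "emeasure (weighted_area_measure \<A> f (F t)) K =
      ennreal (\<Sum>i<n. LINT y|lborel. indicator (S i) y * ?a i (t, y))" .
    moreover have "0 \<le> (\<Sum>i<n. LINT y|lborel. indicator (S i) y * ?a i (t, y))"
      by (rule sum_nonneg) (rule nn, simp)
    ultimately show ?thesis by (simp only: measure_def enn2real_ennreal)
  qed
  have "\<forall>\<^sub>F t in nhds 0. \<forall>i\<in>{..<n}. integrable lborel (\<lambda>y. indicator (S i) y * ?a i (t, y))"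
    by (rule eventually_ball_finite) (use diff(1) in auto)
  moreover have "\<forall>\<^sub>F t in nhds 0. \<bar>t\<bar> < \<epsilon>"
    using eps by (auto simp: eventually_nhds_metric dist_real_def)
  \<comment> \<open>The representation holds only for small times, where every piece is integrable;
    a derivative at 0 sees no more.\<close>
  ultimately have ev: "\<forall>\<^sub>F t in nhds 0. measure (weighted_area_measure \<A> f (F t)) K =
      (\<Sum>i<n. LINT y|lborel. indicator (S i) y * ?a i (t, y))"
    by eventually_elim (use eq in auto)
  have der: "((\<lambda>t. \<Sum>i<n. LINT y|lborel. indicator (S i) y * ?a i (t, y)) has_real_derivative
      (\<Sum>i<n. LINT y|lborel. indicator (S i) y * frechet_derivative (?a i) (at (0, y)) (1, 0))) (at 0)"
    by (intro DERIV_sum diff(3)) auto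
  \<comment> \<open>Outside \<open>K\<close> the variation stands still, so \<open>u\<close>
    vanishes there and the integral over the whole manifold is the sum over the pieces of
    \<open>K\<close>.\<close>
  have u0: "u p = 0" if "p \<notin> K" for p
  proof -
    have "((\<lambda>t. F t p) has_vector_derivative 0) (at 0)"
      by (rule has_vector_derivative_transform_within_open[OF has_vector_derivative_const, of "{-\<epsilon><..<\<epsilon>}" _ "X p"])
        (use eps off[OF _ that] in auto)
    then show ?thesis using speed[of p] by (simp add: vector_derivative_at)
  qed
  let ?W = "weighted_area_measure \<A> f X"
  let ?h = "\<lambda>p. u p * weighted_curvature p"
  have hm: "?h \<in> borel_measurable borel"
    using smooth_map_continuous[OF atlas u] weighted_curvature_continuous
    by (intro borel_measurable_continuous_onI continuous_on_mult)
  have S0: "indicator (S i) y * frechet_derivative (?a i) (at (0, y)) (1, 0) =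
     indicator (V i \<inter> \<psi> i -` B i) y * (area_density X (\<psi> i) y * exp (f (X (\<psi> i y))) * ?h (\<psi> i y))" if i: "i < n" for i y
  proof (cases "y \<in> S i")
    case True
    then have y: "y \<in> V i" by (simp add: S_def)
    have "?a i (0, y) = area_density X (\<psi> i) y * exp (f (X (\<psi> i y)))"
      using dens[OF i, of 0 y] eps True by (simp add: F0)
    then show ?thesis
      using weighted_density_derivative[OF var u speed c[OF i] y] True by (simp add: S_def)
  qed (simp add: S_def)
  have wi: "(LINT p|?W. indicator (B i) p * ?h p) = (LINT y|lborel. indicator (S i) y * frechet_derivative (?a i) (at (0, y)) (1, 0))"
    "integrable ?W (\<lambda>p. indicator (B i) p * ?h p)" if i: "i < n" for i
  proof -
    note w = weighted_area_measure_integral[OF atlas X c[OF i] conjunct1[OF B[OF i]] BV[OF i] f_continuous hm]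
    show "(LINT p|?W. indicator (B i) p * ?h p) = (LINT y|lborel. indicator (S i) y * frechet_derivative (?a i) (at (0, y)) (1, 0))"
      unfolding S0[OF i] by (rule w(1))
    show "integrable ?W (\<lambda>p. indicator (B i) p * ?h p)"
    proof (rule iffD2[OF w(2)])
      have "integrable lborel (\<lambda>y. indicator (S i) y * frechet_derivative (?a i) (at (0, y)) (1, 0))"
        by (rule diff(2)) (rule i)+
      then show "integrable lborel (\<lambda>y. indicator (V i \<inter> \<psi> i -` B i) y * (area_density X (\<psi> i) y * exp (f (X (\<psi> i y))) * ?h (\<psi> i y)))"
        unfolding S0[OF i] .
    qed
  qed
  have "?h p = (\<Sum>i<n. indicator (B i) p * ?h p)" for p
  proof (cases "p \<in> K")
    case True
    then have "(\<Sum>i<n. indicator (B i) p :: real) = indicator (\<Union>i<n. B i) p"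
      using dj by (intro indicator_UN_disjoint[symmetric]) auto
    then show ?thesis using True by (simp add: un sum_distrib_right[symmetric])
  qed (simp add: u0)
  then have "(LINT p|?W. ?h p) = (LINT p|?W. (\<Sum>i<n. indicator (B i) p * ?h p))"
    by (intro Bochner_Integration.integral_cong) auto
  also have "\<dots> = (\<Sum>i<n. LINT p|?W. indicator (B i) p * ?h p)"
    by (intro Bochner_Integration.integral_sum wi) auto
  also have "\<dots> = (\<Sum>i<n. LINT y|lborel. indicator (S i) y * frechet_derivative (?a i) (at (0, y)) (1, 0))"
    by (intro sum.cong refl wi) auto
  finally have "(LINT p|?W. ?h p) = (\<Sum>i<n. LINT y|lborel. indicator (S i) y * frechet_derivative (?a i) (at (0, y)) (1, 0))" .
  with der have d: "((\<lambda>t. \<Sum>i<n. LINT y|lborel. indicator (S i) y * ?a i (t, y)) has_real_derivative (LINT p|?W. ?h p)) (at 0)"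
    by simp
  show ?thesis
    using DERIV_cong_ev[OF refl ev refl] d by blast
qed

end

section \<open>Existence of normal variations\<close>

lemma smooth_on_snd_compose:
  fixes g :: "'a::euclidean_space \<Rightarrow> 'b::real_normed_vector"
  assumes "open V" "smooth_on V g"
  shows "smooth_on (UNIV \<times> V :: ('t::real_normed_vector \<times> 'a) set) (\<lambda>x. g (snd x))"
  using assms by (intro smooth_on_compose[OF _ smooth_on_snd]) (auto simp: open_Times)

lemma isCont_eventually_nhds:
  "isCont g x \<Longrightarrow> open A \<Longrightarrow> g x \<in> A \<Longrightarrow> \<forall>\<^sub>F y in nhds x. g y \<in> A"
  unfolding continuous_at_open eventually_nhds by blast

lemma has_vector_derivative_eventually:
  assumes "(g has_vector_derivative v) (at t)" "\<forall>\<^sub>F s in nhds t. g s = h s"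
  shows "(h has_vector_derivative v) (at t)"
proof -
  obtain A where "open A" "t \<in> A" "\<And>s. s \<in> A \<Longrightarrow> g s = h s"
    using assms(2) unfolding eventually_nhds by blast
  then show ?thesis using assms(1) has_vector_derivative_transform_within_open by blast
qed

lemma C_1_on_locally_lipschitz:
  fixes g :: "real \<times> 'a::euclidean_space \<Rightarrow> 'b::real_normed_vector"
  assumes "open S" "C_k_on (Suc 0) S g" "(t0, x0) \<in> S"
  obtains r L where "0 < r" "0 \<le> L" "\<And>t x x'. \<bar>t - t0\<bar> < r \<Longrightarrow> dist x x0 < r \<Longrightarrow> dist x' x0 < r \<Longrightarrow>
    norm (g (t, x) - g (t, x')) \<le> L * norm (x - x')"
proof -
  let ?D = "\<lambda>x. Blinfun (frechet_derivative g (at x))"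
  define L where "L = norm (?D (t0, x0)) + 1"
  have L: "0 \<le> L" by (simp add: L_def)
  have sing: "compact {(t0, x0)}" "{(t0, x0)} \<subseteq> S" using assms(3) by auto
  obtain d where d: "0 < d" "\<And>x x'. x \<in> {(t0, x0)} \<Longrightarrow> dist x' x < d \<Longrightarrow> x' \<in> S \<and> dist (?D x') (?D x) < 1"
    by (rule continuous_near_compact[OF assms(1) C_1_on_continuous_blinfun[OF assms(2)] sing, of 1]) (simp, rule that)
  have inB: "(t, x) \<in> ball (t0, x0) d" if "\<bar>t - t0\<bar> < d / 2" "dist x x0 < d / 2" for t x
  proof -
    have "dist (t, x) (t0, x0) \<le> \<bar>t - t0\<bar> + dist x x0"
      unfolding dist_Pair_Pair dist_real_def using sqrt_sum_squares_le_sum[of "\<bar>t - t0\<bar>" "dist x x0"] by simp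
    then show ?thesis using that by (simp add: dist_commute)
  qed
  show ?thesis
  proof (rule that[of "d / 2" L])
    fix t x x' assume t: "\<bar>t - t0\<bar> < d / 2" and x: "dist x x0 < d / 2" "dist x' x0 < d / 2"
    have "norm (g (t, x) - g (t, x')) \<le> L * norm ((t, x) - (t, x'))"
    proof (rule differentiable_bound[OF convex_ball _ _ inB[OF t x(1)] inB[OF t x(2)]])
      fix z assume "z \<in> ball (t0, x0) d"
      then have z: "z \<in> S" "dist (?D z) (?D (t0, x0)) < 1" using d(2)[of "(t0, x0)" z] by (auto simp: dist_commute)
      note gd = C_k_on_SucD[OF assms(2) z(1)]
      then show "(g has_derivative frechet_derivative g (at z)) (at z within ball (t0, x0) d)"
        by (rule has_derivative_at_withinI)
      have "norm (?D z) \<le> L"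
        using z(2) norm_triangle_ineq2[of "?D z" "?D (t0, x0)"] by (simp add: L_def dist_norm)
      then show "onorm (frechet_derivative g (at z)) \<le> L"
        by (simp add: norm_blinfun.rep_eq bounded_linear_Blinfun_apply[OF has_derivative_bounded_linear[OF gd]])
    qed
    then show "norm (g (t, x) - g (t, x')) \<le> L * norm (x - x')" by (simp add: norm_Pair)
  qed (use d L in auto)
qed

locale hypersurface_speed = hypersurface \<A> X N f
  for \<A> :: "('n::finite, 'p::{t2_space,second_countable_topology}) atlas"
    and X N :: "'p \<Rightarrow> real^'m::finite" and f :: "real^'m \<Rightarrow> real" +
  fixes u :: "'p \<Rightarrow> real"
  assumes u: "smooth_map \<A> u"
begin

text \<open>The linear variation \<open>push\<close> is normal only at time zero. It is made normal by following, on the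
  parameter manifold, the flow of the vector field \<open>drift\<close> that cancels the tangential velocity.\<close>

definition push :: "real \<Rightarrow> 'p \<Rightarrow> real^'m" where
  "push t p = X p + (t * u p) *\<^sub>R N p"

abbreviation push_chart :: "(real^'n \<Rightarrow> 'p) \<Rightarrow> real \<times> (real^'n) \<Rightarrow> real^'m" where
  "push_chart \<psi> \<equiv> \<lambda>(t, y). push t (\<psi> y)"

abbreviation Dpush :: "(real^'n \<Rightarrow> 'p) \<Rightarrow> real \<times> (real^'n) \<Rightarrow> real \<times> (real^'n) \<Rightarrow> real^'m" where
  "Dpush \<psi> x \<equiv> frechet_derivative (push_chart \<psi>) (at x)"

definition push_gram :: "(real^'n \<Rightarrow> 'p) \<Rightarrow> real \<times> (real^'n) \<Rightarrow> real^'n^'n" where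
  "push_gram \<psi> x = (\<chi> i j. Dpush \<psi> x (0, axis i 1) \<bullet> Dpush \<psi> x (0, axis j 1))"

definition push_regular :: "(real^'n) set \<Rightarrow> (real^'n \<Rightarrow> 'p) \<Rightarrow> (real \<times> (real^'n)) set" where
  "push_regular V \<psi> = {x \<in> UNIV \<times> V. det (push_gram \<psi> x) \<noteq> 0}"

text \<open>Cramer's solution of the linear system saying that the velocity
  \<open>Dpush \<psi> x (1, v)\<close> is orthogonal to the coordinate tangent vectors. As a
  quotient of determinants it is visibly smooth in time and position.\<close>

definition drift :: "(real^'n \<Rightarrow> 'p) \<Rightarrow> real \<times> (real^'n) \<Rightarrow> real^'n" where
  "drift \<psi> x = (\<chi> k. det (\<chi> i j. if j = k then (- (Dpush \<psi> x (0, axis i 1) \<bullet> Dpush \<psi> x (1, 0)))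
     else push_gram \<psi> x $ i $ j) / det (push_gram \<psi> x))"

lemma push_zero: "push 0 = X"
  by (simp add: push_def fun_eq_iff)

context
  fixes V \<psi> assumes c: "(V, \<psi>) \<in> \<A>"
begin

lemma V_open: "open V" "open (UNIV \<times> V :: (real \<times> (real^'n)) set)"
  using chart_facts(1)[OF atlas c] by (auto simp: open_Times)

lemma push_chart_smooth: "smooth_on (UNIV \<times> V) (push_chart \<psi>)"
proof -
  have s: "smooth_on (UNIV \<times> V :: (real \<times> _) set) (\<lambda>x. (Y \<circ> \<psi>) (snd x))" if "smooth_map \<A> Y" for Y :: "'p \<Rightarrow> 'z::real_normed_vector"
    by (rule smooth_on_snd_compose[OF V_open(1) smooth_map_chart[OF that c]])
  have "smooth_on (UNIV \<times> V) (\<lambda>x. (X \<circ> \<psi>) (snd x) + (fst x * (u \<circ> \<psi>) (snd x)) *\<^sub>R (N \<circ> \<psi>) (snd x))"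
    by (intro smooth_on_add smooth_on_scaleR smooth_on_mult smooth_on_fst s X u N(1) V_open)
  then show ?thesis by (simp add: push_def case_prod_unfold)
qed

lemma push_chart_derivative:
  "y \<in> V \<Longrightarrow> (push_chart \<psi> has_derivative Dpush \<psi> (t, y)) (at (t, y))"
  by (rule smooth_on_has_derivative[OF push_chart_smooth]) simp

lemma push_linear: "y \<in> V \<Longrightarrow> linear (Dpush \<psi> (t, y))"
  by (rule has_derivative_linear[OF push_chart_derivative])

lemma push_smooth_slice: "y \<in> V \<Longrightarrow> (push t \<circ> \<psi> has_derivative (\<lambda>v. Dpush \<psi> (t, y) (0, v))) (at y)"
  using frechet_derivative_slice(1)[OF push_chart_derivative[of y t]] by (simp add: o_def)

lemma push_gram: "y \<in> V \<Longrightarrow> push_gram \<psi> (t, y) = gram (push t \<circ> \<psi>) y"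
  by (simp add: push_gram_def gram_def partial_def frechet_derivative_at[OF push_smooth_slice, symmetric])

lemma push_time_derivative:
  assumes "y \<in> V" shows "Dpush \<psi> (t, y) (1, 0) = u (\<psi> y) *\<^sub>R N (\<psi> y)"
proof -
  have "((\<lambda>s. push s (\<psi> y)) has_vector_derivative Dpush \<psi> (t, y) (1, 0)) (at t)"
    using frechet_derivative_slice(2)[OF push_chart_derivative[OF assms, of t]] by simp
  moreover have "((\<lambda>s. push s (\<psi> y)) has_vector_derivative u (\<psi> y) *\<^sub>R N (\<psi> y)) (at t)"
    unfolding push_def by (auto intro!: derivative_eq_intros)
  ultimately show ?thesis by (rule vector_derivative_unique_at)
qed

lemma push_regular_open: "open (push_regular V \<psi>)"
proof -
  have "continuous_on (UNIV \<times> V) (\<lambda>x. det (push_gram \<psi> x))"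
    by (rule smooth_on_imp_continuous, rule smooth_on_det)
      (auto simp: push_gram_def intro!: smooth_on_inner smooth_on_frechet_derivative push_chart_smooth V_open)
  from continuous_open_preimage[OF this V_open(2), of "- {0}"]
  have "open ((UNIV \<times> V) \<inter> (\<lambda>x. det (push_gram \<psi> x)) -` (- {0}))" by auto
  moreover have "(UNIV \<times> V) \<inter> (\<lambda>x. det (push_gram \<psi> x)) -` (- {0}) = push_regular V \<psi>"
    by (auto simp: push_regular_def)
  ultimately show ?thesis by simp
qed

lemma push_regular_zero: "y \<in> V \<Longrightarrow> (0, y) \<in> push_regular V \<psi>"
  by (auto simp: push_regular_def push_gram push_zero dest: immersion_gram_pos[OF imm c])

lemma drift_smooth: "smooth_on (push_regular V \<psi>) (drift \<psi>)"
proof -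
  have sub: "push_regular V \<psi> \<subseteq> UNIV \<times> V" by (auto simp: push_regular_def)
  have D: "smooth_on (push_regular V \<psi>) (\<lambda>x. Dpush \<psi> x e)" for e
    by (rule smooth_on_subset[OF smooth_on_frechet_derivative[OF push_chart_smooth] sub])
  have G: "smooth_on (push_regular V \<psi>) (\<lambda>x. push_gram \<psi> x $ i $ j)" for i j
    by (simp add: push_gram_def smooth_on_inner[OF push_regular_open D D])
  have M: "smooth_on (push_regular V \<psi>) (\<lambda>x. (\<chi> i j. if j = k then (- (Dpush \<psi> x (0, axis i 1) \<bullet> Dpush \<psi> x (1, 0)))
     else push_gram \<psi> x $ i $ j) $ i $ j)" for i j k
    by (cases "j = k") (simp_all add: G smooth_on_minus[OF push_regular_open smooth_on_inner[OF push_regular_open D D]])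
  have "smooth_on (push_regular V \<psi>) (\<lambda>x. drift \<psi> x $ k)" for k
    unfolding drift_def vec_lambda_beta
    by (rule smooth_on_divide[OF push_regular_open smooth_on_det[OF push_regular_open M] smooth_on_det[OF push_regular_open G]])
      (simp add: push_regular_def)
  then show ?thesis by (rule smooth_on_vec[OF push_regular_open])
qed

lemma Dpush_split:
  assumes "y \<in> V" shows "Dpush \<psi> (t, y) (1, v) = Dpush \<psi> (t, y) (1, 0) + Dpush \<psi> (t, y) (0, v)"
  using linear_add[OF push_linear[OF assms], of t "(1, 0)" "(0, v)"] by simp

text \<open>The orthogonality conditions are a linear system whose matrix is the Gram matrix,
  invertible on the regular set. This characterization is what makes the field independent of the
  chart.\<close>

lemma drift_unique:
  assumes y: "(t, y) \<in> push_regular V \<psi>"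
  shows "(\<forall>i. Dpush \<psi> (t, y) (1, v) \<bullet> Dpush \<psi> (t, y) (0, axis i 1) = 0) \<longleftrightarrow> v = drift \<psi> (t, y)"
proof -
  have yV: "y \<in> V" and nz: "det (push_gram \<psi> (t, y)) \<noteq> 0" using y by (auto simp: push_regular_def)
  let ?b = "\<chi> i. - (Dpush \<psi> (t, y) (0, axis i 1) \<bullet> Dpush \<psi> (t, y) (1, 0))"
  have diff: "(push t \<circ> \<psi>) differentiable (at y)" using push_smooth_slice[OF yV] by (auto simp: differentiable_def)
  have D: "frechet_derivative (push t \<circ> \<psi>) (at y) w = Dpush \<psi> (t, y) (0, w)" for w
    using frechet_derivative_at[OF push_smooth_slice[OF yV]] by metis
  have "(push_gram \<psi> (t, y) *v v) $ i = Dpush \<psi> (t, y) (0, axis i 1) \<bullet> Dpush \<psi> (t, y) (0, v)" for i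
    unfolding push_gram[OF yV] gram_mult_vec[OF diff] partial_def D ..
  then have "(\<forall>i. Dpush \<psi> (t, y) (1, v) \<bullet> Dpush \<psi> (t, y) (0, axis i 1) = 0) \<longleftrightarrow> push_gram \<psi> (t, y) *v v = ?b"
    by (auto simp: vec_eq_iff Dpush_split[OF yV, of t v] inner_add_left inner_add_right inner_commute add_eq_0_iff)
  also have "\<dots> \<longleftrightarrow> v = drift \<psi> (t, y)"
    unfolding cramer[OF nz] drift_def vec_lambda_beta ..
  finally show ?thesis .
qed

lemma drift_orthogonal:
  assumes y: "(t, y) \<in> push_regular V \<psi>"
  shows "Dpush \<psi> (t, y) (1, drift \<psi> (t, y)) \<bullet> Dpush \<psi> (t, y) (0, w) = 0"
proof -
  have yV: "y \<in> V" using y by (auto simp: push_regular_def)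
  have diff: "(push t \<circ> \<psi>) differentiable (at y)" using push_smooth_slice[OF yV] by (auto simp: differentiable_def)
  have D: "frechet_derivative (push t \<circ> \<psi>) (at y) w = Dpush \<psi> (t, y) (0, w)" for w
    using frechet_derivative_at[OF push_smooth_slice[OF yV]] by metis
  have "Dpush \<psi> (t, y) (0, w) = (\<Sum>i\<in>UNIV. w $ i *\<^sub>R Dpush \<psi> (t, y) (0, axis i 1))"
    using frechet_derivative_partial[OF diff, of w] unfolding partial_def D .
  then show ?thesis using drift_unique[OF y, of "drift \<psi> (t, y)"] by (simp add: inner_sum_right)
qed

end

section \<open>Trajectories of the drift on the parameter manifold\<close>

text \<open>The differential equation is asked for in some chart and at one time only, so a curve
  may pass through many charts; \<open>trajectory_at_chart\<close> shows that any chart around the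
  point would do.\<close>

definition trajectory_at :: "(real \<Rightarrow> 'p) \<Rightarrow> real \<Rightarrow> bool" where
  "trajectory_at \<gamma> t \<longleftrightarrow> (\<exists>V \<psi> c. (V, \<psi>) \<in> \<A> \<and> (\<forall>\<^sub>F s in nhds t. c s \<in> V \<and> \<gamma> s = \<psi> (c s)) \<and>
     (t, c t) \<in> push_regular V \<psi> \<and> (c has_vector_derivative drift \<psi> (t, c t)) (at t))"

text \<open>The transition derivative carries the drift of one chart to a vector with the same
  orthogonality property in the other; by \<open>drift_unique\<close> it is the drift there.\<close>

lemma trajectory_at_chart:
  assumes tr: "trajectory_at \<gamma> t" and W: "(W, \<phi>) \<in> \<A>" "\<gamma> t \<in> \<phi> ` W"
  defines "d \<equiv> \<lambda>s. inv_into W \<phi> (\<gamma> s)"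
  shows "(t, d t) \<in> push_regular W \<phi>" "(d has_vector_derivative drift \<phi> (t, d t)) (at t)"
proof -
  obtain V \<psi> c where V: "(V, \<psi>) \<in> \<A>" and ev: "\<forall>\<^sub>F s in nhds t. c s \<in> V \<and> \<gamma> s = \<psi> (c s)"
    and reg: "(t, c t) \<in> push_regular V \<psi>" and cd: "(c has_vector_derivative drift \<psi> (t, c t)) (at t)"
    using tr unfolding trajectory_at_def by blast
  let ?T = "transition_domain V \<psi> W \<phi>" and ?\<tau> = "transition \<psi> W \<phi>"
  let ?y = "c t" and ?D\<tau> = "frechet_derivative (transition \<psi> W \<phi>) (at (c t))"
  have ct: "c t \<in> V" "\<gamma> t = \<psi> (c t)" using eventually_nhds_x_imp_x[OF ev] by auto
  have yT: "c t \<in> ?T" using ct W by (simp add: transition_domain_def)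
  note op = transition_open[OF atlas V W(1)] and mem = transition_mem[OF atlas V W(1)]
  have cont: "isCont c t" using cd has_vector_derivative_continuous by blast
  have evT: "\<forall>\<^sub>F s in nhds t. c s \<in> ?T"
    by (rule isCont_eventually_nhds[OF cont op yT])
  have evd: "\<forall>\<^sub>F s in nhds t. ?\<tau> (c s) = d s"
    using ev by eventually_elim (simp add: d_def transition_def)
  have dt: "d t = ?\<tau> (c t)" using eventually_nhds_x_imp_x[OF evd] by simp
  have \<tau>d: "(?\<tau> has_derivative ?D\<tau>) (at (c t))"
    using transition_differentiable[OF atlas V W(1) yT] frechet_derivative_works by blast
  have "((\<lambda>s. ?\<tau> (c s)) has_vector_derivative ?D\<tau> (drift \<psi> (t, c t))) (at t)"
    using has_derivative_compose[OF cd[unfolded has_vector_derivative_def] \<tau>d]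
    by (simp add: has_vector_derivative_def linear_cmul[OF has_derivative_linear[OF \<tau>d]])
  then have dd: "(d has_vector_derivative ?D\<tau> (drift \<psi> (t, c t))) (at t)"
    by (rule has_vector_derivative_eventually[OF _ evd])
  have dW: "d t \<in> W" unfolding dt by (rule mem(4)[OF yT])
  have "(push t \<circ> \<phi>) differentiable (at (?\<tau> (c t)))"
    using push_smooth_slice[OF W(1) dW] unfolding dt by (auto simp: differentiable_def)
  from chart_change(1)[OF atlas V W(1) this yT]
  have "det (gram (push t \<circ> \<psi>) (c t)) = (det (matrix ?D\<tau>))\<^sup>2 * det (gram (push t \<circ> \<phi>) (d t))"
    by (simp add: dt det_mul det_transpose power2_eq_square)
  then show regd: "(t, d t) \<in> push_regular W \<phi>"
    using reg dW ct(1) by (auto simp: push_regular_def push_gram[OF V] push_gram[OF W(1)])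
  \<comment> \<open>Locally \<open>push_chart \<psi>\<close> is \<open>push_chart \<phi>\<close>
    after the chart change in the space variable, which leaves time alone.\<close>
  have DD: "Dpush \<psi> (t, c t) (a, v) = Dpush \<phi> (t, d t) (a, ?D\<tau> v)" for a v
  proof -
    have sd: "((\<lambda>x. ?\<tau> (snd x)) has_derivative (\<lambda>h. ?D\<tau> (snd h))) (at (t, c t))"
      by (rule has_derivative_compose[OF has_derivative_snd[OF has_derivative_ident]]) (simp add: \<tau>d)
    have "((\<lambda>x. (fst x, ?\<tau> (snd x))) has_derivative (\<lambda>h. (fst h, ?D\<tau> (snd h)))) (at (t, c t))"
      by (rule has_derivative_Pair[OF has_derivative_fst[OF has_derivative_ident] sd])
    moreover have "(push_chart \<phi> has_derivative Dpush \<phi> (t, d t)) (at (fst (t, c t), ?\<tau> (snd (t, c t))))"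
      using push_chart_derivative[OF W(1) dW, of t] by (simp add: dt)
    ultimately have "((\<lambda>x. push_chart \<phi> (fst x, ?\<tau> (snd x))) has_derivative (\<lambda>h. Dpush \<phi> (t, d t) (fst h, ?D\<tau> (snd h)))) (at (t, c t))"
      by (rule has_derivative_compose)
    then have "(push_chart \<psi> has_derivative (\<lambda>h. Dpush \<phi> (t, d t) (fst h, ?D\<tau> (snd h)))) (at (t, c t))"
      by (rule has_derivative_transform_within_open[where s = "UNIV \<times> ?T"])
        (use op yT mem(2) in \<open>auto simp: open_Times\<close>)
    from fun_cong[OF frechet_derivative_at[OF this], of "(a, v)"] show ?thesis by simp
  qed
  \<comment> \<open>The transition derivative is onto, so testing against its values tests against
    all tangent vectors.\<close>
  have "Dpush \<phi> (t, d t) (1, ?D\<tau> (drift \<psi> (t, c t))) \<bullet> Dpush \<phi> (t, d t) (0, w) = 0" for w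
  proof -
    obtain w' where "w = ?D\<tau> w'" using transition_bij(1)[OF atlas V W(1) yT] by (metis bij_pointE)
    then show ?thesis using drift_orthogonal[OF V reg, of w'] by (simp add: DD)
  qed
  then have "?D\<tau> (drift \<psi> (t, c t)) = drift \<phi> (t, d t)"
    using drift_unique[OF W(1) regd] by blast
  with dd show "(d has_vector_derivative drift \<phi> (t, d t)) (at t)" by simp
qed

lemma trajectory_at_isCont:
  assumes "trajectory_at \<gamma> t"
  shows "isCont \<gamma> t"
proof -
  obtain V \<psi> c where V: "(V, \<psi>) \<in> \<A>" and ev: "\<forall>\<^sub>F s in nhds t. c s \<in> V \<and> \<gamma> s = \<psi> (c s)"
    and cd: "(c has_vector_derivative drift \<psi> (t, c t)) (at t)"
    using assms unfolding trajectory_at_def by blast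
  have ct: "c t \<in> V" using eventually_nhds_x_imp_x[OF ev] by auto
  note f = chart_facts[OF atlas V]
  have "isCont \<psi> (c t)" using f(1,4) ct by (simp add: continuous_on_eq_continuous_at)
  then have "isCont (\<lambda>s. \<psi> (c s)) t"
    using has_vector_derivative_continuous[OF cd] isCont_o2 by blast
  then show ?thesis
    using ev by (subst isCont_cong[of \<gamma> "\<lambda>s. \<psi> (c s)"]) (auto elim: eventually_mono)
qed

text \<open>In a common chart both curves solve one locally Lipschitz equation; after moving
  \<open>t0\<close> to 0, \<open>ode_estimate\<close> with error 0 makes their difference
  vanish.\<close>

lemma trajectories_agree_locally:
  assumes tr: "\<And>t. t \<in> I \<Longrightarrow> trajectory_at \<gamma> t \<and> trajectory_at \<delta> t" and I: "open I" "t0 \<in> I" and eq: "\<gamma> t0 = \<delta> t0"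
  shows "\<forall>\<^sub>F t in nhds t0. \<gamma> t = \<delta> t"
proof -
  obtain W \<phi> y where W: "(W, \<phi>) \<in> \<A>" "y \<in> W" "\<phi> y = \<gamma> t0" by (rule chart_cover[OF atlas])
  note f = chart_facts[OF atlas W(1)]
  have \<gamma>0: "\<gamma> t0 \<in> \<phi> ` W" "\<delta> t0 \<in> \<phi> ` W" using W eq by (metis imageI)+
  have ev: "\<forall>\<^sub>F t in nhds t0. t \<in> I \<and> \<gamma> t \<in> \<phi> ` W \<and> \<delta> t \<in> \<phi> ` W"
  proof -
    have "\<forall>\<^sub>F t in nhds t0. \<gamma> t \<in> \<phi> ` W" "\<forall>\<^sub>F t in nhds t0. \<delta> t \<in> \<phi> ` W"
      using isCont_eventually_nhds[OF trajectory_at_isCont f(2)] tr[OF I(2)] \<gamma>0 by simp_all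
    moreover have "\<forall>\<^sub>F t in nhds t0. t \<in> I" using I by (rule eventually_nhds_in_open)
    ultimately show ?thesis by eventually_elim blast
  qed
  let ?c = "\<lambda>t. inv_into W \<phi> (\<gamma> t)" and ?d = "\<lambda>t. inv_into W \<phi> (\<delta> t)"
  note c0 = trajectory_at_chart[OF conjunct1[OF tr[OF I(2)]] W(1) \<gamma>0(1)]
  note d0 = trajectory_at_chart[OF conjunct2[OF tr[OF I(2)]] W(1) \<gamma>0(2)]
  obtain r L where r: "0 < r" "0 \<le> L" "\<And>t x x'. \<bar>t - t0\<bar> < r \<Longrightarrow> dist x (?c t0) < r \<Longrightarrow> dist x' (?c t0) < r \<Longrightarrow>
      norm (drift \<phi> (t, x) - drift \<phi> (t, x')) \<le> L * norm (x - x')"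
    by (rule C_1_on_locally_lipschitz[OF push_regular_open[OF W(1)] smooth_on_C_k[OF drift_smooth[OF W(1)]] c0(1)]) (rule that)
  have near: "\<forall>\<^sub>F t in nhds t0. dist (?c t) (?c t0) < r" "\<forall>\<^sub>F t in nhds t0. dist (?d t) (?c t0) < r"
  proof -
    have "isCont ?c t0" "isCont ?d t0"
      using has_vector_derivative_continuous[OF c0(2)] has_vector_derivative_continuous[OF d0(2)] by auto
    then show "\<forall>\<^sub>F t in nhds t0. dist (?c t) (?c t0) < r" "\<forall>\<^sub>F t in nhds t0. dist (?d t) (?c t0) < r"
      using isCont_eventually_nhds[of t0 ?c "ball (?c t0) r"] isCont_eventually_nhds[of t0 ?d "ball (?c t0) r"] r(1) eq
      by (simp_all add: dist_commute)
  qed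
  from ev near have "\<forall>\<^sub>F t in nhds t0. (t \<in> I \<and> \<gamma> t \<in> \<phi> ` W \<and> \<delta> t \<in> \<phi> ` W) \<and> dist (?c t) (?c t0) < r \<and> dist (?d t) (?c t0) < r"
    by eventually_elim simp
  then obtain e where e: "0 < e" "\<And>t. dist t t0 < e \<Longrightarrow> (t \<in> I \<and> \<gamma> t \<in> \<phi> ` W \<and> \<delta> t \<in> \<phi> ` W) \<and>
      dist (?c t) (?c t0) < r \<and> dist (?d t) (?c t0) < r"
    unfolding eventually_nhds_metric by blast
  \<comment> \<open>The bounds keep both curves in the chart and in the region of the Lipschitz
    estimate, and give \<open>2 * L * T \<le> 1\<close>; the added 1 covers
    \<open>L = 0\<close>.\<close>
  define T where "T = Min {e, r, 1 / (2 * L + 1)}"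
  have T: "0 < T" "T \<le> e" "T \<le> r" "T \<le> 1 / (2 * L + 1)" using e r by (auto simp: T_def)
  have LT: "2 * L * T \<le> 1"
  proof -
    have "(2 * L + 1) * T \<le> 1" using T(4) r(2) by (simp add: field_simps)
    then show ?thesis using T(1) by (simp add: algebra_simps)
  qed
  have same: "?c (t0 + s) - ?d (t0 + s) = 0" if s: "\<bar>s\<bar> < T" for s
  proof -
    have "norm (?c (t0 + s) - ?d (t0 + s)) \<le> 2 * T * 0"
    proof (rule ode_estimate[where e = "\<lambda>s. ?c (t0 + s) - ?d (t0 + s)" and L = L
          and e' = "\<lambda>s. drift \<phi> (t0 + s, ?c (t0 + s)) - drift \<phi> (t0 + s, ?d (t0 + s))"])
      fix q assume q: "\<bar>q\<bar> < T"
      have "dist (t0 + q) t0 < e" using q T(2) by (simp add: dist_real_def)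
      note eq' = e(2)[OF this]
      note tq = tr[of "t0 + q"]
      have cq: "(?c has_vector_derivative drift \<phi> (t0 + q, ?c (t0 + q))) (at (t0 + q))"
        "(?d has_vector_derivative drift \<phi> (t0 + q, ?d (t0 + q))) (at (t0 + q))"
        using trajectory_at_chart(2)[OF _ W(1), of \<gamma> "t0 + q"] trajectory_at_chart(2)[OF _ W(1), of \<delta> "t0 + q"] tq eq' by auto
      have sh: "((\<lambda>s. h (t0 + s)) has_vector_derivative w) (at q)" if "(h has_vector_derivative w) (at (t0 + q))" for h :: "real \<Rightarrow> real^'n" and w
      proof -
        have "((\<lambda>s. t0 + s) has_vector_derivative 1) (at q)" by (auto intro!: derivative_eq_intros)
        from vector_diff_chain_at[OF this that] show ?thesis by (simp add: o_def)
      qed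
      show "((\<lambda>s. ?c (t0 + s) - ?d (t0 + s)) has_vector_derivative
        drift \<phi> (t0 + q, ?c (t0 + q)) - drift \<phi> (t0 + q, ?d (t0 + q))) (at q)"
        by (rule has_vector_derivative_diff[OF sh[OF cq(1)] sh[OF cq(2)]])
      show "norm (drift \<phi> (t0 + q, ?c (t0 + q)) - drift \<phi> (t0 + q, ?d (t0 + q))) \<le>
        L * norm (?c (t0 + q) - ?d (t0 + q)) + 0"
        using r(3)[of "t0 + q" "?c (t0 + q)" "?d (t0 + q)"] eq' q T(3) by simp
    qed (use eq r(2) LT s in auto)
    then show ?thesis by simp
  qed
  have "\<gamma> t = \<delta> t" if t: "dist t t0 < T" for t
  proof -
    have "?c t = ?d t" using same[of "t - t0"] t by (simp add: dist_real_def)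
    moreover have "dist t t0 < e" using t T(2) by simp
    from e(2)[OF this] have "\<gamma> t \<in> \<phi> ` W" "\<delta> t \<in> \<phi> ` W" by auto
    ultimately show ?thesis by (metis f_inv_into_f)
  qed
  then show ?thesis unfolding eventually_nhds_metric using T(1) by blast
qed

text \<open>The times of agreement form an open set by local uniqueness, the times of disagreement
  one by continuity and the Hausdorff property. The interval is connected and the curves agree at
  0.\<close>

lemma trajectories_unique:
  assumes tr: "\<And>t. \<bar>t\<bar> < T \<Longrightarrow> trajectory_at \<gamma> t \<and> trajectory_at \<delta> t" and eq: "\<gamma> 0 = \<delta> 0" and t: "\<bar>t\<bar> < T"
  shows "\<gamma> t = \<delta> t"
proof -
  let ?I = "{-T<..<T}"
  have tr': "trajectory_at \<gamma> t \<and> trajectory_at \<delta> t" if "t \<in> ?I" for t using tr[of t] that by auto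
  have "open {t \<in> ?I. \<gamma> t = \<delta> t}"
  proof (subst open_subopen, safe)
    fix s assume s: "s \<in> ?I" "\<gamma> s = \<delta> s"
    from trajectories_agree_locally[OF tr' _ s] have "\<forall>\<^sub>F t in nhds s. \<gamma> t = \<delta> t" by simp
    moreover have "\<forall>\<^sub>F t in nhds s. t \<in> ?I" using s(1) by (intro eventually_nhds_in_open) auto
    ultimately have "\<forall>\<^sub>F t in nhds s. t \<in> {t \<in> ?I. \<gamma> t = \<delta> t}" by eventually_elim simp
    then show "\<exists>T'. open T' \<and> s \<in> T' \<and> T' \<subseteq> {t \<in> ?I. \<gamma> t = \<delta> t}" unfolding eventually_nhds by blast
  qed
  moreover have "open {t \<in> ?I. \<gamma> t \<noteq> \<delta> t}"
  proof (subst open_subopen, safe)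
    fix s assume s: "s \<in> ?I" "\<gamma> s \<noteq> \<delta> s"
    obtain A B where AB: "open A" "open B" "\<gamma> s \<in> A" "\<delta> s \<in> B" "A \<inter> B = {}" using hausdorff[OF s(2)] by blast
    have "\<forall>\<^sub>F t in nhds s. \<gamma> t \<in> A" "\<forall>\<^sub>F t in nhds s. \<delta> t \<in> B"
      using isCont_eventually_nhds[OF trajectory_at_isCont AB(1)] isCont_eventually_nhds[OF trajectory_at_isCont AB(2)]
        tr'[OF s(1)] AB(3,4) by simp_all
    moreover have "\<forall>\<^sub>F t in nhds s. t \<in> ?I" using s(1) by (intro eventually_nhds_in_open) auto
    ultimately have "\<forall>\<^sub>F t in nhds s. t \<in> {t \<in> ?I. \<gamma> t \<noteq> \<delta> t}" by eventually_elim (use AB(5) in auto)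
    then show "\<exists>T'. open T' \<and> s \<in> T' \<and> T' \<subseteq> {t \<in> ?I. \<gamma> t \<noteq> \<delta> t}" unfolding eventually_nhds by blast
  qed
  ultimately have "{t \<in> ?I. \<gamma> t = \<delta> t} \<inter> ?I = {} \<or> {t \<in> ?I. \<gamma> t \<noteq> \<delta> t} \<inter> ?I = {}"
    by (intro connectedD[OF connected_Ioo]) auto
  moreover have "0 \<in> {t \<in> ?I. \<gamma> t = \<delta> t}" "t \<in> ?I" using eq t by auto
  ultimately show ?thesis by blast
qed

end

context hypersurface_speed
begin

text \<open>A local flow together with the facts that a normal variation will need: chartwise
  smoothness of the moved surface, normal velocity at all times, and initial normal speed
  \<open>u\<close>. Velocity is tested in all charts at once, so families can later be glued without
  recomputation.\<close>

definition trajectory_family :: "'p set \<Rightarrow> real \<Rightarrow> (real \<Rightarrow> 'p \<Rightarrow> 'p) \<Rightarrow> bool" where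
  "trajectory_family U T \<Phi> \<longleftrightarrow> open U \<and> 0 < T \<and> (\<forall>p\<in>U. \<Phi> 0 p = p) \<and>
    (\<forall>t p. \<bar>t\<bar> < T \<longrightarrow> p \<in> U \<longrightarrow> trajectory_at (\<lambda>t. \<Phi> t p) t) \<and>
    (\<forall>W \<theta>. (W, \<theta>) \<in> \<A> \<longrightarrow> smooth_on ({-T<..<T} \<times> (W \<inter> \<theta> -` U)) (\<lambda>(t, y). push t (\<Phi> t (\<theta> y)))) \<and>
    (\<forall>t p. \<bar>t\<bar> < T \<longrightarrow> p \<in> U \<longrightarrow> (\<exists>w. ((\<lambda>s. push s (\<Phi> s p)) has_vector_derivative w) (at t) \<and>
      (\<forall>W \<theta> y v. (W, \<theta>) \<in> \<A> \<longrightarrow> y \<in> W \<longrightarrow> \<theta> y = p \<longrightarrow>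
        w \<bullet> frechet_derivative (\<lambda>y. push t (\<Phi> t (\<theta> y))) (at y) v = 0) \<and> (t = 0 \<longrightarrow> w \<bullet> N p = u p)))"

text \<open>The flow of \<open>drift\<close> in one chart, read on the manifold. The choice of
  \<open>drift\<close> makes the velocity of the pushed point orthogonal to the whole slice, in
  particular to the tangent vectors of the reparametrized map.\<close>

lemma local_trajectories:
  obtains U T \<Phi> where "p0 \<in> U" "trajectory_family U T \<Phi>"
proof -
  obtain V \<psi> y0 where c: "(V, \<psi>) \<in> \<A>" "y0 \<in> V" "\<psi> y0 = p0" by (rule chart_cover[OF atlas])
  note f = chart_facts[OF atlas c(1)]
  obtain r T \<phi> where r: "0 < r" and T: "0 < T" and \<phi>s: "smooth_on ({-T<..<T} \<times> ball y0 r) \<phi>"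
    and \<phi>0: "\<And>y. y \<in> ball y0 r \<Longrightarrow> \<phi> (0, y) = y"
    and \<phi>: "\<And>t y. \<bar>t\<bar> < T \<Longrightarrow> y \<in> ball y0 r \<Longrightarrow> (t, \<phi> (t, y)) \<in> push_regular V \<psi> \<and>
       ((\<lambda>s. \<phi> (s, y)) has_vector_derivative drift \<psi> (t, \<phi> (t, y))) (at t)"
    by (rule smooth_local_flow[OF push_regular_open[OF c(1)] drift_smooth[OF c(1)] push_regular_zero[OF c(1,2)]]) (rule that)
  let ?B = "ball y0 r" and ?U = "\<psi> ` ball y0 r"
  have BV: "?B \<subseteq> V" using \<phi>[of 0] \<phi>0 T by (auto simp: push_regular_def)
  have U: "open ?U" by (rule chart_open_image[OF atlas c(1) open_ball BV])
  have p0: "p0 \<in> ?U" using c(3) r by auto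
  define \<Phi> where "\<Phi> t p = \<psi> (\<phi> (t, inv_into V \<psi> p))" for t p
  have inv: "inv_into V \<psi> p \<in> ?B" "\<psi> (inv_into V \<psi> p) = p" if "p \<in> ?U" for p
    using that BV f(3) by (auto simp: inv_into_f_f subset_iff)
  have \<phi>V: "\<phi> (t, y) \<in> V" if "\<bar>t\<bar> < T" "y \<in> ?B" for t y
    using \<phi>[OF that] by (auto simp: push_regular_def)
  have eps: "\<forall>\<^sub>F s in nhds t. \<bar>s\<bar> < T" if "\<bar>t\<bar> < T" for t
    using eventually_nhds_in_open[of "{-T<..<T}" t] that by (auto simp: abs_less_iff elim!: eventually_mono)
  have tr: "trajectory_at (\<lambda>t. \<Phi> t p) t" if t: "\<bar>t\<bar> < T" and p: "p \<in> ?U" for t p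
    unfolding trajectory_at_def
  proof (intro exI conjI)
    let ?y = "inv_into V \<psi> p"
    show "(V, \<psi>) \<in> \<A>" by (rule c(1))
    show "\<forall>\<^sub>F s in nhds t. \<phi> (s, ?y) \<in> V \<and> \<Phi> s p = \<psi> (\<phi> (s, ?y))"
      using eps[OF t] by eventually_elim (use \<phi>V[OF _ inv(1)[OF p]] in \<open>simp add: \<Phi>_def\<close>)
    show "(t, \<phi> (t, ?y)) \<in> push_regular V \<psi>"
      "((\<lambda>s. \<phi> (s, ?y)) has_vector_derivative drift \<psi> (t, \<phi> (t, ?y))) (at t)"
      using \<phi>[OF t inv(1)[OF p]] by auto
  qed
  have dom: "W \<inter> \<theta> -` ?U \<subseteq> transition_domain W \<theta> V \<psi>" "open (W \<inter> \<theta> -` ?U)"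
    "\<And>y. y \<in> W \<inter> \<theta> -` ?U \<Longrightarrow> transition \<theta> V \<psi> y \<in> ?B" if W: "(W, \<theta>) \<in> \<A>" for W \<theta>
  proof -
    show "W \<inter> \<theta> -` ?U \<subseteq> transition_domain W \<theta> V \<psi>" using BV by (auto simp: transition_domain_def)
    show "open (W \<inter> \<theta> -` ?U)"
      by (rule continuous_open_preimage[OF chart_facts(4,1)[OF atlas W] U])
    show "transition \<theta> V \<psi> y \<in> ?B" if "y \<in> W \<inter> \<theta> -` ?U" for y
      using inv(1)[of "\<theta> y"] that by (simp add: transition_def)
  qed
  have sm: "smooth_on ({-T<..<T} \<times> (W \<inter> \<theta> -` ?U)) (\<lambda>(t, y). push t (\<Phi> t (\<theta> y)))" if W: "(W, \<theta>) \<in> \<A>" for W \<theta>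
  proof -
    let ?S = "{-T<..<T} \<times> (W \<inter> \<theta> -` ?U)"
    have op: "open ?S" using dom(2)[OF W] by simp
    have "smooth_on (W \<inter> \<theta> -` ?U) (transition \<theta> V \<psi>)"
      by (rule smooth_on_subset[OF transition_smooth[OF atlas W c(1)] dom(1)[OF W]])
    from smooth_on_compose[OF op smooth_on_snd this]
    have 1: "smooth_on ?S (\<lambda>x. transition \<theta> V \<psi> (snd x))" by auto
    have "smooth_on ?S (\<lambda>x. \<phi> (fst x, transition \<theta> V \<psi> (snd x)))"
    proof (rule smooth_on_compose[OF op smooth_on_Pair[OF op smooth_on_fst 1] \<phi>s])
      show "(\<lambda>x. (fst x, transition \<theta> V \<psi> (snd x))) ` ?S \<subseteq> {-T<..<T} \<times> ?B"
      proof (rule image_subsetI)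
        fix x assume "x \<in> ?S"
        then have "fst x \<in> {-T<..<T}" "snd x \<in> W \<inter> \<theta> -` ?U" by (auto simp only: mem_Times_iff)
        with dom(3)[OF W] show "(fst x, transition \<theta> V \<psi> (snd x)) \<in> {-T<..<T} \<times> ?B" by blast
      qed
    qed
    from smooth_on_Pair[OF op smooth_on_fst this]
    have "smooth_on ?S (\<lambda>x. push_chart \<psi> (fst x, \<phi> (fst x, transition \<theta> V \<psi> (snd x))))"
    proof (rule smooth_on_compose[OF op _ push_chart_smooth[OF c(1)]])
      show "(\<lambda>x. (fst x, \<phi> (fst x, transition \<theta> V \<psi> (snd x)))) ` ?S \<subseteq> UNIV \<times> V"
      proof (rule image_subsetI)
        fix x assume "x \<in> ?S"
        then have "\<bar>fst x\<bar> < T" "snd x \<in> W \<inter> \<theta> -` ?U" by (auto simp: abs_less_iff)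
        with \<phi>V dom(3)[OF W] show "(fst x, \<phi> (fst x, transition \<theta> V \<psi> (snd x))) \<in> UNIV \<times> V" by blast
      qed
    qed
    then show ?thesis by (simp add: \<Phi>_def transition_def case_prod_unfold)
  qed
  have nrm: "\<exists>w. ((\<lambda>s. push s (\<Phi> s p)) has_vector_derivative w) (at t) \<and>
      (\<forall>W \<theta> y v. (W, \<theta>) \<in> \<A> \<longrightarrow> y \<in> W \<longrightarrow> \<theta> y = p \<longrightarrow>
        w \<bullet> frechet_derivative (\<lambda>y. push t (\<Phi> t (\<theta> y))) (at y) v = 0) \<and> (t = 0 \<longrightarrow> w \<bullet> N p = u p)"
    if t: "\<bar>t\<bar> < T" and p: "p \<in> ?U" for t p
  proof -
    let ?y = "inv_into V \<psi> p"
    note yB = inv(1)[OF p]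
    let ?x = "\<phi> (t, ?y)"
    let ?w = "Dpush \<psi> (t, ?x) (1, drift \<psi> (t, ?x))"
    have reg: "(t, ?x) \<in> push_regular V \<psi>" and xd: "((\<lambda>s. \<phi> (s, ?y)) has_vector_derivative drift \<psi> (t, ?x)) (at t)"
      using \<phi>[OF t yB] by auto
    have xV: "?x \<in> V" by (rule \<phi>V[OF t yB])
    have "((\<lambda>s. (s, \<phi> (s, ?y))) has_derivative (\<lambda>h. h *\<^sub>R (1, drift \<psi> (t, ?x)))) (at t)"
      using has_derivative_Pair[OF has_derivative_ident xd[unfolded has_vector_derivative_def]] by simp
    from has_derivative_compose[OF this, where g = "push_chart \<psi>", OF push_chart_derivative[OF c(1) xV]]
    have "((\<lambda>s. push s (\<Phi> s p)) has_derivative (\<lambda>h. Dpush \<psi> (t, ?x) (h *\<^sub>R (1, drift \<psi> (t, ?x))))) (at t)"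
      by (simp add: \<Phi>_def)
    then have 1: "((\<lambda>s. push s (\<Phi> s p)) has_vector_derivative ?w) (at t)"
      unfolding has_vector_derivative_def
      by (rule has_derivative_eq_rhs) (rule ext, rule linear_cmul[OF push_linear[OF c(1) xV]])
    have 2: "?w \<bullet> frechet_derivative (\<lambda>y. push t (\<Phi> t (\<theta> y))) (at y) v = 0"
      if W: "(W, \<theta>) \<in> \<A>" "y \<in> W" "\<theta> y = p" for W \<theta> y v
    proof -
      let ?\<tau> = "transition \<theta> V \<psi>"
      have yU: "y \<in> W \<inter> \<theta> -` ?U" using W p by simp
      have ty: "?\<tau> y = ?y" by (simp add: transition_def W)
      have "?\<tau> differentiable (at y)"
        by (rule transition_differentiable[OF atlas W(1) c(1)]) (use dom(1)[OF W(1)] yU in blast)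
      then have \<tau>d: "(?\<tau> has_derivative frechet_derivative ?\<tau> (at y)) (at y)" by (simp add: frechet_derivative_works)
      have "(t, ?y) \<in> {-T<..<T} \<times> ?B" using t yB by (auto simp: abs_less_iff)
      from frechet_derivative_slice(1)[OF smooth_on_has_derivative[OF \<phi>s this]]
      have "((\<lambda>z. \<phi> (t, z)) has_derivative (\<lambda>v. frechet_derivative \<phi> (at (t, ?y)) (0, v))) (at (?\<tau> y))" by (simp add: ty)
      from has_derivative_compose[OF \<tau>d this]
      have h: "((\<lambda>z. \<phi> (t, ?\<tau> z)) has_derivative (\<lambda>v. frechet_derivative \<phi> (at (t, ?y)) (0, frechet_derivative ?\<tau> (at y) v))) (at y)" .
      have "((\<lambda>z. push t (\<psi> z)) has_derivative (\<lambda>v. Dpush \<psi> (t, ?x) (0, v))) (at (\<phi> (t, ?\<tau> y)))"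
        using push_smooth_slice[OF c(1) xV, of t] by (simp add: ty o_def)
      from has_derivative_compose[OF h this]
      have "((\<lambda>y. push t (\<Phi> t (\<theta> y))) has_derivative
        (\<lambda>v. Dpush \<psi> (t, ?x) (0, frechet_derivative \<phi> (at (t, ?y)) (0, frechet_derivative ?\<tau> (at y) v)))) (at y)"
        by (simp add: \<Phi>_def transition_def)
      from fun_cong[OF frechet_derivative_at[OF this], of v]
      show ?thesis using drift_orthogonal[OF c(1) reg] by metis
    qed
    \<comment> \<open>At time zero the flow is the identity, and the drift contributes to the
      velocity only a vector tangent to \<open>X\<close>, which \<open>N\<close> does not
      see.\<close>
    have 3: "?w \<bullet> N p = u p" if "t = 0"
    proof -
      have x: "?x = ?y" using \<phi>0[OF yB] that by simp
      have yV: "?y \<in> V" using yB BV by blast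
      have p': "\<psi> ?y = p" by (rule inv(2)[OF p])
      let ?d = "drift \<psi> (0, ?y)"
      have "frechet_derivative (X \<circ> \<psi>) (at ?y) = (\<lambda>v. Dpush \<psi> (0, ?y) (0, v))"
        using frechet_derivative_at[OF push_smooth_slice[OF c(1) yV, of 0]] unfolding push_zero by (rule sym)
      from fun_cong[OF this, of ?d]
      have "Dpush \<psi> (0, ?y) (0, ?d) = frechet_derivative (X \<circ> \<psi>) (at ?y) ?d" by (rule sym)
      with Dpush_split[OF c(1) yV, of 0 ?d]
      have "Dpush \<psi> (0, ?y) (1, ?d) = u p *\<^sub>R N p + frechet_derivative (X \<circ> \<psi>) (at ?y) ?d"
        unfolding push_time_derivative[OF c(1) yV, of 0] p' by (rule trans[OF _ arg_cong])
      then have "?w = u p *\<^sub>R N p + frechet_derivative (X \<circ> \<psi>) (at ?y) ?d"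
        unfolding that x[unfolded that] .
      moreover have "frechet_derivative (X \<circ> \<psi>) (at ?y) (drift \<psi> (0, ?y)) \<bullet> N p = 0"
        using N_orthogonal[OF c(1) yV] p' by (simp add: inner_commute)
      moreover have "N p \<bullet> N p = 1" using N(2)[of p] by (simp add: norm_eq_1)
      ultimately show ?thesis by (simp add: inner_add_left)
    qed
    show ?thesis using 1 2 3 by blast
  qed
  show thesis
  proof (rule that[OF p0])
    have \<Phi>0: "\<Phi> 0 p = p" if "p \<in> ?U" for p
      using \<phi>0[OF inv(1)[OF that]] inv(2)[OF that] by (simp add: \<Phi>_def)
    show "trajectory_family ?U T \<Phi>"
      unfolding trajectory_family_def
    proof (intro conjI)
      show "\<forall>p\<in>?U. \<Phi> 0 p = p" by (intro ballI \<Phi>0)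
      show "\<forall>t p. \<bar>t\<bar> < T \<longrightarrow> p \<in> ?U \<longrightarrow> trajectory_at (\<lambda>t. \<Phi> t p) t"
        by (intro allI impI) (rule tr)
      show "\<forall>W \<theta>. (W, \<theta>) \<in> \<A> \<longrightarrow> smooth_on ({-T<..<T} \<times> (W \<inter> \<theta> -` ?U)) (\<lambda>(t, y). push t (\<Phi> t (\<theta> y)))"
        by (intro allI impI) (rule sm)
      show "\<forall>t p. \<bar>t\<bar> < T \<longrightarrow> p \<in> ?U \<longrightarrow> (\<exists>w. ((\<lambda>s. push s (\<Phi> s p)) has_vector_derivative w) (at t) \<and>
        (\<forall>W \<theta> y v. (W, \<theta>) \<in> \<A> \<longrightarrow> y \<in> W \<longrightarrow> \<theta> y = p \<longrightarrow>
          w \<bullet> frechet_derivative (\<lambda>y. push t (\<Phi> t (\<theta> y))) (at y) v = 0) \<and> (t = 0 \<longrightarrow> w \<bullet> N p = u p))"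
        by (intro allI impI) (rule nrm)
    qed (rule U, rule T)
  qed
qed

text \<open>Off the closed support, \<open>u\<close> vanishes on a whole neighbourhood. There
  \<open>push t\<close> is \<open>X\<close>, hence still regular, and its time derivative is 0, so
  the unique drift is 0.\<close>

lemma constant_trajectory:
  assumes "p \<notin> closure {p. u p \<noteq> 0}"
  shows "trajectory_at (\<lambda>t. p) t" "push t p = X p"
proof -
  let ?K = "closure {p. u p \<noteq> 0}"
  have u0: "u q = 0" if "q \<notin> ?K" for q using that closure_subset[of "{p. u p \<noteq> 0}"] by blast
  have push: "push t q = X q" if "q \<notin> ?K" for t q by (simp add: push_def u0[OF that])
  then show "push t p = X p" using assms by blast
  obtain V \<psi> y where c: "(V, \<psi>) \<in> \<A>" "y \<in> V" "\<psi> y = p" by (rule chart_cover[OF atlas])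
  note f = chart_facts[OF atlas c(1)]
  have op: "open (V \<inter> \<psi> -` (- ?K))"
    by (rule continuous_open_preimage[OF f(4,1) open_Compl[OF closed_closure]])
  have y: "y \<in> V \<inter> \<psi> -` (- ?K)" using c assms by simp
  have Xd: "(X \<circ> \<psi> has_derivative frechet_derivative (X \<circ> \<psi>) (at y)) (at y)"
    by (rule smooth_on_has_derivative[OF smooth_map_chart[OF X c(1)] c(2)])
  have "(push t \<circ> \<psi> has_derivative frechet_derivative (X \<circ> \<psi>) (at y)) (at y)"
    by (rule has_derivative_transform_within_open[OF Xd op y]) (simp add: push)
  from frechet_derivative_at[OF this] have "gram (push t \<circ> \<psi>) y = gram (X \<circ> \<psi>) y"
    by (simp add: gram_def partial_def)
  then have reg: "(t, y) \<in> push_regular V \<psi>"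
    using immersion_gram_pos[OF imm c(1,2)] c(2) by (simp add: push_regular_def push_gram[OF c(1,2)])
  have "Dpush \<psi> (t, y) (1, 0) = 0"
    unfolding push_time_derivative[OF c(1,2)] c(3) u0[OF assms] by simp
  then have dz: "drift \<psi> (t, y) = 0" using drift_unique[OF c(1) reg, of 0] by simp
  show "trajectory_at (\<lambda>t. p) t"
    unfolding trajectory_at_def
  proof (intro exI[of _ V] exI[of _ \<psi>] exI[of _ "\<lambda>t. y"] conjI)
    show "((\<lambda>t. y) has_vector_derivative drift \<psi> (t, y)) (at t)"
      unfolding dz by (rule has_vector_derivative_const)
    show "\<forall>\<^sub>F s in nhds t. y \<in> V \<and> p = \<psi> y" using c by simp
  qed (fact c(1) reg)+
qed

text \<open>Finitely many local flows cover the compact support and share a positive lifetime.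
  Uniqueness of trajectories makes them agree on overlaps, also with the constant trajectories off
  the support, so a single variation results.\<close>

theorem normal_variation_exists:
  assumes K: "compact (closure {p. u p \<noteq> 0})"
  obtains \<epsilon> F where "compact_normal_variation \<A> X \<epsilon> (closure {p. u p \<noteq> 0}) F"
    "\<And>p. vector_derivative (\<lambda>t. F t p) (at 0) \<bullet> N p = u p"
proof -
  let ?K = "closure {p. u p \<noteq> 0}"
  have "\<exists>U T \<Phi>. p0 \<in> U \<and> trajectory_family U T \<Phi>" for p0
    by (rule local_trajectories[of p0]) (intro exI conjI)
  from choice[OF allI[OF this]] obtain U where "\<forall>q. \<exists>T \<Phi>. q \<in> U q \<and> trajectory_family (U q) T \<Phi>" by (rule exE)
  from choice[OF this] obtain T where "\<forall>q. \<exists>\<Phi>. q \<in> U q \<and> trajectory_family (U q) (T q) \<Phi>" by (rule exE)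
  from choice[OF this] obtain \<Phi> where UT: "\<forall>q. q \<in> U q \<and> trajectory_family (U q) (T q) (\<Phi> q)" by (rule exE)
  have good: "trajectory_family (U q) (T q) (\<Phi> q)" for q using spec[OF UT, of q] by (rule conjunct2)
  have U: "open (U q)" for q using good[of q] unfolding trajectory_family_def by (elim conjE)
  have U': "q \<in> U q" for q using spec[OF UT, of q] by (rule conjunct1)
  have T: "0 < T q" for q using good[of q] unfolding trajectory_family_def by (elim conjE)
  note fam = good[unfolded trajectory_family_def, THEN conjunct2, THEN conjunct2]
  note \<Phi>0 = bspec[OF fam[THEN conjunct1]]
  note tr = fam[THEN conjunct2, THEN conjunct1, THEN spec, THEN spec, THEN mp, THEN mp]
  note sm = fam[THEN conjunct2, THEN conjunct2, THEN conjunct1, THEN spec, THEN spec, THEN mp]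
  note nrm = fam[THEN conjunct2, THEN conjunct2, THEN conjunct2, THEN spec, THEN spec, THEN mp, THEN mp]
  have cov: "?K \<subseteq> (\<Union>q\<in>?K. U q)" using U' by blast
  obtain D where D: "D \<subseteq> ?K" "finite D" "?K \<subseteq> (\<Union>q\<in>D. U q)"
    by (rule compactE_image[OF K U cov]) (rule that)
  \<comment> \<open>The entry 1 covers the case of empty support, where \<open>D\<close> may be
    empty.\<close>
  define \<epsilon> where "\<epsilon> = Min (insert 1 (T ` D))"
  have \<epsilon>: "0 < \<epsilon>" "\<And>q. q \<in> D \<Longrightarrow> \<epsilon> \<le> T q" using D(2) T by (auto simp: \<epsilon>_def)
  define is_orbit where "is_orbit p \<gamma> \<longleftrightarrow> \<gamma> 0 = p \<and> (\<forall>t. \<bar>t\<bar> < \<epsilon> \<longrightarrow> trajectory_at \<gamma> t)" for p \<gamma>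
  \<comment> \<open>The arbitrary choice is harmless: two orbits of the same point agree for all
    times below \<open>\<epsilon>\<close>, so each local formula computes the chosen orbit.\<close>
  define \<Psi> where "\<Psi> p = (SOME \<gamma>. is_orbit p \<gamma>)" for p
  have orbit_unique: "\<Psi> p t = \<gamma> t" if "is_orbit p \<gamma>" "\<bar>t\<bar> < \<epsilon>" for p \<gamma> t
  proof -
    have o: "is_orbit p (\<Psi> p)" unfolding \<Psi>_def using that(1) by (rule someI[of "is_orbit p"])
    show ?thesis
    proof (rule trajectories_unique[of \<epsilon> "\<Psi> p" \<gamma> t, OF conjI _ that(2)])
      show "trajectory_at (\<Psi> p) s" if "\<bar>s\<bar> < \<epsilon>" for s
        using o[unfolded is_orbit_def, THEN conjunct2, THEN spec, THEN mp, OF that] .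
      show "trajectory_at \<gamma> s" if "\<bar>s\<bar> < \<epsilon>" for s
        using \<open>is_orbit p \<gamma>\<close>[unfolded is_orbit_def, THEN conjunct2, THEN spec, THEN mp, OF that] .
      show "\<Psi> p 0 = \<gamma> 0"
        using o[unfolded is_orbit_def, THEN conjunct1] \<open>is_orbit p \<gamma>\<close>[unfolded is_orbit_def, THEN conjunct1] by (rule trans[OF _ sym])
    qed
  qed
  have inD: "\<Psi> p t = \<Phi> q t p" if "q \<in> D" "p \<in> U q" "\<bar>t\<bar> < \<epsilon>" for p q t
  proof (rule orbit_unique[OF _ that(3)])
    show "is_orbit p (\<lambda>t. \<Phi> q t p)"
      unfolding is_orbit_def using \<Phi>0[OF that(2)] tr[OF _ that(2)] \<epsilon>(2)[OF that(1)] by auto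
  qed
  have out: "\<Psi> p t = p" if "p \<notin> ?K" "\<bar>t\<bar> < \<epsilon>" for p t
    by (rule orbit_unique[OF _ that(2)]) (simp add: is_orbit_def constant_trajectory(1)[OF that(1)])
  define F where "F t p = push t (\<Psi> p t)" for t p
  have Fin: "F t p = push t (\<Phi> q t p)" if "q \<in> D" "p \<in> U q" "\<bar>t\<bar> < \<epsilon>" for q p t
    by (simp add: F_def inD[OF that])
  have Fout: "F t p = X p" if "p \<notin> ?K" "\<bar>t\<bar> < \<epsilon>" for p t
    by (simp add: F_def out[OF that] constant_trajectory(2)[OF that(1)])
  have tI: "\<bar>t\<bar> < \<epsilon>" if "t \<in> {-\<epsilon><..<\<epsilon>}" for t using that by (auto simp: abs_less_iff)
  \<comment> \<open>Both alternatives describe open sets, so smoothness and normality can be checked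
    on each separately.\<close>
  have cases: "(\<exists>q\<in>D. p \<in> U q) \<or> p \<notin> ?K" for p using D(3) by blast
  have smooth: "smooth_on ({-\<epsilon><..<\<epsilon>} \<times> W) (\<lambda>(t, y). F t (\<theta> y))" if W: "(W, \<theta>) \<in> \<A>" for W \<theta>
  proof (rule smooth_on_local)
    fix x assume x: "x \<in> {-\<epsilon><..<\<epsilon>} \<times> W"
    note fW = chart_facts[OF atlas W]
    show "\<exists>A. open A \<and> x \<in> A \<and> smooth_on A (\<lambda>(t, y). F t (\<theta> y))"
      using cases[of "\<theta> (snd x)"]
    proof
      assume "\<exists>q\<in>D. \<theta> (snd x) \<in> U q"
      then obtain q where q: "q \<in> D" "\<theta> (snd x) \<in> U q" by blast
      let ?A = "{-\<epsilon><..<\<epsilon>} \<times> (W \<inter> \<theta> -` U q)"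
      have op: "open ?A" using continuous_open_preimage[OF fW(4,1) U] by simp
      have "?A \<subseteq> {-T q<..<T q} \<times> (W \<inter> \<theta> -` U q)" using \<epsilon>(2)[OF q(1)] by auto
      from smooth_on_subset[OF sm[OF W] this] have "smooth_on ?A (\<lambda>(t, y). push t (\<Phi> q t (\<theta> y)))" .
      then have "smooth_on ?A (\<lambda>(t, y). F t (\<theta> y))"
        by (rule smooth_on_cong[OF op, THEN iffD1, rotated]) (use Fin[OF q(1)] tI in auto)
      then show ?thesis using op x q by (intro exI[of _ ?A]) auto
    next
      assume n: "\<theta> (snd x) \<notin> ?K"
      let ?A = "{-\<epsilon><..<\<epsilon>} \<times> (W \<inter> \<theta> -` (- ?K))"
      have op: "open ?A" using continuous_open_preimage[OF fW(4,1) open_Compl[OF closed_closure]] by simp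
      have "smooth_on ?A (\<lambda>x. (X \<circ> \<theta>) (snd x))"
        by (rule smooth_on_compose[OF op smooth_on_snd smooth_map_chart[OF X W]]) auto
      then have "smooth_on ?A (\<lambda>(t, y). F t (\<theta> y))"
        by (rule smooth_on_cong[OF op, THEN iffD1, rotated]) (use Fout tI in auto)
      then show ?thesis using op x n by (intro exI[of _ ?A]) auto
    qed
  qed
  have normal: "normal_at \<A> (F t) p (vector_derivative (\<lambda>s. F s p) (at t)) \<and>
      (t = 0 \<longrightarrow> vector_derivative (\<lambda>s. F s p) (at t) \<bullet> N p = u p)" if t: "\<bar>t\<bar> < \<epsilon>" for t p
    using cases[of p]
  proof
    have ev: "\<forall>\<^sub>F s in nhds t. \<bar>s\<bar> < \<epsilon>"
      using eventually_nhds_in_open[of "{-\<epsilon><..<\<epsilon>}" t] t by (auto simp: abs_less_iff elim!: eventually_mono)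
    {
      assume "\<exists>q\<in>D. p \<in> U q"
      then obtain q where q: "q \<in> D" "p \<in> U q" by blast
      have tq: "\<bar>t\<bar> < T q" using t \<epsilon>(2)[OF q(1)] by simp
      obtain w where w: "((\<lambda>s. push s (\<Phi> q s p)) has_vector_derivative w) (at t)"
        and orth: "\<And>W \<theta> y v. (W, \<theta>) \<in> \<A> \<Longrightarrow> y \<in> W \<Longrightarrow> \<theta> y = p \<Longrightarrow>
          w \<bullet> frechet_derivative (\<lambda>y. push t (\<Phi> q t (\<theta> y))) (at y) v = 0" and w0: "t = 0 \<Longrightarrow> w \<bullet> N p = u p"
        using nrm[OF tq q(2)] by blast
      have "\<forall>\<^sub>F s in nhds t. push s (\<Phi> q s p) = F s p"
        using ev by eventually_elim (simp add: Fin[OF q])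
      from vector_derivative_at[OF has_vector_derivative_eventually[OF w this]]
      have vd: "vector_derivative (\<lambda>s. F s p) (at t) = w" .
      have "normal_at \<A> (F t) p w"
        unfolding normal_at_def
      proof (safe)
        fix W \<theta> y v assume W: "(W, \<theta>) \<in> \<A>" "y \<in> W" and p: "p = \<theta> y"
        let ?A = "W \<inter> \<theta> -` U q"
        have op: "open ?A" by (rule continuous_open_preimage[OF chart_facts(4,1)[OF atlas W(1)] U])
        have yA: "y \<in> ?A" using W q p by simp
        have "(t, y) \<in> {-T q<..<T q} \<times> ?A" using tq yA by (auto simp: abs_less_iff)
        from frechet_derivative_slice(1)[OF smooth_on_has_derivative[OF sm[OF W(1)] this]]
        have d: "((\<lambda>y. push t (\<Phi> q t (\<theta> y))) has_derivative
            (\<lambda>v. frechet_derivative (\<lambda>(t, y). push t (\<Phi> q t (\<theta> y))) (at (t, y)) (0, v))) (at y)" by simp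
        have "frechet_derivative (F t \<circ> \<theta>) (at y) = frechet_derivative (\<lambda>y. push t (\<Phi> q t (\<theta> y))) (at y)"
          by (rule frechet_derivative_transform_within_open[symmetric, OF _ op yA])
            (use d in \<open>auto simp: differentiable_def Fin[OF q(1) _ t]\<close>)
        then show "w \<bullet> frechet_derivative (F t \<circ> \<theta>) (at y) v = 0" using orth[OF W p[symmetric]] by simp
      qed
      then show ?thesis unfolding vd using w0 by blast
    next
      assume n: "p \<notin> ?K"
      have "\<forall>\<^sub>F s in nhds t. X p = F s p" using ev by eventually_elim (simp add: Fout[OF n])
      from vector_derivative_at[OF has_vector_derivative_eventually[OF has_vector_derivative_const this]]
      have vd: "vector_derivative (\<lambda>s. F s p) (at t) = 0" .
      have up: "u p = 0" using n closure_subset[of "{p. u p \<noteq> 0}"] by blast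
      show ?thesis unfolding vd up by (simp add: normal_at_def case_prod_unfold)
    }
  qed
  show thesis
  proof (rule that[of \<epsilon> F])
    show "compact_normal_variation \<A> X \<epsilon> ?K F"
      unfolding compact_normal_variation_def
    proof (intro conjI)
      show "\<forall>p. F 0 p = X p"
      proof
        fix p
        show "F 0 p = X p" using cases[of p] Fin[of _ p 0] Fout[of p 0] \<Phi>0[of p] \<epsilon>(1) by (auto simp: push_zero)
      qed
    qed (use \<epsilon>(1) K smooth normal Fout tI in auto)
    show "vector_derivative (\<lambda>t. F t p) (at 0) \<bullet> N p = u p" for p
      using normal[of 0 p] \<epsilon>(1) by simp
  qed
qed

end

section \<open>Bump functions\<close>

text \<open>The flat function exp(-1/x) with a polynomial factor in 1/x. The factor makes the family
  closed under differentiation, so that smoothness is a single induction over all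
  polynomials.\<close>

definition flat_exp :: "real poly \<Rightarrow> real \<Rightarrow> real" where
  "flat_exp p x = (if 0 < x then poly p (1 / x) * exp (- (1 / x)) else 0)"

lemma poly_exp_decay: "((\<lambda>x::real. poly p x * exp (- x)) \<longlongrightarrow> 0) at_top"
proof -
  have "((\<lambda>x::real. \<Sum>i\<le>degree p. coeff p i * (x ^ i / exp x)) \<longlongrightarrow> (\<Sum>i\<le>degree p. coeff p i * 0)) at_top"
    by (intro tendsto_sum tendsto_mult tendsto_const tendsto_power_div_exp_0)
  moreover have "poly p x * exp (- x) = (\<Sum>i\<le>degree p. coeff p i * (x ^ i / exp x))" for x
    by (simp add: poly_altdef sum_distrib_left sum_distrib_right exp_minus divide_inverse mult_ac)
  ultimately show ?thesis by simp
qed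

lemma flat_exp_tendsto: "(flat_exp p \<longlongrightarrow> 0) (at 0)"
proof -
  have "filterlim (\<lambda>x::real. 1 / x) at_top (at_right 0)"
    using filterlim_inverse_at_top_right by (simp add: inverse_eq_divide)
  from filterlim_compose[OF poly_exp_decay this]
  have "((\<lambda>x. poly p (1 / x) * exp (- (1 / x))) \<longlongrightarrow> 0) (at_right 0)" .
  then have "(flat_exp p \<longlongrightarrow> 0) (at_right 0)"
    by (rule tendsto_cong[THEN iffD1, rotated]) (auto simp: flat_exp_def eventually_at_right_field intro!: exI[of _ 1])
  moreover have "(flat_exp p \<longlongrightarrow> 0) (at_left 0)"
    by (rule tendsto_eventually) (auto simp: flat_exp_def eventually_at_left_field intro!: exI[of _ "-1"])
  ultimately show ?thesis by (simp add: filterlim_split_at_real)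
qed

lemma flat_exp_derivative:
  "(flat_exp p has_real_derivative flat_exp ([:0, 0, 1:] * (p - pderiv p)) x) (at x)"
proof (cases "x = 0")
  case True
  \<comment> \<open>At 0 the difference quotient belongs to the same family, with one more factor
    1/x, and hence tends to 0.\<close>
  have "flat_exp p h / h = flat_exp ([:0, 1:] * p) h" for h
    by (simp add: flat_exp_def)
  then have "((\<lambda>h. (flat_exp p (0 + h) - flat_exp p 0) / h) \<longlongrightarrow> 0) (at 0)"
    using flat_exp_tendsto[of "[:0, 1:] * p"] by (simp add: flat_exp_def[of p 0])
  then show ?thesis using True by (simp add: DERIV_def flat_exp_def[of _ 0])
next
  case False
  then consider "0 < x" | "x < 0" by linarith
  then show ?thesis
  proof cases
    case 1
    have "((\<lambda>x. poly p (1 / x) * exp (- (1 / x))) has_real_derivative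
      poly (pderiv p) (1 / x) * (- (1 / x^2)) * exp (- (1 / x)) + exp (- (1 / x)) * (1 / x^2) * poly p (1 / x)) (at x)"
      using 1 by (auto intro!: derivative_eq_intros DERIV_chain2[OF poly_DERIV] simp: power2_eq_square)
    also have "poly (pderiv p) (1 / x) * (- (1 / x^2)) * exp (- (1 / x)) + exp (- (1 / x)) * (1 / x^2) * poly p (1 / x) =
      flat_exp ([:0, 0, 1:] * (p - pderiv p)) x"
      using 1 by (simp add: flat_exp_def power2_eq_square field_simps)
    finally show ?thesis
      by (rule has_field_derivative_transform_within_open[where S = "{0<..}"]) (use 1 in \<open>auto simp: flat_exp_def\<close>)
  next
    case 2
    have "flat_exp q x = 0" for q using 2 by (simp add: flat_exp_def)
    moreover have "(flat_exp p has_real_derivative 0) (at x)"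
      by (rule has_field_derivative_transform_within_open[where S = "{..<0}", OF DERIV_const[of 0]])
        (use 2 in \<open>auto simp: flat_exp_def\<close>)
    ultimately show ?thesis by simp
  qed
qed

lemma flat_exp_smooth: "smooth_on UNIV (flat_exp p)"
proof -
  have "C_k_on k UNIV (flat_exp p)" for k
  proof (induction k arbitrary: p)
    case 0
    show ?case using DERIV_isCont[OF flat_exp_derivative] by (simp add: continuous_on_eq_continuous_at)
  next
    case (Suc k)
    show ?case
      by (rule C_k_on_real_deriv[OF open_UNIV _ Suc])
        (use flat_exp_derivative in \<open>simp add: has_real_derivative_iff_has_vector_derivative[symmetric]\<close>)
  qed
  then show ?thesis by (simp add: smooth_on_def)
qed

text \<open>Built on the squared distance, which is smooth at the centre as well; positive exactly
  on the open ball of radius \<open>r\<close> when \<open>r\<close> is positive.\<close>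

definition bump :: "'a::euclidean_space \<Rightarrow> real \<Rightarrow> 'a \<Rightarrow> real" where
  "bump y0 r y = flat_exp 1 (r^2 - (y - y0) \<bullet> (y - y0))"

lemma bump_smooth: "smooth_on UNIV (bump y0 r)"
  unfolding bump_def[abs_def]
  by (rule smooth_on_compose[OF open_UNIV _ flat_exp_smooth])
    (auto intro!: smooth_on_diff smooth_on_inner)

lemma bump_pos: "0 < r \<Longrightarrow> 0 < bump y0 r y \<longleftrightarrow> y \<in> ball y0 r"
proof -
  assume r: "0 < r"
  have "(y - y0) \<bullet> (y - y0) < r^2 \<longleftrightarrow> norm (y - y0) < r"
    using r by (simp add: power2_norm_eq_inner[symmetric] not_le[symmetric] power_mono_iff)
  then show ?thesis by (auto simp: bump_def flat_exp_def dist_norm norm_minus_commute)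
qed

lemma bump_nonneg: "0 \<le> bump y0 r y"
  by (simp add: bump_def flat_exp_def)

context hypersurface
begin

section \<open>Test functions on the hypersurface\<close>

lemma smooth_map_add_scaled:
  fixes g h :: "'p \<Rightarrow> real"
  assumes "smooth_map \<A> g" "smooth_map \<A> h"
  shows "smooth_map \<A> (\<lambda>p. a * g p + b * h p)"
  unfolding smooth_map_def
proof clarify
  fix V \<psi> assume c: "(V, \<psi>) \<in> \<A>"
  note op = chart_facts(1)[OF atlas c]
  have "smooth_on V (\<lambda>y. a * (g \<circ> \<psi>) y + b * (h \<circ> \<psi>) y)"
    by (intro smooth_on_add smooth_on_mult op smooth_on_const smooth_map_chart[OF _ c] assms)
  then show "smooth_on V ((\<lambda>p. a * g p + b * h p) \<circ> \<psi>)" by (simp add: o_def)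
qed

abbreviation "\<mu> \<equiv> weighted_area_measure \<A> f X"

text \<open>A Euclidean bump is transplanted through one chart and extended by 0. Smoothness of the
  extension rests on the closed ball having compact, hence closed, image in the Hausdorff
  manifold.\<close>

lemma manifold_bump:
  assumes "open U" "p \<in> U"
  obtains \<phi> where "smooth_compact_support \<A> \<phi>" "\<And>q. 0 \<le> \<phi> q" "\<And>q. \<phi> q \<noteq> 0 \<Longrightarrow> q \<in> U"
    "0 < (LINT q|\<mu>. \<phi> q)" "\<And>h. continuous_on UNIV h \<Longrightarrow> integrable \<mu> (\<lambda>q. \<phi> q * h q)"
proof -
  obtain V \<psi> y0 where c: "(V, \<psi>) \<in> \<A>" "y0 \<in> V" "\<psi> y0 = p" by (rule chart_cover[OF atlas])
  note fc = chart_facts[OF atlas c(1)]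
  have "open (V \<inter> \<psi> -` U)" by (rule continuous_open_preimage[OF fc(4,1) assms(1)])
  moreover have "y0 \<in> V \<inter> \<psi> -` U" using c assms by simp
  ultimately obtain r where r: "0 < r" "cball y0 r \<subseteq> V \<inter> \<psi> -` U" using open_contains_cball by blast
  let ?C = "cball y0 r" and ?B = "ball y0 r"
  have CV: "?C \<subseteq> V" and BV: "?B \<subseteq> V" using r(2) ball_subset_cball by blast+
  define \<phi> where "\<phi> q = (if q \<in> \<psi> ` V then bump y0 r (inv_into V \<psi> q) else 0)" for q
  have \<phi>\<psi>: "\<phi> (\<psi> y) = bump y0 r y" if "y \<in> V" for y
    using that fc(3) by (simp add: \<phi>_def inv_into_f_f)
  have nz: "\<phi> q \<noteq> 0 \<longleftrightarrow> q \<in> \<psi> ` ?B" for q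
  proof
    assume "\<phi> q \<noteq> 0"
    then obtain y where y: "y \<in> V" "q = \<psi> y" by (auto simp: \<phi>_def split: if_splits)
    then have "0 < bump y0 r y" using \<open>\<phi> q \<noteq> 0\<close> \<phi>\<psi> bump_nonneg[of y0 r y] by simp
    then show "q \<in> \<psi> ` ?B" using y bump_pos[OF r(1)] by blast
  next
    assume "q \<in> \<psi> ` ?B"
    then obtain y where y: "y \<in> ?B" "q = \<psi> y" by blast
    then show "\<phi> q \<noteq> 0" using \<phi>\<psi>[of y] bump_pos[OF r(1), of y0 y] BV by auto
  qed
  have Cc: "compact (\<psi> ` ?C)"
    by (rule compact_continuous_image[OF continuous_on_subset[OF fc(4) CV] compact_cball])
  have Cl: "closed (\<psi> ` ?C)" by (rule compact_imp_closed[OF Cc])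
  have sub: "{q. \<phi> q \<noteq> 0} \<subseteq> \<psi> ` ?C" using nz ball_subset_cball by blast
  have sm: "smooth_map \<A> \<phi>"
    unfolding smooth_map_def
  proof clarify
    fix W \<theta> assume W: "(W, \<theta>) \<in> \<A>"
    note fW = chart_facts[OF atlas W]
    show "smooth_on W (\<phi> \<circ> \<theta>)"
    proof (rule smooth_on_local)
      fix x assume x: "x \<in> W"
      show "\<exists>A. open A \<and> x \<in> A \<and> smooth_on A (\<phi> \<circ> \<theta>)"
      proof (cases "\<theta> x \<in> \<psi> ` V")
        case True
        let ?A = "transition_domain W \<theta> V \<psi>"
        have op: "open ?A" by (rule transition_open[OF atlas W c(1)])
        have "smooth_on ?A (\<lambda>y. bump y0 r (transition \<theta> V \<psi> y))"
          by (rule smooth_on_compose[OF op transition_smooth[OF atlas W c(1)] bump_smooth]) simp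
        then have "smooth_on ?A (\<phi> \<circ> \<theta>)"
          by (rule smooth_on_cong[OF op, THEN iffD1, rotated])
            (simp add: \<phi>_def transition_domain_def transition_def)
        then show ?thesis using op x True by (intro exI[of _ ?A]) (simp add: transition_domain_def)
      next
        case False
        \<comment> \<open>A neighbourhood of \<open>x\<close> that misses the support: the image of
          the closed ball is closed and lies inside the chart that \<open>\<theta> x\<close>
          avoids.\<close>
        let ?A = "W \<inter> \<theta> -` (- \<psi> ` ?C)"
        have op: "open ?A" by (rule continuous_open_preimage[OF fW(4,1) open_Compl[OF Cl]])
        have "(\<phi> \<circ> \<theta>) y = 0" if "y \<in> ?A" for y using that sub by auto
        then have "smooth_on ?A (\<phi> \<circ> \<theta>)"
          using smooth_on_cong[OF op, of "\<phi> \<circ> \<theta>" "\<lambda>y. 0"] by simp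
        moreover have "x \<in> ?A" using x False CV by auto
        ultimately show ?thesis using op by blast
      qed
    qed
  qed
  have supp: "smooth_compact_support \<A> \<phi>"
    unfolding smooth_compact_support_def
  proof
    have "closure {q. \<phi> q \<noteq> 0} \<subseteq> \<psi> ` ?C" by (rule closure_minimal[OF sub Cl])
    then show "compact (closure {q. \<phi> q \<noteq> 0})"
      using compact_Int_closed[OF Cc closed_closure[of "{q. \<phi> q \<noteq> 0}"]] by (simp add: Int_absorb1)
  qed (rule sm)
  let ?P = "\<psi> ` ?B"
  have Pb: "?P \<in> sets borel" "?P \<subseteq> \<psi> ` V"
    using chart_open_image[OF atlas c(1) open_ball BV] BV by auto
  have pre: "V \<inter> \<psi> -` ?P = ?B" using BV fc(3) by (auto dest: inj_onD)
  have ind: "indicator ?P q * (\<phi> q * h q) = \<phi> q * h q" for q and h :: "'p \<Rightarrow> real"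
    using nz[of q] by (auto simp: indicator_def)
  have int: "integrable \<mu> (\<lambda>q. \<phi> q * h q)"
    and eq: "(LINT q|\<mu>. \<phi> q * h q) =
      (LINT y|lborel. indicator ?B y * (area_density X \<psi> y * exp (f (X (\<psi> y))) * (\<phi> (\<psi> y) * h (\<psi> y))))"
    and int': "integrable lborel (\<lambda>y. indicator ?B y * (area_density X \<psi> y * exp (f (X (\<psi> y))) * (\<phi> (\<psi> y) * h (\<psi> y))))"
    if h: "continuous_on UNIV h" for h
  proof -
    have \<phi>h: "(\<lambda>q. \<phi> q * h q) \<in> borel_measurable borel"
      by (intro borel_measurable_continuous_onI continuous_on_mult smooth_map_continuous[OF atlas sm] h)
    note w = weighted_area_measure_integral[OF atlas X c(1) Pb f_continuous \<phi>h, unfolded ind pre]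
    have cont: "continuous_on ?C (\<lambda>y. k (\<psi> y))" if "continuous_on UNIV k" for k :: "'p \<Rightarrow> 'z::topological_space"
      by (rule continuous_on_compose2[OF that continuous_on_subset[OF fc(4) CV]]) simp
    have fX: "continuous_on UNIV (\<lambda>q. f (X q))"
      by (rule continuous_on_compose2[OF f_continuous smooth_map_continuous[OF atlas X]]) simp
    show int': "integrable lborel (\<lambda>y. indicator ?B y * (area_density X \<psi> y * exp (f (X (\<psi> y))) * (\<phi> (\<psi> y) * h (\<psi> y))))"
      by (rule integrable_continuous_compact[OF _ compact_cball[of y0 r]])
        (auto intro!: continuous_intros cont fX h smooth_map_continuous[OF atlas sm]
          continuous_on_subset[OF area_density_continuous[OF X atlas c(1)] CV])
    then show "integrable \<mu> (\<lambda>q. \<phi> q * h q)" using w(2) by blast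
    show "(LINT q|\<mu>. \<phi> q * h q) =
      (LINT y|lborel. indicator ?B y * (area_density X \<psi> y * exp (f (X (\<psi> y))) * (\<phi> (\<psi> y) * h (\<psi> y))))"
      by (rule w(1))
  qed
  have pos: "0 < (LINT q|\<mu>. \<phi> q)"
  proof -
    let ?g = "\<lambda>y. indicator ?B y * (area_density X \<psi> y * exp (f (X (\<psi> y))) * \<phi> (\<psi> y)) :: real"
    have gi: "integrable lborel ?g" and ge: "(LINT q|\<mu>. \<phi> q) = (LINT y|lborel. ?g y)"
      using int'[of "\<lambda>q. 1"] eq[of "\<lambda>q. 1"] by simp_all
    have gpos: "0 < ?g y" if "y \<in> ?B" for y
    proof -
      have "y \<in> V" using that BV by blast
      then show ?thesis
        using immersion_gram_pos[OF imm c(1), of y] bump_pos[OF r(1), of y0 y] that \<phi>\<psi>[of y]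
        by (simp add: area_density_def)
    qed
    then have nn: "0 \<le> ?g y" for y by (cases "y \<in> ?B") (auto intro: less_imp_le)
    \<comment> \<open>A nonnegative integrand with integral 0 vanishes almost everywhere, but this
      one is positive on a ball of positive volume.\<close>
    have "(LINT y|lborel. ?g y) \<noteq> 0"
    proof
      assume "(LINT y|lborel. ?g y) = 0"
      then have "AE y in lborel. ?g y = 0"
        using integral_nonneg_eq_0_iff_AE[OF gi] nn by simp
      then have "AE y in lborel. y \<notin> ?B" by eventually_elim (use gpos in force)
      then have "emeasure lborel ?B = 0" by (subst (asm) AE_iff_measurable[of ?B]) auto
      then show False
        using r(1) unit_ball_vol_pos[of "real CARD('n)"] by (simp add: emeasure_ball)
    qed
    moreover have "0 \<le> (LINT y|lborel. ?g y)" using nn by simp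
    ultimately show ?thesis using ge by simp
  qed
  show thesis
  proof (rule that[OF supp _ _ pos int])
    show "0 \<le> \<phi> q" for q by (simp add: \<phi>_def bump_nonneg)
    show "q \<in> U" if q: "\<phi> q \<noteq> 0" for q
    proof -
      obtain y where "y \<in> ?B" "q = \<psi> y" using q unfolding nz by (rule imageE)
      then show ?thesis using r(2) by (auto simp: subset_iff)
    qed
  qed
qed

section \<open>Critical hypersurfaces\<close>

theorem first_variation_eq:
  assumes "smooth_compact_support \<A> u"
  shows "first_variation \<A> f X N u = (LINT p|\<mu>. u p * weighted_curvature p)"
proof -
  have u: "smooth_map \<A> u" and K: "compact (closure {p. u p \<noteq> 0})"
    using assms by (auto simp: smooth_compact_support_def)
  interpret hypersurface_speed \<A> X N f u by unfold_locales (rule u)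
  obtain \<epsilon> F where F: "compact_normal_variation \<A> X \<epsilon> (closure {p. u p \<noteq> 0}) F"
    "\<And>p. vector_derivative (\<lambda>t. F t p) (at 0) \<bullet> N p = u p"
    by (rule normal_variation_exists[OF K]) (rule that)
  show ?thesis
    unfolding first_variation_def
  proof (rule the_equality)
    show "\<exists>\<epsilon> K F. compact_normal_variation \<A> X \<epsilon> K F \<and>
     (\<forall>p. vector_derivative (\<lambda>t. F t p) (at 0) \<bullet> N p = u p) \<and>
     ((\<lambda>t. measure (weighted_area_measure \<A> f (F t)) K) has_real_derivative
       (LINT p|\<mu>. u p * weighted_curvature p)) (at 0)"
      using F first_variation_formula[OF F(1) u F(2)] by blast
    show "D = (LINT p|\<mu>. u p * weighted_curvature p)"
      if "\<exists>\<epsilon> K F. compact_normal_variation \<A> X \<epsilon> K F \<and>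
     (\<forall>p. vector_derivative (\<lambda>t. F t p) (at 0) \<bullet> N p = u p) \<and>
     ((\<lambda>t. measure (weighted_area_measure \<A> f (F t)) K) has_real_derivative D) (at 0)" for D
      using that first_variation_formula[OF _ u] DERIV_unique by blast
  qed
qed

theorem critical_iff_constant:
  "(\<forall>u. smooth_compact_support \<A> u \<and> (LINT p|\<mu>. u p) = 0 \<longrightarrow> first_variation \<A> f X N u = 0)
     \<longleftrightarrow> weighted_curvature constant_on UNIV"
proof
  assume "weighted_curvature constant_on UNIV"
  then obtain k where k: "\<And>p. weighted_curvature p = k" by (auto simp: constant_on_def)
  show "\<forall>u. smooth_compact_support \<A> u \<and> (LINT p|\<mu>. u p) = 0 \<longrightarrow> first_variation \<A> f X N u = 0"
    by (simp add: first_variation_eq k)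
next
  assume crit: "\<forall>u. smooth_compact_support \<A> u \<and> (LINT p|\<mu>. u p) = 0 \<longrightarrow> first_variation \<A> f X N u = 0"
  let ?h = weighted_curvature
  have "\<not> ?h p < ?h q" for p q
  proof
    assume "?h p < ?h q"
    then obtain a where a: "?h p < a" "a < ?h q" using dense by blast
    \<comment> \<open>Two separate levels leave a gap between the averages of the curvature over the
      two bumps.\<close>
    obtain b where b: "a < b" "b < ?h q" using a dense by blast
    note hc = weighted_curvature_continuous
    have op: "open {x. ?h x < a}" "open {x. b < ?h x}"
      using hc by (auto intro: open_Collect_less continuous_intros)
    obtain \<phi> where \<phi>: "smooth_compact_support \<A> \<phi>" "\<And>x. 0 \<le> \<phi> x" "\<And>x. \<phi> x \<noteq> 0 \<Longrightarrow> x \<in> {x. ?h x < a}"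
      "0 < (LINT x|\<mu>. \<phi> x)" "\<And>h. continuous_on UNIV h \<Longrightarrow> integrable \<mu> (\<lambda>x. \<phi> x * h x)"
      by (rule manifold_bump[OF op(1), of p]) (use a in simp, rule that)
    obtain \<eta> where \<eta>: "smooth_compact_support \<A> \<eta>" "\<And>x. 0 \<le> \<eta> x" "\<And>x. \<eta> x \<noteq> 0 \<Longrightarrow> x \<in> {x. b < ?h x}"
      "0 < (LINT x|\<mu>. \<eta> x)" "\<And>h. continuous_on UNIV h \<Longrightarrow> integrable \<mu> (\<lambda>x. \<eta> x * h x)"
      by (rule manifold_bump[OF op(2), of q]) (use b in simp, rule that)
    define I where "I = (LINT x|\<mu>. \<phi> x)"
    define J where "J = (LINT x|\<mu>. \<eta> x)"
    have IJ: "0 < I" "0 < J" using \<phi>(4) \<eta>(4) by (simp_all add: I_def J_def)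
    \<comment> \<open>Each bump is normalized to weighted integral 1, so the difference has mean
      zero and is an admissible speed.\<close>
    define u where "u x = (1 / J) * \<eta> x + (- 1 / I) * \<phi> x" for x
    have i\<phi>: "integrable \<mu> \<phi>" "integrable \<mu> (\<lambda>x. \<phi> x * ?h x)"
      and i\<eta>: "integrable \<mu> \<eta>" "integrable \<mu> (\<lambda>x. \<eta> x * ?h x)"
      using \<phi>(5)[of "\<lambda>x. 1"] \<phi>(5)[OF hc] \<eta>(5)[of "\<lambda>x. 1"] \<eta>(5)[OF hc] by simp_all
    have us: "smooth_compact_support \<A> u"
      unfolding smooth_compact_support_def
    proof
      show "smooth_map \<A> u"
        unfolding u_def[abs_def] using \<phi>(1) \<eta>(1)
        by (intro smooth_map_add_scaled) (simp_all add: smooth_compact_support_def)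
      let ?S = "closure {x. \<eta> x \<noteq> 0} \<union> closure {x. \<phi> x \<noteq> 0}"
      have S: "compact ?S" using \<phi>(1) \<eta>(1) by (auto simp: smooth_compact_support_def)
      have "{x. u x \<noteq> 0} \<subseteq> {x. \<eta> x \<noteq> 0} \<union> {x. \<phi> x \<noteq> 0}" by (auto simp: u_def)
      then have "closure {x. u x \<noteq> 0} \<subseteq> ?S" unfolding closure_Un[symmetric] by (rule closure_mono)
      then show "compact (closure {x. u x \<noteq> 0})"
        using compact_Int_closed[OF S closed_closure[of "{x. u x \<noteq> 0}"]] by (simp add: Int_absorb1)
    qed
    have "(LINT x|\<mu>. u x) = (1 / J) * J + (- 1 / I) * I"
      unfolding u_def by (subst Bochner_Integration.integral_add) (use i\<phi> i\<eta> in \<open>simp_all add: I_def J_def\<close>)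
    then have "(LINT x|\<mu>. u x) = 0" using IJ by simp
    with crit us have "(LINT x|\<mu>. u x * ?h x) = 0" using first_variation_eq[OF us] by simp
    moreover have "(LINT x|\<mu>. u x * ?h x) = (1 / J) * (LINT x|\<mu>. \<eta> x * ?h x) + (- 1 / I) * (LINT x|\<mu>. \<phi> x * ?h x)"
    proof -
      have "u x * ?h x = (1 / J) * (\<eta> x * ?h x) + (- 1 / I) * (\<phi> x * ?h x)" for x
        by (simp add: u_def algebra_simps)
      then have "(LINT x|\<mu>. u x * ?h x) = (LINT x|\<mu>. (1 / J) * (\<eta> x * ?h x) + (- 1 / I) * (\<phi> x * ?h x))" by presburger
      also have "\<dots> = (LINT x|\<mu>. (1 / J) * (\<eta> x * ?h x)) + (LINT x|\<mu>. (- 1 / I) * (\<phi> x * ?h x))"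
        by (intro Bochner_Integration.integral_add integrable_mult_right i\<eta> i\<phi>)
      finally show ?thesis by (simp only: integral_mult_right_zero)
    qed
    moreover have "b \<le> (LINT x|\<mu>. \<eta> x * ?h x) / J"
    proof -
      have "(LINT x|\<mu>. b * \<eta> x) \<le> (LINT x|\<mu>. \<eta> x * ?h x)"
      proof (rule integral_mono)
        show "b * \<eta> x \<le> \<eta> x * ?h x" for x
          using \<eta>(2,3)[of x] by (cases "\<eta> x = 0") (auto intro: mult_left_mono simp: mult.commute[of b])
      qed (use i\<eta> in auto)
      then show ?thesis using IJ by (simp add: J_def pos_le_divide_eq)
    qed
    moreover have "(LINT x|\<mu>. \<phi> x * ?h x) / I \<le> a"
    proof -
      have "(LINT x|\<mu>. \<phi> x * ?h x) \<le> (LINT x|\<mu>. a * \<phi> x)"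
      proof (rule integral_mono)
        show "\<phi> x * ?h x \<le> a * \<phi> x" for x
          using \<phi>(2,3)[of x] by (cases "\<phi> x = 0") (auto intro: mult_left_mono simp: mult.commute[of a])
      qed (use i\<phi> in auto)
      then show ?thesis using IJ by (simp add: I_def pos_divide_le_eq)
    qed
    \<comment> \<open>Vanishing of the first variation says that the two averages of the curvature
      coincide; one is at least \<open>b\<close>, the other at most \<open>a\<close>.\<close>
    ultimately have "b \<le> a" by simp
    with b show False by simp
  qed
  then show "?h constant_on UNIV" unfolding constant_on_def by (metis linorder_neqE_linordered_idom)
qed

end

theorem lemma1p2:
  fixes \<A> :: "('n::finite, 'p::{t2_space,second_countable_topology}) atlas"
    and X N :: "'p \<Rightarrow> real^'m::finite"
    and f :: "real^'m \<Rightarrow> real"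
  assumes "smooth_on UNIV f"
    and "two_sided_proper_hypersurface \<A> X N"
  shows "(\<forall>u. smooth_compact_support \<A> u \<and> (LINT p|weighted_area_measure \<A> f X. u p) = 0
            \<longrightarrow> first_variation \<A> f X N u = 0)
     \<longleftrightarrow> (\<lambda>p. mean_curvature \<A> X N p + gradient f (X p) \<bullet> N p) constant_on UNIV"
proof -
  interpret hypersurface \<A> X N f by unfold_locales (use assms in auto)
  show ?thesis
    using critical_iff_constant unfolding weighted_curvature_def[abs_def] .
qed

end
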